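(* For all $0<\epsilon<1$ and any pair of channels $\mathcal{N},\mathcal{M}:A\to B$ between finite-dimensional systems, $$\liminf_{n\to\infty}\frac1n D^\epsilon_{\max}(\mathcal{N}^{\otimes n}\|\mathcal{M}^{\otimes n})\ge D(\mathcal{N}\|\mathcal{M}),$$ where $D(\mathcal{N}\|\mathcal{M})=\sup_C\sup_{\rho\in\mathcal{S}(A\otimes C)}D\bigl((\mathcal{N}\otimes\mathrm{id}_C)(\rho)\,\|\,(\mathcal{M}\otimes\mathrm{id}_C)(\rho)\bigr)$, with $C$ ranging over auxiliary systems and $D(\rho\|\sigma)$ the quantum (Umegaki) relative entropy of states.
   Context: $\mathcal{S}(A)$ denotes the set of density operators on $A$; $\|\cdot\|_\diamond$ is the diamond norm. For completely positive maps $\mathcal{N},\mathcal{M}:A\to B$, $D_{\max}(\mathcal{N}\|\mathcal{M})=\log\min\{\lambda:\lambda\mathcal{M}-\mathcal{N}\text{ is completely positive}\}$ ($+\infty$ if no such $\lambda$), and for channels the $\epsilon$-smooth version is $D^\epsilon_{\max}(\mathcal{N}\|\mathcal{M})=\inf\{D_{\max}(\mathcal{N}'\|\mathcal{M}):\mathcal{N}'\text{ a channel }A\to B,\ \tfrac12\|\mathcal{N}'-\mathcal{N}\|_\diamond\le\epsilon\}$. *)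

theory Defs
  imports Complex_Main "Jordan_Normal_Form.Matrix" "Jordan_Normal_Form.Matrix_Kernel"
    "HOL-Library.Extended_Real" "HOL-Library.Liminf_Limsup"
begin

text \<open>Finite-dimensional quantum systems are identified with their dimension d;
operators on a d-dimensional system are complex d x d matrices. The tensor
product of systems of dimensions d1, d2 uses the index (i,k) |-> i*d2 + k.\<close>

definition mtrace :: "complex mat \<Rightarrow> complex" where
  "mtrace A = (\<Sum>i<dim_row A. A $$ (i,i))"

definition adj :: "complex mat \<Rightarrow> complex mat" where
  "adj A = Matrix.mat (dim_col A) (dim_row A) (\<lambda>(i,j). cnj (A $$ (j,i)))"

definition unitary_mat :: "nat \<Rightarrow> complex mat \<Rightarrow> bool" where
  "unitary_mat n U \<longleftrightarrow> U \<in> carrier_mat n n \<and> adj U * U = 1\<^sub>m n"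

definition psd :: "nat \<Rightarrow> complex mat \<Rightarrow> bool" where
  "psd n A \<longleftrightarrow> A \<in> carrier_mat n n \<and>
     (\<forall>v \<in> carrier_vec n. let z = (\<Sum>i<n. cnj (v $ i) * (A *\<^sub>v v) $ i) in Im z = 0 \<and> Re z \<ge> 0)"

definition density :: "nat \<Rightarrow> complex mat \<Rightarrow> bool" where
  "density n \<rho> \<longleftrightarrow> psd n \<rho> \<and> mtrace \<rho> = 1"

text \<open>functional calculus for Hermitian matrices via a unitary diagonalisation
  (independent of the chosen diagonalisation)\<close>
definition mfun :: "(real \<Rightarrow> real) \<Rightarrow> complex mat \<Rightarrow> complex mat" where
  "mfun f A = (let n = dim_row A in
     (SOME B. \<exists>U ev. unitary_mat n U \<and>
        A = U * mat_diag n (\<lambda>i. complex_of_real (ev i)) * adj U \<and>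
        B = U * mat_diag n (\<lambda>i. complex_of_real (f (ev i))) * adj U))"

definition tnorm :: "complex mat \<Rightarrow> real" where
  "tnorm X = Re (mtrace (mfun sqrt (adj X * X)))"

definition ln_supp :: "real \<Rightarrow> real" where
  "ln_supp x = (if x > 0 then ln x else 0)"

definition rel_ent :: "complex mat \<Rightarrow> complex mat \<Rightarrow> ereal" where
  "rel_ent \<rho> \<sigma> = (if mat_kernel \<sigma> \<subseteq> mat_kernel \<rho>
      then ereal (Re (mtrace (\<rho> * (mfun ln_supp \<rho> - mfun ln_supp \<sigma>))))
      else \<infinity>)"

definition kron :: "complex mat \<Rightarrow> complex mat \<Rightarrow> complex mat" where
  "kron A B = Matrix.mat (dim_row A * dim_row B) (dim_col A * dim_col B)
     (\<lambda>(i,j). A $$ (i div dim_row B, j div dim_col B) * B $$ (i mod dim_row B, j mod dim_col B))"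

definition munit :: "nat \<Rightarrow> nat \<Rightarrow> nat \<Rightarrow> complex mat" where
  "munit n i j = Matrix.mat n n (\<lambda>(r,c). if r = i \<and> c = j then 1 else 0)"

text \<open>tensor product N \<otimes> M of linear maps N: a1 -> b1 and M: a2 -> b2,
  defined by linearity from matrix units\<close>
definition tensor_map :: "nat \<Rightarrow> nat \<Rightarrow> nat \<Rightarrow> nat \<Rightarrow>
    (complex mat \<Rightarrow> complex mat) \<Rightarrow> (complex mat \<Rightarrow> complex mat) \<Rightarrow> complex mat \<Rightarrow> complex mat" where
  "tensor_map a1 b1 a2 b2 N M X = Matrix.mat (b1 * b2) (b1 * b2) (\<lambda>(r,c).
     \<Sum>i<a1. \<Sum>j<a1. \<Sum>k<a2. \<Sum>l<a2.
       X $$ (i * a2 + k, j * a2 + l) * kron (N (munit a1 i j)) (M (munit a2 k l)) $$ (r,c))"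

definition lin_map :: "nat \<Rightarrow> nat \<Rightarrow> (complex mat \<Rightarrow> complex mat) \<Rightarrow> bool" where
  "lin_map a b N \<longleftrightarrow> (\<forall>X \<in> carrier_mat a a. N X \<in> carrier_mat b b) \<and>
     (\<forall>X \<in> carrier_mat a a. \<forall>Y \<in> carrier_mat a a. N (X + Y) = N X + N Y) \<and>
     (\<forall>X \<in> carrier_mat a a. \<forall>z. N (z \<cdot>\<^sub>m X) = z \<cdot>\<^sub>m N X)"

definition comp_pos :: "nat \<Rightarrow> nat \<Rightarrow> (complex mat \<Rightarrow> complex mat) \<Rightarrow> bool" where
  "comp_pos a b N \<longleftrightarrow> lin_map a b N \<and>
     (\<forall>c \<rho>. psd (a * c) \<rho> \<longrightarrow> psd (b * c) (tensor_map a b c c N (\<lambda>X. X) \<rho>))"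

definition channel :: "nat \<Rightarrow> nat \<Rightarrow> (complex mat \<Rightarrow> complex mat) \<Rightarrow> bool" where
  "channel a b N \<longleftrightarrow> comp_pos a b N \<and> (\<forall>X \<in> carrier_mat a a. mtrace (N X) = mtrace X)"

definition diamond :: "nat \<Rightarrow> nat \<Rightarrow> (complex mat \<Rightarrow> complex mat) \<Rightarrow> real" where
  "diamond a b \<Phi> = Sup {tnorm (tensor_map a b a a \<Phi> (\<lambda>X. X) X) | X.
      X \<in> carrier_mat (a * a) (a * a) \<and> tnorm X \<le> 1}"

definition Dmax :: "nat \<Rightarrow> nat \<Rightarrow> (complex mat \<Rightarrow> complex mat) \<Rightarrow> (complex mat \<Rightarrow> complex mat) \<Rightarrow> ereal" where
  "Dmax a b N M = (let S = {t::real. comp_pos a b (\<lambda>X. t \<cdot>\<^sub>m M X - N X)} in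
     if S = {} then \<infinity> else ereal (ln (Inf S)))"

definition Dmax_eps :: "nat \<Rightarrow> nat \<Rightarrow> real \<Rightarrow> (complex mat \<Rightarrow> complex mat) \<Rightarrow> (complex mat \<Rightarrow> complex mat) \<Rightarrow> ereal" where
  "Dmax_eps a b \<epsilon> N M = Inf {Dmax a b N' M | N'.
      channel a b N' \<and> diamond a b (\<lambda>X. N' X - N X) / 2 \<le> \<epsilon>}"

primrec tpow :: "nat \<Rightarrow> nat \<Rightarrow> (complex mat \<Rightarrow> complex mat) \<Rightarrow> nat \<Rightarrow> complex mat \<Rightarrow> complex mat" where
  "tpow a b N 0 = (\<lambda>X. X)"
| "tpow a b N (Suc n) = tensor_map a b (a ^ n) (b ^ n) N (tpow a b N n)"

definition chan_rel_ent :: "nat \<Rightarrow> nat \<Rightarrow> (complex mat \<Rightarrow> complex mat) \<Rightarrow> (complex mat \<Rightarrow> complex mat) \<Rightarrow> ereal" where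
  "chan_rel_ent a b N M = Sup {rel_ent (tensor_map a b c c N (\<lambda>X. X) \<rho>) (tensor_map a b c c M (\<lambda>X. X) \<rho>)
      | c \<rho>. c > 0 \<and> density (a * c) \<rho>}"

end

theory Submission
  imports Defs "Jordan_Normal_Form.Spectral_Radius" "HOL-Analysis.L2_Norm"
begin

text \<open>Let \<open>r\<close> and \<open>s\<close> be the outputs of N and M on a state of A C, with eigenvectors \<open>u\<close> and \<open>w\<close>,
  and let \<open>\<Pi>\<^sub>1\<close> be the typical projection of the n-fold power of \<open>r\<close>, which has rank at most
  \<open>exp (n (H(r) + \<delta>))\<close>. Let \<open>\<Pi>\<^sub>2\<close> project onto the products of the \<open>w\<close> whose eigenvalue for the
  power of \<open>s\<close> is at most \<open>exp (n (Tr(r log s) + \<delta>))\<close>. By the law of large numbers the power of \<open>r\<close>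
  almost lies in both ranges, so the test \<open>T = \<Pi>\<^sub>2 \<Pi>\<^sub>1 \<Pi>\<^sub>2\<close> accepts it with probability close to 1,
  whereas it accepts the power of \<open>s\<close> with weight at most \<open>exp (- n (D(r||s) - 2 \<delta>))\<close>. A channel N'
  that is \<open>\<epsilon>\<close>-close to the power of N still passes \<open>T\<close> with probability about \<open>1 - \<epsilon>\<close>; if
  \<open>t M\<close> dominates N', this forces \<open>t \<ge> (1 - \<epsilon>) / 2 * exp (n (D(r||s) - 2 \<delta>))\<close>. If the kernel of \<open>s\<close> is not
  contained in that of \<open>r\<close>, the eigenvalue 0 of \<open>s\<close> may be replaced by \<open>exp (- K)\<close> for any K, which
  makes the exponent arbitrarily large.\<close>

section \<open>Spectral theorem for Hermitian matrices\<close>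

text \<open>The outputs \<open>r\<close> and \<open>s\<close> need not commute, so no joint
  eigenbasis supports a likelihood-ratio test. Two classical distributions stand in for it: the
  eigenvalues \<open>p\<close> of \<open>r\<close>, and \<open>P j\<close>, the probability of
  outcome j when \<open>r\<close> is measured in the eigenbasis of \<open>s\<close>, under which ln
  q has mean Tr(r log s). The outer \<open>\<Pi>\<^sub>2\<close> restricts T to small eigenvalues of
  the power of \<open>s\<close>, so rank times eigenvalue bounds its weight. Two mismatches shape
  the rest. \<open>diamond\<close> uses a reference of the input dimension, while the test acts on a
  power of an arbitrary C. And \<open>tpow\<close> with a reference is ordered B...B C...C, while a
  power of \<open>r\<close> is ordered (B C)...(B C); so matrices become functions on index sets,
  tuples serve as indices, and one regrouping bijection links both orders. Smoothing bounds half the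
  diamond norm. The test therefore enters as the contraction 2 T - 1: as traces agree, it sees twice
  the change of acceptance, and the loss is \<epsilon>. Each of the two tails is counted twice by
  gentle measurement; keeping both below (1 - \<epsilon>) / 8 leaves (1 - \<epsilon>) / 2.\<close>

lemma adj_carrier [simp]: "A \<in> carrier_mat n m \<Longrightarrow> adj A \<in> carrier_mat m n"
  unfolding adj_def by auto

lemma adj_index [simp]:
  "A \<in> carrier_mat n m \<Longrightarrow> i < m \<Longrightarrow> j < n \<Longrightarrow> adj A $$ (i, j) = cnj (A $$ (j, i))"
  unfolding adj_def by auto

lemma adj_adj [simp]: "adj (adj A) = A"
  unfolding adj_def by (intro eq_matI) auto

lemma mult_mat_index_sum:
  assumes "A \<in> carrier_mat n m" "B \<in> carrier_mat m k" "i < n" "j < k"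
  shows "(A * B) $$ (i, j) = (\<Sum>l<m. A $$ (i, l) * B $$ (l, j))"
  using assms by (auto simp: scalar_prod_def atLeast0LessThan)

lemma mult_mat_vec_index_sum:
  assumes "A \<in> carrier_mat n m" "v \<in> carrier_vec m" "i < n"
  shows "(A *\<^sub>v v) $ i = (\<Sum>l<m. A $$ (i, l) * v $ l)"
  using assms by (auto simp: scalar_prod_def atLeast0LessThan)

lemma adj_mult:
  assumes "A \<in> carrier_mat n m" "B \<in> carrier_mat m k"
  shows "adj (A * B) = adj B * adj A"
proof (rule eq_matI)
  fix i j assume "i < dim_row (adj B * adj A)" "j < dim_col (adj B * adj A)"
  then have ij: "i < k" "j < n" using assms by (auto simp: adj_def)
  have "adj (A * B) $$ (i, j) = cnj ((A * B) $$ (j, i))"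
    using assms ij by (intro adj_index[of _ n k]) auto
  also have "\<dots> = (\<Sum>l<m. adj B $$ (i, l) * adj A $$ (l, j))"
    using assms ij by (simp add: mult_mat_index_sum[OF assms ij(2) ij(1)] mult.commute)
  also have "\<dots> = (adj B * adj A) $$ (i, j)"
    using assms ij by (subst mult_mat_index_sum[of _ k m _ n]) auto
  finally show "adj (A * B) $$ (i, j) = (adj B * adj A) $$ (i, j)" .
qed (use assms in \<open>auto simp: adj_def\<close>)

lemma unitary_mat_adj:
  assumes "unitary_mat n U" shows "U * adj U = 1\<^sub>m n"
  using assms mat_mult_left_right_inverse[of "adj U" n U] unfolding unitary_mat_def by auto

lemma unitary_mat_mult:
  assumes "unitary_mat n U" "unitary_mat n V" shows "unitary_mat n (U * V)"
proof -
  have c: "U \<in> carrier_mat n n" "V \<in> carrier_mat n n"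
    using assms unfolding unitary_mat_def by auto
  have "adj (U * V) * (U * V) = adj V * adj U * (U * V)"
    using c by (subst adj_mult) auto
  also have "\<dots> = adj V * (adj U * U * V)"
    using c by (simp add: assoc_mult_mat[of _ n n _ n _ n] mult_carrier_mat[of _ n n _ n])
  also have "\<dots> = 1\<^sub>m n"
    using assms c unfolding unitary_mat_def by auto
  finally show ?thesis using c unfolding unitary_mat_def by auto
qed

section \<open>Vectors and unitaries over arbitrary index sets\<close>

definition sqnorm :: "'i set \<Rightarrow> ('i \<Rightarrow> complex) \<Rightarrow> real" where
  "sqnorm I f = (\<Sum>x\<in>I. (cmod (f x))\<^sup>2)"

lemma sqnorm_nonneg [simp]: "0 \<le> sqnorm I f"
  unfolding sqnorm_def by (simp add: sum_nonneg)

lemma of_real_sqnorm: "complex_of_real (sqnorm I f) = (\<Sum>x\<in>I. cnj (f x) * f x)"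
  unfolding sqnorm_def of_real_sum
  by (intro sum.cong refl) (metis complex_norm_square mult.commute)

text \<open>Two-argument functions on any index set, so that pairs and tuples can index tensor
  products directly. Orthonormality and completeness of the columns are both demanded, so that
  neither has to be derived from the other after passing to tensor powers.\<close>

definition unitary_ker :: "'i set \<Rightarrow> ('i \<Rightarrow> 'i \<Rightarrow> complex) \<Rightarrow> bool" where
  "unitary_ker I U \<longleftrightarrow>
     (\<forall>k\<in>I. \<forall>l\<in>I. (\<Sum>x\<in>I. cnj (U x k) * U x l) = of_bool (k = l)) \<and>
     (\<forall>x\<in>I. \<forall>y\<in>I. (\<Sum>k\<in>I. U x k * cnj (U y k)) = of_bool (x = y))"

lemma unitary_mat_ker:
  assumes "unitary_mat n U" shows "unitary_ker {..<n} (\<lambda>x k. U $$ (x, k))"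
  unfolding unitary_ker_def
proof (intro conjI ballI)
  have c: "U \<in> carrier_mat n n" "adj U \<in> carrier_mat n n"
    using assms unfolding unitary_mat_def by auto
  fix k l assume kl: "k \<in> {..<n}" "l \<in> {..<n}"
  have "(adj U * U) $$ (k, l) = of_bool (k = l)"
    using assms kl unfolding unitary_mat_def by auto
  then show "(\<Sum>x<n. cnj (U $$ (x, k)) * U $$ (x, l)) = of_bool (k = l)"
    using c kl by (subst (asm) mult_mat_index_sum[OF c(2,1)]) auto
  have "(U * adj U) $$ (k, l) = of_bool (k = l)"
    using unitary_mat_adj[OF assms] kl by auto
  then show "(\<Sum>x<n. U $$ (k, x) * cnj (U $$ (l, x))) = of_bool (k = l)"
    using c kl by (subst (asm) mult_mat_index_sum[OF c]) auto
qed

lemma sum_of_bool_eq [simp]: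
  "finite I \<Longrightarrow> k \<in> I \<Longrightarrow> (\<Sum>x\<in>I. of_bool (k = x) * f x) = (f k :: complex)"
  "finite I \<Longrightarrow> k \<in> I \<Longrightarrow> (\<Sum>x\<in>I. of_bool (x = k) * f x) = (f k :: complex)"
  by (auto simp: of_bool_def if_distrib[of "\<lambda>u. u * _"] cong: if_cong)

lemma unitary_mat_kerI:
  assumes "U \<in> carrier_mat n n"
    and "\<And>k l. k < n \<Longrightarrow> l < n \<Longrightarrow> (\<Sum>x<n. cnj (U $$ (x, k)) * U $$ (x, l)) = of_bool (k = l)"
  shows "unitary_mat n U"
  unfolding unitary_mat_def
proof (intro conjI eq_matI)
  fix i j assume "i < dim_row (1\<^sub>m n)" "j < dim_col (1\<^sub>m n)"
  then show "(adj U * U) $$ (i, j) = 1\<^sub>m n $$ (i, j)"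
    using assms by (subst mult_mat_index_sum[of _ n n]) auto
qed (use assms in \<open>auto simp: adj_def\<close>)

lemma diag_conj_index:
  assumes "U \<in> carrier_mat n n" "x < n" "y < n"
  shows "(U * mat_diag n d * adj U) $$ (x, y) = (\<Sum>k<n. d k * U $$ (x, k) * cnj (U $$ (y, k)))"
proof -
  have "(U * mat_diag n d * adj U) $$ (x, y)
      = (\<Sum>k<n. (U * mat_diag n d) $$ (x, k) * adj U $$ (k, y))"
    using assms by (subst mult_mat_index_sum[of _ n n]) auto
  also have "\<dots> = (\<Sum>k<n. d k * U $$ (x, k) * cnj (U $$ (y, k)))"
    using assms by (intro sum.cong refl) (auto simp: mat_diag_mult_right[of U n n])
  finally show ?thesis .
qed

text \<open>The Householder reflection that swaps v with a phase multiple of the first basis vector.\<close>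

lemma unitary_with_first_column:
  fixes v :: "complex vec"
  assumes v: "v \<in> carrier_vec (Suc m)" and nv: "sqnorm {..<Suc m} (($) v) = 1"
  shows "\<exists>Q \<alpha>. unitary_mat (Suc m) Q \<and> \<alpha> \<noteq> 0 \<and> (\<forall>i<Suc m. Q $$ (i, 0) = \<alpha> * v $ i)"
proof -
  let ?n = "Suc m"
  \<comment> \<open>This phase makes the overlap of v with \<alpha> times the first basis vector
    equal to -r with r nonnegative. The reflection vector \<open>w\<close> then has squared norm 2 +
    2 r, which never vanishes, and the case where v is already a basis vector needs no separate
    treatment.\<close>
  define \<alpha> :: complex where "\<alpha> = (if v $ 0 = 0 then 1 else - v $ 0 / cmod (v $ 0))"
  have "cmod \<alpha> = 1" unfolding \<alpha>_def by (auto simp: norm_divide)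
  then have \<alpha>1: "cnj \<alpha> * \<alpha> = 1"
    using complex_norm_square[of \<alpha>] by (simp add: mult.commute)
  define r where "r = cmod (v $ 0)"
  have \<alpha>v: "cnj (v $ 0) * \<alpha> = - complex_of_real r" "cnj \<alpha> * v $ 0 = - complex_of_real r"
    unfolding \<alpha>_def r_def
    by (auto simp: complex_norm_square[symmetric] power2_eq_square field_simps mult.commute)
  define w where "w = (\<lambda>i. v $ i - (if i = 0 then \<alpha> else 0))"
  define s where "s = complex_of_real (2 + 2 * r)"
  have s0: "s \<noteq> 0" unfolding s_def r_def
    by (metis add_pos_nonneg mult_nonneg_nonneg norm_ge_zero of_real_eq_0_iff order_less_irrefl zero_le_numeral zero_less_numeral)
  have nv': "(\<Sum>i<?n. cnj (v $ i) * v $ i) = 1"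
    using of_real_sqnorm[of "{..<?n}" "($) v"] nv by simp
  have ww: "(\<Sum>i<?n. cnj (w i) * w i) = s"
  proof -
    have "(\<Sum>i<?n. cnj (w i) * w i) = (\<Sum>i<?n. cnj (v $ i) * v $ i
        + (if i = 0 then - cnj (v $ 0) * \<alpha> - cnj \<alpha> * v $ 0 + cnj \<alpha> * \<alpha> else 0))"
      by (intro sum.cong refl) (auto simp: w_def algebra_simps)
    also have "\<dots> = 1 + (- cnj (v $ 0) * \<alpha> - cnj \<alpha> * v $ 0 + cnj \<alpha> * \<alpha>)"
      by (subst sum.distrib) (simp add: nv' del: sum.lessThan_Suc)
    also have "\<dots> = s" using \<alpha>v \<alpha>1 by (simp add: s_def)
    finally show ?thesis .
  qed
  define Q where "Q = Matrix.mat ?n ?n (\<lambda>(i, j). of_bool (i = j) - 2 * w i * cnj (w j) / s)"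
  have Qi: "Q $$ (i, j) = of_bool (i = j) - 2 * w i * cnj (w j) / s" if "i < ?n" "j < ?n" for i j
    using that by (auto simp: Q_def)
  have cs: "cnj s = s" by (simp add: s_def)
  have "unitary_mat ?n Q"
  proof (rule unitary_mat_kerI)
    fix k l assume kl: "k < ?n" "l < ?n"
    have "(\<Sum>x<?n. cnj (Q $$ (x, k)) * Q $$ (x, l)) =
      (\<Sum>x<?n. of_bool (x = k) * of_bool (x = l) - of_bool (x = k) * (2 * w x * cnj (w l) / s)
         - of_bool (x = l) * (2 * cnj (w x) * w k / s)
         + (cnj (w x) * w x) * (4 * w k * cnj (w l) / (s * s)))"
      using kl by (intro sum.cong refl) (simp add: Qi cs algebra_simps)
    also have "\<dots> = of_bool (k = l) - 2 * w k * cnj (w l) / s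
         - 2 * cnj (w l) * w k / s + s * (4 * w k * cnj (w l) / (s * s))"
      unfolding sum.distrib sum_subtractf sum_distrib_right[symmetric] ww
      using kl by (simp del: sum.lessThan_Suc times_divide_eq_right)
    also have "\<dots> = of_bool (k = l)" using s0 by (simp add: field_simps)
    finally show "(\<Sum>x<?n. cnj (Q $$ (x, k)) * Q $$ (x, l)) = of_bool (k = l)" .
  qed (simp add: Q_def)
  moreover have "Q $$ (i, 0) = cnj \<alpha> * v $ i" if "i < ?n" for i
  proof -
    have 1: "2 * cnj (w 0) / s = - cnj \<alpha>"
    proof -
      have "2 * cnj (w 0) = 2 * (cnj (v $ 0) - cnj \<alpha>)" by (simp add: w_def)
      also have "\<dots> = 2 * (cnj (v $ 0) * \<alpha> - 1) * cnj \<alpha>"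
        using \<alpha>1 by (simp add: algebra_simps)
      also have "\<dots> = - cnj \<alpha> * s" unfolding \<alpha>v by (simp add: s_def algebra_simps)
      finally show ?thesis using s0 by (simp add: field_simps)
    qed
    have "Q $$ (i, 0) = of_bool (i = 0) - w i * (2 * cnj (w 0) / s)" using that by (simp add: Qi)
    also have "\<dots> = cnj \<alpha> * v $ i" unfolding 1 using \<alpha>1 by (simp add: w_def algebra_simps)
    finally show ?thesis .
  qed
  moreover have "cnj \<alpha> \<noteq> 0" using \<alpha>1 by auto
  ultimately show ?thesis by blast
qed

lemma unit_eigenvector:
  fixes A :: "complex mat"
  assumes A: "A \<in> carrier_mat n n" and n: "n > 0"
  shows "\<exists>v e. v \<in> carrier_vec n \<and> sqnorm {..<n} (($) v) = 1 \<and> A *\<^sub>v v = e \<cdot>\<^sub>v v"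
proof -
  obtain e where "eigenvalue A e" using spectrum_non_empty[OF A n] unfolding spectrum_def by auto
  then obtain v where v: "v \<in> carrier_vec n" "v \<noteq> 0\<^sub>v n" "A *\<^sub>v v = e \<cdot>\<^sub>v v"
    using A unfolding eigenvalue_def eigenvector_def by auto
  have "sqnorm {..<n} (($) v) \<noteq> 0"
  proof
    assume "sqnorm {..<n} (($) v) = 0"
    then have "\<forall>i<n. v $ i = 0" unfolding sqnorm_def by (subst (asm) sum_nonneg_eq_0_iff) auto
    then show False using v(1,2) by (auto intro!: eq_vecI)
  qed
  then have pos: "sqnorm {..<n} (($) v) > 0" using sqnorm_nonneg[of "{..<n}" "($) v"] by linarith
  define c where "c = complex_of_real (1 / sqrt (sqnorm {..<n} (($) v)))"
  have "sqnorm {..<n} (($) (c \<cdot>\<^sub>v v)) = (cmod c)\<^sup>2 * sqnorm {..<n} (($) v)"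
    unfolding sqnorm_def sum_distrib_left using v(1)
    by (intro sum.cong refl) (auto simp: norm_mult power_mult_distrib)
  also have "\<dots> = 1" using pos by (simp add: c_def norm_divide power_divide)
  finally have "sqnorm {..<n} (($) (c \<cdot>\<^sub>v v)) = 1" .
  moreover have "A *\<^sub>v (c \<cdot>\<^sub>v v) = e \<cdot>\<^sub>v (c \<cdot>\<^sub>v v)"
    using v A by (simp add: mult_mat_vec smult_smult_assoc mult.commute)
  ultimately show ?thesis using v(1) by (metis smult_carrier_vec)
qed

text \<open>Deflation: conjugating by a unitary whose first column is proportional to an eigenvector
  clears the first column below the corner, and by hermiticity the first row as well. The corner
  entry is the eigenvalue, real because the matrix is Hermitian, and the induction hypothesis
  diagonalises the remaining block.\<close>

theorem hermitian_spectral: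
  assumes "A \<in> carrier_mat n n" "adj A = A"
  shows "\<exists>U ev. unitary_mat n U \<and> A = U * mat_diag n (\<lambda>i. complex_of_real (ev i)) * adj U"
  using assms
proof (induction n arbitrary: A)
  case 0
  then show ?case
    by (intro exI[of _ "1\<^sub>m 0"] exI[of _ "\<lambda>_. 0"]) (auto simp: unitary_mat_def adj_def intro!: eq_matI)
next
  case (Suc m)
  let ?n = "Suc m"
  note A = Suc.prems(1)
  obtain v e where v: "v \<in> carrier_vec ?n" "sqnorm {..<?n} (($) v) = 1" "A *\<^sub>v v = e \<cdot>\<^sub>v v"
    using unit_eigenvector[OF A] by blast
  obtain Q \<alpha> where Q: "unitary_mat ?n Q" and \<alpha>: "\<alpha> \<noteq> 0" and Q0: "\<And>i. i < ?n \<Longrightarrow> Q $$ (i, 0) = \<alpha> * v $ i"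
    using unitary_with_first_column[OF v(1,2)] by blast
  have Qc: "Q \<in> carrier_mat ?n ?n" using Q unfolding unitary_mat_def by auto
  note Qa = adj_carrier[OF Qc]
  define B where "B = adj Q * A * Q"
  have B: "B \<in> carrier_mat ?n ?n" unfolding B_def using Qc Qa A by (metis mult_carrier_mat)
  have BH: "adj B = B"
  proof -
    have "adj B = adj Q * (adj A * adj (adj Q))"
      unfolding B_def adj_mult[OF mult_carrier_mat[OF Qa A] Qc] adj_mult[OF Qa A] ..
    then show ?thesis using Suc.prems(2) assoc_mult_mat[OF Qa A Qc] by (simp add: B_def)
  qed
  have Bij: "B $$ (i, j) = cnj (B $$ (j, i))" if "i < ?n" "j < ?n" for i j
    using adj_index[OF B that] BH by simp
  have B0: "B $$ (i, 0) = e * of_bool (i = 0)" if i: "i < ?n" for i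
  proof -
    have "(A * Q) $$ (j, 0) = e * Q $$ (j, 0)" if j: "j < ?n" for j
    proof -
      have "(A * Q) $$ (j, 0) = (\<Sum>l<?n. A $$ (j, l) * (\<alpha> * v $ l))"
        using A Qc j by (subst mult_mat_index_sum[of _ ?n ?n _ ?n]) (auto intro!: sum.cong simp: Q0 simp del: sum.lessThan_Suc)
      also have "\<dots> = \<alpha> * (A *\<^sub>v v) $ j"
        using A v(1) j by (subst mult_mat_vec_index_sum[of _ ?n ?n])
          (auto simp: sum_distrib_left mult_ac simp del: sum.lessThan_Suc)
      also have "\<dots> = e * Q $$ (j, 0)" using v j by (simp add: Q0)
      finally show ?thesis .
    qed
    then have "(adj Q * (A * Q)) $$ (i, 0) = (\<Sum>l<?n. adj Q $$ (i, l) * (e * Q $$ (l, 0)))"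
      using A Qc Qa i by (subst mult_mat_index_sum[of _ ?n ?n _ ?n]) (auto intro!: sum.cong simp del: sum.lessThan_Suc)
    also have "\<dots> = e * (adj Q * Q) $$ (i, 0)"
      using Qc Qa i by (subst mult_mat_index_sum[of "adj Q" ?n ?n _ ?n])
        (auto simp: sum_distrib_left mult_ac simp del: sum.lessThan_Suc)
    also have "\<dots> = e * of_bool (i = 0)" using Q i unfolding unitary_mat_def by auto
    finally show ?thesis using assoc_mult_mat[OF Qa A Qc] by (simp add: B_def)
  qed
  have eR: "e = complex_of_real (Re e)"
    using arg_cong[OF Bij[of 0 0], of Im] B0[of 0] by (simp add: complex_eq_iff)
  define A' where "A' = Matrix.mat m m (\<lambda>(i, j). B $$ (Suc i, Suc j))"
  have A': "A' \<in> carrier_mat m m" by (simp add: A'_def)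
  have "adj A' = A'"
    by (intro eq_matI) (auto simp: A'_def adj_def simp flip: Bij)
  from Suc.IH[OF A' this] obtain U ev where U: "unitary_mat m U"
    and A'U: "A' = U * mat_diag m (\<lambda>i. complex_of_real (ev i)) * adj U" by blast
  have Uc: "U \<in> carrier_mat m m" using U unfolding unitary_mat_def by auto
  define V where "V = Matrix.mat ?n ?n (\<lambda>(i, j). if i = 0 \<or> j = 0 then of_bool (i = j) else U $$ (i - 1, j - 1))"
  have Vc: "V \<in> carrier_mat ?n ?n" by (simp add: V_def)
  have V: "V $$ (0, 0) = 1" "\<And>i. i < m \<Longrightarrow> V $$ (Suc i, 0) = 0" "\<And>i. i < m \<Longrightarrow> V $$ (0, Suc i) = 0"
    "\<And>i j. i < m \<Longrightarrow> j < m \<Longrightarrow> V $$ (Suc i, Suc j) = U $$ (i, j)"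
    by (auto simp: V_def)
  define ev' where "ev' = (\<lambda>i. if i = 0 then Re e else ev (i - 1))"
  have VU: "unitary_mat ?n V"
  proof (rule unitary_mat_kerI[OF Vc])
    fix k l assume kl: "k < ?n" "l < ?n"
    have UU: "(\<Sum>x<m. cnj (U $$ (x, i)) * U $$ (x, j)) = of_bool (i = j)" if "i < m" "j < m" for i j
      using unitary_mat_ker[OF U] that unfolding unitary_ker_def by auto
    show "(\<Sum>x<?n. cnj (V $$ (x, k)) * V $$ (x, l)) = of_bool (k = l)"
      unfolding sum.lessThan_Suc_shift
      using kl UU by (cases k; cases l) (auto simp: V)
  qed
  have BV: "B = V * mat_diag ?n (\<lambda>i. complex_of_real (ev' i)) * adj V"
  proof (rule eq_matI)
    fix i j assume "i < dim_row (V * mat_diag ?n (\<lambda>i. complex_of_real (ev' i)) * adj V)"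
      "j < dim_col (V * mat_diag ?n (\<lambda>i. complex_of_real (ev' i)) * adj V)"
    then have ij: "i < ?n" "j < ?n" using Vc by (auto simp: adj_def)
    have A'i: "B $$ (Suc k, Suc l) = (\<Sum>x<m. complex_of_real (ev x) * U $$ (k, x) * cnj (U $$ (l, x)))"
      if "k < m" "l < m" for k l
      using diag_conj_index[OF Uc that, of "\<lambda>i. complex_of_real (ev i)"] that
      unfolding A'U[symmetric] by (simp add: A'_def)
    have Z: "B $$ (Suc k, 0) = 0" "B $$ (0, Suc k) = 0" if "k < m" for k
      using B0[of "Suc k"] Bij[of 0 "Suc k"] that by auto
    show "B $$ (i, j) = (V * mat_diag ?n (\<lambda>i. complex_of_real (ev' i)) * adj V) $$ (i, j)"
      unfolding diag_conj_index[OF Vc ij] sum.lessThan_Suc_shift using ij B0[of 0] eR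
      by (cases i; cases j) (auto simp: V A'i Z ev'_def intro!: sum.cong)
  qed (use B Vc in \<open>auto simp: adj_def\<close>)
  have "A = Q * B * adj Q"
  proof -
    have 1: "Q * (adj Q * X) = X" if "X \<in> carrier_mat ?n ?n" for X
      using that unitary_mat_adj[OF Q] by (simp flip: assoc_mult_mat[OF Qc Qa])
    have "Q * B * adj Q = Q * (adj Q * (A * (Q * adj Q)))"
      unfolding B_def using A Qc Qa
      by (simp add: assoc_mult_mat[of _ ?n ?n _ ?n _ ?n] mult_carrier_mat[of _ ?n ?n _ ?n])
    then show ?thesis using 1 A unitary_mat_adj[OF Q] by simp
  qed
  also have "\<dots> = (Q * V) * mat_diag ?n (\<lambda>i. complex_of_real (ev' i)) * adj (Q * V)"
    unfolding BV adj_mult[OF Qc Vc] using Qc Qa Vc adj_carrier[OF Vc] mat_diag_dim[of ?n]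
    by (simp add: assoc_mult_mat[of _ ?n ?n _ ?n _ ?n] mult_carrier_mat[of _ ?n ?n _ ?n])
  finally show ?case using unitary_mat_mult[OF Q VU] by blast
qed

section \<open>Trace norm\<close>

lemma sum_rotate3:
  "(\<Sum>a\<in>A. \<Sum>b\<in>B. \<Sum>c\<in>C. f a b c) = (\<Sum>b\<in>B. \<Sum>c\<in>C. \<Sum>a\<in>A. f a b c)"
  by (rule trans[OF sum.swap], rule sum.cong[OF refl], rule sum.swap)

lemma sum_rotate4:
  "(\<Sum>a\<in>A. \<Sum>b\<in>B. \<Sum>c\<in>C. \<Sum>d\<in>D. f a b c d) = (\<Sum>b\<in>B. \<Sum>c\<in>C. \<Sum>d\<in>D. \<Sum>a\<in>A. f a b c d)"
  by (rule trans[OF sum.swap], rule sum.cong[OF refl], rule sum_rotate3)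

lemma psd_carrier: "psd n A \<Longrightarrow> A \<in> carrier_mat n n"
  unfolding psd_def by auto

lemma psd_form:
  assumes "psd n A"
  shows "Im (\<Sum>x<n. \<Sum>y<n. cnj (f x) * A $$ (x, y) * f y) = 0"
    "0 \<le> Re (\<Sum>x<n. \<Sum>y<n. cnj (f x) * A $$ (x, y) * f y)"
proof -
  note A = psd_carrier[OF assms]
  have "(\<Sum>i<n. cnj (vec n f $ i) * (A *\<^sub>v vec n f) $ i)
      = (\<Sum>x<n. \<Sum>y<n. cnj (f x) * A $$ (x, y) * f y)"
    using A by (intro sum.cong refl)
      (auto simp: mult_mat_vec_index_sum[OF A] sum_distrib_left mult.assoc intro!: sum.cong
        simp del: index_mult_mat_vec)
  moreover have "vec n f \<in> carrier_vec n" by simp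
  ultimately show "Im (\<Sum>x<n. \<Sum>y<n. cnj (f x) * A $$ (x, y) * f y) = 0"
    "0 \<le> Re (\<Sum>x<n. \<Sum>y<n. cnj (f x) * A $$ (x, y) * f y)"
    using assms unfolding psd_def Let_def by metis+
qed

text \<open>The quadratic form at v is the squared norm of the adjoint of \<open>V\<close> applied
  to v. The index type of the Gram vectors is free, so tuples may be used for tensor powers.\<close>

lemma psd_gramI:
  fixes V :: "nat \<Rightarrow> 'm \<Rightarrow> complex"
  assumes A: "A \<in> carrier_mat n n"
    and AV: "\<And>x y. x < n \<Longrightarrow> y < n \<Longrightarrow> A $$ (x, y) = (\<Sum>m\<in>F. V x m * cnj (V y m))"
  shows "psd n A"
  unfolding psd_def Let_def
proof (intro conjI ballI A)
  fix v :: "complex vec" assume v: "v \<in> carrier_vec n"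
  have "(\<Sum>i<n. cnj (v $ i) * (A *\<^sub>v v) $ i)
     = (\<Sum>x<n. \<Sum>y<n. \<Sum>m\<in>F. cnj (cnj (V x m) * v $ x) * (cnj (V y m) * v $ y))"
    using v by (intro sum.cong refl)
      (simp add: mult_mat_vec_index_sum[OF A] sum_distrib_left sum_distrib_right AV mult_ac
        del: index_mult_mat_vec)
  also have "\<dots> = (\<Sum>m\<in>F. cnj (\<Sum>x<n. cnj (V x m) * v $ x) * (\<Sum>y<n. cnj (V y m) * v $ y))"
    unfolding cnj_sum sum_product by (rule sum_rotate3[symmetric])
  also have "\<dots> = complex_of_real (sqnorm F (\<lambda>m. \<Sum>x<n. cnj (V x m) * v $ x))"
    by (rule of_real_sqnorm[symmetric])
  finally have *: "(\<Sum>i<n. cnj (v $ i) * (A *\<^sub>v v) $ i) = complex_of_real (sqnorm F (\<lambda>m. \<Sum>x<n. cnj (V x m) * v $ x))" .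
  show "Im (\<Sum>i<n. cnj (v $ i) * (A *\<^sub>v v) $ i) = 0" "0 \<le> Re (\<Sum>i<n. cnj (v $ i) * (A *\<^sub>v v) $ i)"
    unfolding * by auto
qed

text \<open>Polarisation: \<open>psd\<close> only says that the quadratic form is real and
  nonnegative. Evaluating it at \<alpha> e_i + \<beta> e_j for (\<alpha>, \<beta>) = (1, 0), (0, 1),
  (1, 1) and (1, \<i>) determines how the two off-diagonal entries are related.\<close>

lemma psd_hermitian:
  assumes "psd n A" shows "adj A = A"
proof -
  note A = psd_carrier[OF assms]
  have *: "A $$ (i, j) = cnj (A $$ (j, i))" if ij: "i < n" "j < n" for i j
  proof -
    have two: "(\<Sum>x<n. \<Sum>y<n. cnj (\<alpha> * of_bool (x = i) + \<beta> * of_bool (x = j)) * A $$ (x, y)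
          * (\<alpha> * of_bool (y = i) + \<beta> * of_bool (y = j)))
        = cnj \<alpha> * \<alpha> * A $$ (i, i) + cnj \<alpha> * \<beta> * A $$ (i, j)
          + cnj \<beta> * \<alpha> * A $$ (j, i) + cnj \<beta> * \<beta> * A $$ (j, j)" for \<alpha> \<beta>
    proof -
      have "(\<Sum>x<n. \<Sum>y<n. cnj (\<alpha> * of_bool (x = i) + \<beta> * of_bool (x = j)) * A $$ (x, y)
          * (\<alpha> * of_bool (y = i) + \<beta> * of_bool (y = j)))
        = (\<Sum>x<n. of_bool (x = i) * (\<Sum>y<n. of_bool (y = i) * (cnj \<alpha> * \<alpha> * A $$ (x, y))
                   + of_bool (y = j) * (cnj \<alpha> * \<beta> * A $$ (x, y)))
            + of_bool (x = j) * (\<Sum>y<n. of_bool (y = i) * (cnj \<beta> * \<alpha> * A $$ (x, y))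
                   + of_bool (y = j) * (cnj \<beta> * \<beta> * A $$ (x, y))))"
        unfolding sum_distrib_left sum.distrib[symmetric]
        by (intro sum.cong refl) (simp add: algebra_simps)
      then show ?thesis using ij by (simp add: sum.distrib)
    qed
    note R = psd_form(1)[OF assms, of "\<lambda>x. _ * of_bool (x = i) + _ * of_bool (x = j)", unfolded two]
    have "Im (A $$ (i, i)) = 0" "Im (A $$ (j, j)) = 0" using R[of 1 0] R[of 0 1] by auto
    then have "Im (A $$ (i, j)) + Im (A $$ (j, i)) = 0" "Re (A $$ (i, j)) - Re (A $$ (j, i)) = 0"
      using R[of 1 1] R[of 1 \<i>] by auto
    then show ?thesis by (simp add: complex_eq_iff)
  qed
  show ?thesis
    using A by (intro eq_matI) (auto simp: adj_def simp flip: *)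
qed

lemma unitary_ker_eigen:
  assumes U: "unitary_ker I U" and fin: "finite I" and k: "k \<in> I" and x: "x \<in> I"
    and A: "\<And>y. y \<in> I \<Longrightarrow> A x y = (\<Sum>m\<in>I. d m * U x m * cnj (U y m))"
  shows "(\<Sum>y\<in>I. A x y * U y k) = d k * U x k"
proof -
  have "(\<Sum>y\<in>I. A x y * U y k) = (\<Sum>y\<in>I. \<Sum>m\<in>I. d m * U x m * (cnj (U y m) * U y k))"
    using A by (simp add: sum_distrib_right mult.assoc)
  also have "\<dots> = (\<Sum>m\<in>I. d m * U x m * (\<Sum>y\<in>I. cnj (U y m) * U y k))"
    by (subst sum.swap) (simp add: sum_distrib_left)
  also have "\<dots> = (\<Sum>m\<in>I. of_bool (m = k) * (d m * U x m))"
    using U k unfolding unitary_ker_def by (intro sum.cong refl) auto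
  finally show ?thesis using fin k by simp
qed

lemma unitary_ker_norm:
  assumes U: "unitary_ker I U" and k: "k \<in> I"
  shows "sqnorm I (\<lambda>x. U x k) = 1"
proof -
  have "complex_of_real (sqnorm I (\<lambda>x. U x k)) = 1"
    using U k unfolding of_real_sqnorm unitary_ker_def by auto
  then show ?thesis by (simp only: of_real_eq_1_iff)
qed

lemma unitary_ker_trace:
  assumes U: "unitary_ker I U" and A: "\<And>x. x \<in> I \<Longrightarrow> A x x = (\<Sum>m\<in>I. d m * U x m * cnj (U x m))"
  shows "(\<Sum>x\<in>I. A x x) = (\<Sum>m\<in>I. d m)"
proof -
  have "(\<Sum>x\<in>I. A x x) = (\<Sum>x\<in>I. \<Sum>m\<in>I. d m * (cnj (U x m) * U x m))"
    using A by (auto intro!: sum.cong)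
  also have "\<dots> = (\<Sum>m\<in>I. d m * (\<Sum>x\<in>I. cnj (U x m) * U x m))"
    by (subst sum.swap) (simp add: sum_distrib_left)
  also have "\<dots> = (\<Sum>m\<in>I. d m)" using U unfolding unitary_ker_def by (intro sum.cong refl) auto
  finally show ?thesis .
qed

text \<open>The choice in \<open>mfun\<close> ranges over a nonempty set by the spectral theorem, so
  the chosen matrix brings along a diagonalisation shared by \<open>A\<close> and
  \<open>mfun f A\<close>. All later computations use that one. The eigenvalues are nonnegative as
  values of the quadratic form at unit eigenvectors.\<close>

lemma psd_mfun:
  assumes "psd n A"
  obtains U ev where "unitary_ker {..<n} U"
    "\<forall>x<n. \<forall>y<n. A $$ (x, y) = (\<Sum>m<n. complex_of_real (ev m) * U x m * cnj (U y m))"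
    "\<forall>x<n. \<forall>y<n. mfun f A $$ (x, y) = (\<Sum>m<n. complex_of_real (f (ev m)) * U x m * cnj (U y m))"
    "mfun f A \<in> carrier_mat n n" "\<forall>m<n. ev m \<ge> 0"
proof -
  note A = psd_carrier[OF assms]
  define P where "P = (\<lambda>B. \<exists>U ev. unitary_mat n U \<and>
        A = U * mat_diag n (\<lambda>i. complex_of_real (ev i)) * adj U \<and>
        B = U * mat_diag n (\<lambda>i. complex_of_real (f (ev i))) * adj U)"
  have "\<exists>B. P B"
    unfolding P_def using hermitian_spectral[OF A psd_hermitian[OF assms]] by blast
  then have "P (mfun f A)"
    using A someI_ex[of P] unfolding mfun_def P_def by (simp add: Let_def)
  then obtain U ev where U: "unitary_mat n U"
    and AU: "A = U * mat_diag n (\<lambda>i. complex_of_real (ev i)) * adj U"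
    and fU: "mfun f A = U * mat_diag n (\<lambda>i. complex_of_real (f (ev i))) * adj U"
    unfolding P_def by blast
  have Uc: "U \<in> carrier_mat n n" using U unfolding unitary_mat_def by auto
  let ?U = "\<lambda>x k. U $$ (x, k)"
  have Uk: "unitary_ker {..<n} ?U" by (rule unitary_mat_ker[OF U])
  have Ax: "A $$ (x, y) = (\<Sum>m<n. complex_of_real (ev m) * U $$ (x, m) * cnj (U $$ (y, m)))"
    if "x < n" "y < n" for x y
    unfolding AU by (rule diag_conj_index[OF Uc that])
  have ev0: "ev k \<ge> 0" if k: "k < n" for k
  proof -
    have "(\<Sum>x<n. \<Sum>y<n. cnj (?U x k) * A $$ (x, y) * ?U y k)
        = (\<Sum>x<n. cnj (?U x k) * (\<Sum>y<n. A $$ (x, y) * ?U y k))"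
      by (simp add: sum_distrib_left mult.assoc)
    also have "\<dots> = (\<Sum>x<n. cnj (?U x k) * (ev k * ?U x k))"
      using Ax k by (intro sum.cong refl)
        (subst unitary_ker_eigen[OF Uk, where d = "\<lambda>k. complex_of_real (ev k)"], auto)
    also have "\<dots> = complex_of_real (ev k * sqnorm {..<n} (\<lambda>x. ?U x k))"
      unfolding of_real_mult of_real_sqnorm by (simp add: sum_distrib_left mult_ac)
    finally show ?thesis
      using psd_form(2)[OF assms, of "\<lambda>x. ?U x k"] unitary_ker_norm[OF Uk] k by simp
  qed
  have fx: "mfun f A $$ (x, y) = (\<Sum>m<n. complex_of_real (f (ev m)) * U $$ (x, m) * cnj (U $$ (y, m)))"
    if "x < n" "y < n" for x y
    unfolding fU by (rule diag_conj_index[OF Uc that])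
  have fc: "mfun f A \<in> carrier_mat n n"
    unfolding fU using Uc adj_carrier[OF Uc] mat_diag_dim[of n] by (metis mult_carrier_mat)
  show thesis
    by (rule that[of ?U ev]) (use Uk Ax fx fc ev0 in auto)
qed

lemma adj_mult_self_index:
  assumes "X \<in> carrier_mat n n" "x < n" "y < n"
  shows "(adj X * X) $$ (x, y) = (\<Sum>z<n. cnj (X $$ (z, x)) * X $$ (z, y))"
  using assms by (subst mult_mat_index_sum[of _ n n _ n]) auto

lemma psd_adj_mult_self:
  assumes "X \<in> carrier_mat n n" shows "psd n (adj X * X)"
proof (rule psd_gramI)
  show "adj X * X \<in> carrier_mat n n" using assms adj_carrier[OF assms] by (metis mult_carrier_mat)
  show "(adj X * X) $$ (x, y) = (\<Sum>m<n. cnj (X $$ (m, x)) * cnj (cnj (X $$ (m, y))))"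
    if "x < n" "y < n" for x y using adj_mult_self_index[OF assms that] by simp
qed

text \<open>For a unit eigenvector u of \<open>adj X * X\<close>, the eigenvalue is the squared norm
  of X u. Hence \<open>sqrt (ev m)\<close> are the singular values, and the trace norm is their
  sum.\<close>

lemma tnorm_singular:
  assumes X: "X \<in> carrier_mat n n"
  obtains U ev where "unitary_ker {..<n} U"
    "\<forall>x<n. \<forall>y<n. (adj X * X) $$ (x, y) = (\<Sum>m<n. complex_of_real (ev m) * U x m * cnj (U y m))"
    "\<forall>m<n. ev m = sqnorm {..<n} (\<lambda>x. \<Sum>y<n. X $$ (x, y) * U y m)"
    "tnorm X = (\<Sum>m<n. sqrt (ev m))"
proof -
  obtain U ev where U: "unitary_ker {..<n} U"
    and XX[rule_format]: "\<forall>x<n. \<forall>y<n. (adj X * X) $$ (x, y) = (\<Sum>m<n. complex_of_real (ev m) * U x m * cnj (U y m))"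
    and S[rule_format]: "\<forall>x<n. \<forall>y<n. mfun sqrt (adj X * X) $$ (x, y) = (\<Sum>m<n. complex_of_real (sqrt (ev m)) * U x m * cnj (U y m))"
    and Sc: "mfun sqrt (adj X * X) \<in> carrier_mat n n" and "\<forall>m<n. ev m \<ge> 0"
    using psd_mfun[OF psd_adj_mult_self[OF X], of sqrt] .
  have "ev k = sqnorm {..<n} (\<lambda>x. \<Sum>y<n. X $$ (x, y) * U y k)" if k: "k < n" for k
  proof -
    have "complex_of_real (sqnorm {..<n} (\<lambda>x. \<Sum>y<n. X $$ (x, y) * U y k))
      = (\<Sum>z<n. \<Sum>x<n. \<Sum>y<n. cnj (U x k) * (cnj (X $$ (z, x)) * X $$ (z, y)) * U y k)"
      unfolding of_real_sqnorm cnj_sum sum_product by (simp add: mult_ac)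
    also have "\<dots> = (\<Sum>x<n. \<Sum>y<n. \<Sum>z<n. cnj (U x k) * (cnj (X $$ (z, x)) * X $$ (z, y)) * U y k)"
      by (rule sum_rotate3)
    also have "\<dots> = (\<Sum>x<n. cnj (U x k) * (\<Sum>y<n. (adj X * X) $$ (x, y) * U y k))"
      by (simp add: adj_mult_self_index[OF X] sum_distrib_left sum_distrib_right mult.assoc)
    also have "\<dots> = (\<Sum>x<n. cnj (U x k) * (ev k * U x k))"
      using k XX by (intro sum.cong refl)
        (subst unitary_ker_eigen[OF U, where d = "\<lambda>k. complex_of_real (ev k)"], auto)
    also have "\<dots> = complex_of_real (ev k * sqnorm {..<n} (\<lambda>x. U x k))"
      unfolding of_real_mult of_real_sqnorm by (simp add: sum_distrib_left mult_ac)
    finally show ?thesis using unitary_ker_norm[OF U] k by (simp only: of_real_eq_iff) simp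
  qed
  moreover have "tnorm X = (\<Sum>m<n. sqrt (ev m))"
  proof -
    have "mtrace (mfun sqrt (adj X * X)) = (\<Sum>m<n. complex_of_real (sqrt (ev m)))"
      unfolding mtrace_def using Sc S
      by (subst unitary_ker_trace[OF U, where d = "\<lambda>m. complex_of_real (sqrt (ev m))", symmetric]) auto
    then show ?thesis unfolding tnorm_def by simp
  qed
  ultimately show thesis using that[OF U, of ev] XX by blast
qed

section \<open>Sesquilinear forms, contractions and duality with the trace norm\<close>

definition form :: "'i set \<Rightarrow> ('i \<Rightarrow> 'i \<Rightarrow> complex) \<Rightarrow> ('i \<Rightarrow> complex) \<Rightarrow> ('i \<Rightarrow> complex) \<Rightarrow> complex" where
  "form I K f g = (\<Sum>x\<in>I. \<Sum>y\<in>I. cnj (f x) * K x y * g y)"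

text \<open>Operator norm at most 1, phrased through the sesquilinear form so that it can be
  transported along bijections of the index set.\<close>

definition contraction :: "'i set \<Rightarrow> ('i \<Rightarrow> 'i \<Rightarrow> complex) \<Rightarrow> bool" where
  "contraction I K \<longleftrightarrow> (\<forall>f g. cmod (form I K f g) \<le> sqrt (sqnorm I f) * sqrt (sqnorm I g))"

definition ktrace :: "'i set \<Rightarrow> ('i \<Rightarrow> 'i \<Rightarrow> complex) \<Rightarrow> ('i \<Rightarrow> 'i \<Rightarrow> complex) \<Rightarrow> complex" where
  "ktrace I K Y = (\<Sum>x\<in>I. \<Sum>y\<in>I. K x y * Y y x)"

lemma ktrace_eigen_sum:
  assumes U: "unitary_ker I U" and fin: "finite I"
  shows "ktrace I K Y = (\<Sum>k\<in>I. form I K (\<lambda>x. U x k) (\<lambda>y. \<Sum>z\<in>I. Y y z * U z k))"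
proof -
  have "(\<Sum>k\<in>I. form I K (\<lambda>x. U x k) (\<lambda>y. \<Sum>z\<in>I. Y y z * U z k))
      = (\<Sum>k\<in>I. \<Sum>x\<in>I. \<Sum>y\<in>I. \<Sum>z\<in>I. K x y * Y y z * (U z k * cnj (U x k)))"
    unfolding form_def by (simp add: sum_distrib_left mult_ac)
  also have "\<dots> = (\<Sum>x\<in>I. \<Sum>y\<in>I. \<Sum>z\<in>I. \<Sum>k\<in>I. K x y * Y y z * (U z k * cnj (U x k)))"
    by (rule sum_rotate4)
  also have "\<dots> = (\<Sum>x\<in>I. \<Sum>y\<in>I. \<Sum>z\<in>I. of_bool (z = x) * (K x y * Y y z))"
    unfolding sum_distrib_left[symmetric] using U unfolding unitary_ker_def
    by (intro sum.cong refl) (simp add: mult.commute)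
  also have "\<dots> = ktrace I K Y" unfolding ktrace_def using fin by simp
  finally show ?thesis by simp
qed

text \<open>Evaluate Tr(K X) in the eigenbasis u_k of \<open>adj X * X\<close>. Each diagonal term
  is bounded by the norm of u_k times the norm of X u_k, that is, by the k-th singular
  value.\<close>

lemma ktrace_le_tnorm:
  assumes K: "contraction {..<n} K" and X: "X \<in> carrier_mat n n"
  shows "cmod (ktrace {..<n} K (\<lambda>x y. X $$ (x, y))) \<le> tnorm X"
proof -
  obtain U ev where U: "unitary_ker {..<n} U"
    and XX[rule_format]: "\<forall>x<n. \<forall>y<n. (adj X * X) $$ (x, y) = (\<Sum>m<n. complex_of_real (ev m) * U x m * cnj (U y m))"
    and ev[rule_format]: "\<forall>m<n. ev m = sqnorm {..<n} (\<lambda>x. \<Sum>y<n. X $$ (x, y) * U y m)"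
    and t: "tnorm X = (\<Sum>m<n. sqrt (ev m))"
    using tnorm_singular[OF X] .
  have "cmod (ktrace {..<n} K (\<lambda>x y. X $$ (x, y)))
     \<le> (\<Sum>k<n. cmod (form {..<n} K (\<lambda>x. U x k) (\<lambda>y. \<Sum>z<n. X $$ (y, z) * U z k)))"
    by (subst ktrace_eigen_sum[OF U finite_lessThan]) (rule norm_sum)
  also have "\<dots> \<le> (\<Sum>k<n. sqrt (ev k))"
  proof (rule sum_mono)
    fix k assume k: "k \<in> {..<n}"
    have "cmod (form {..<n} K (\<lambda>x. U x k) (\<lambda>y. \<Sum>z<n. X $$ (y, z) * U z k))
      \<le> sqrt (sqnorm {..<n} (\<lambda>x. U x k)) * sqrt (sqnorm {..<n} (\<lambda>y. \<Sum>z<n. X $$ (y, z) * U z k))"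
      using K unfolding contraction_def by blast
    then show "cmod (form {..<n} K (\<lambda>x. U x k) (\<lambda>y. \<Sum>z<n. X $$ (y, z) * U z k)) \<le> sqrt (ev k)"
      using unitary_ker_norm[OF U k] ev k by simp
  qed
  finally show ?thesis unfolding t .
qed

text \<open>The matrix is a projection, so \<open>adj X * X = X\<close>. Each eigenvalue e then
  equals the squared norm of X u, which is e squared; so it is its own square root, and the singular
  values sum to the trace. This admits normalised pure states as inputs in
  \<open>diamond\<close>.\<close>

lemma tnorm_rank_one:
  assumes f: "sqnorm {..<n} f = 1"
  shows "tnorm (Matrix.mat n n (\<lambda>(x, y). f x * cnj (f y))) = 1"
proof -
  define X where "X = Matrix.mat n n (\<lambda>(x, y). f x * cnj (f y))"
  have X: "X \<in> carrier_mat n n" by (simp add: X_def)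
  have f1: "(\<Sum>z<n. cnj (f z) * f z) = 1" using f of_real_sqnorm[of "{..<n}" f] by simp
  obtain U ev where U: "unitary_ker {..<n} U"
    and XX[rule_format]: "\<forall>x<n. \<forall>y<n. (adj X * X) $$ (x, y) = (\<Sum>m<n. complex_of_real (ev m) * U x m * cnj (U y m))"
    and ev[rule_format]: "\<forall>m<n. ev m = sqnorm {..<n} (\<lambda>x. \<Sum>y<n. X $$ (x, y) * U y m)"
    and t: "tnorm X = (\<Sum>m<n. sqrt (ev m))"
    using tnorm_singular[OF X] .
  have idem: "(adj X * X) $$ (x, y) = X $$ (x, y)" if "x < n" "y < n" for x y
  proof -
    have "(adj X * X) $$ (x, y) = f x * cnj (f y) * (\<Sum>z<n. cnj (f z) * f z)"
      unfolding adj_mult_self_index[OF X that] sum_distrib_left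
      using that by (intro sum.cong refl) (simp add: X_def mult_ac)
    then show ?thesis using f1 that by (simp add: X_def)
  qed
  have "sqrt (ev k) = ev k" if k: "k < n" for k
  proof -
    have e: "(\<Sum>y<n. X $$ (x, y) * U y k) = ev k * U x k" if "x < n" for x
      using that k XX idem
      by (intro unitary_ker_eigen[OF U, where d = "\<lambda>k. complex_of_real (ev k)"]) auto
    have "ev k = sqnorm {..<n} (\<lambda>x. ev k * U x k)"
      using e by (subst ev[OF k]) (simp add: sqnorm_def)
    also have "\<dots> = (ev k)\<^sup>2 * sqnorm {..<n} (\<lambda>x. U x k)"
      by (simp add: sqnorm_def norm_mult power_mult_distrib sum_distrib_left)
    finally have "ev k = (ev k)\<^sup>2" using unitary_ker_norm[OF U] k by simp
    then show ?thesis by (metis ev k real_sqrt_abs abs_of_nonneg sqnorm_nonneg)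
  qed
  then have "tnorm X = (\<Sum>m<n. ev m)" unfolding t by simp
  moreover have "complex_of_real (\<Sum>m<n. ev m) = 1"
  proof -
    have "complex_of_real (\<Sum>m<n. ev m) = (\<Sum>x<n. X $$ (x, x))"
      using XX idem by (subst unitary_ker_trace[OF U, where d = "\<lambda>m. complex_of_real (ev m)"]) auto
    also have "\<dots> = 1" using f1 by (simp add: X_def mult.commute)
    finally show ?thesis .
  qed
  ultimately show ?thesis unfolding X_def by (simp only: of_real_eq_1_iff)
qed

section \<open>Comparison of the trace norm with matrix entries\<close>

lemma sqnorm_component_le: "finite I \<Longrightarrow> x \<in> I \<Longrightarrow> cmod (f x) \<le> sqrt (sqnorm I f)"
proof -
  assume "finite I" "x \<in> I"
  then have "(cmod (f x))\<^sup>2 \<le> sqnorm I f"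
    unfolding sqnorm_def by (intro member_le_sum) auto
  then show ?thesis by (rule real_le_rsqrt)
qed

lemma sqrt_sqnorm_le_sum: "sqrt (sqnorm I f) \<le> (\<Sum>x\<in>I. cmod (f x))"
proof -
  have "sqnorm I f \<le> (\<Sum>x\<in>I. cmod (f x))\<^sup>2"
    unfolding sqnorm_def by (induction I rule: infinite_finite_induct)
      (auto simp: power2_sum intro!: add_mono mult_nonneg_nonneg sum_nonneg order_trans[OF _ add_increasing2])
  then show ?thesis by (simp add: real_le_lsqrt sum_nonneg)
qed

text \<open>An entry is Tr(K X) for a matrix unit K, and matrix units are contractions.\<close>

lemma entry_le_tnorm:
  assumes X: "X \<in> carrier_mat n n" and ij: "i < n" "j < n"
  shows "cmod (X $$ (i, j)) \<le> tnorm X"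
proof -
  define K :: "nat \<Rightarrow> nat \<Rightarrow> complex" where "K = (\<lambda>x y. of_bool (x = j) * of_bool (y = i))"
  have "form {..<n} K f g = cnj (f j) * g i" for f g
  proof -
    have "form {..<n} K f g = (\<Sum>x<n. of_bool (x = j) * (\<Sum>y<n. of_bool (y = i) * (cnj (f x) * g y)))"
      unfolding form_def K_def sum_distrib_left by (intro sum.cong refl) (simp only: mult_ac)
    then show ?thesis using ij by simp
  qed
  then have "contraction {..<n} K" unfolding contraction_def
    using ij by (auto simp: norm_mult intro!: mult_mono sqnorm_component_le)
  moreover have "ktrace {..<n} K (\<lambda>x y. X $$ (x, y)) = X $$ (i, j)"
  proof -
    have "ktrace {..<n} K (\<lambda>x y. X $$ (x, y)) = (\<Sum>x<n. of_bool (x = j) * (\<Sum>y<n. of_bool (y = i) * X $$ (y, x)))"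
      unfolding ktrace_def K_def sum_distrib_left by (intro sum.cong refl) (simp only: mult_ac)
    then show ?thesis using ij by simp
  qed
  ultimately show ?thesis using ktrace_le_tnorm[OF _ X] by metis
qed

text \<open>A crude converse to \<open>entry_le_tnorm\<close>. The two together show that the
  supremum in \<open>diamond\<close> is over a bounded set.\<close>

lemma tnorm_le_sum_entries:
  assumes X: "X \<in> carrier_mat n n"
  shows "tnorm X \<le> n * (\<Sum>x<n. \<Sum>y<n. cmod (X $$ (x, y)))"
proof -
  obtain U ev where U: "unitary_ker {..<n} U"
    and XX[rule_format]: "\<forall>x<n. \<forall>y<n. (adj X * X) $$ (x, y) = (\<Sum>m<n. complex_of_real (ev m) * U x m * cnj (U y m))"
    and ev[rule_format]: "\<forall>m<n. ev m = sqnorm {..<n} (\<lambda>x. \<Sum>y<n. X $$ (x, y) * U y m)"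
    and t: "tnorm X = (\<Sum>m<n. sqrt (ev m))"
    using tnorm_singular[OF X] .
  have "sqrt (ev m) \<le> (\<Sum>x<n. \<Sum>y<n. cmod (X $$ (x, y)))" if m: "m < n" for m
  proof -
    have "sqrt (ev m) \<le> (\<Sum>x<n. cmod (\<Sum>y<n. X $$ (x, y) * U y m))"
      unfolding ev[OF m] by (rule sqrt_sqnorm_le_sum)
    also have "\<dots> \<le> (\<Sum>x<n. \<Sum>y<n. cmod (X $$ (x, y) * U y m))"
      by (intro sum_mono norm_sum)
    also have "\<dots> \<le> (\<Sum>x<n. \<Sum>y<n. cmod (X $$ (x, y)))"
    proof (intro sum_mono)
      fix x y assume "y \<in> {..<n}"
      then have "cmod (U y m) \<le> 1"
        using sqnorm_component_le[of "{..<n}" y "\<lambda>y. U y m"] unitary_ker_norm[OF U] m by simp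
      then show "cmod (X $$ (x, y) * U y m) \<le> cmod (X $$ (x, y))"
        by (simp add: norm_mult mult_left_le)
    qed
    finally show ?thesis .
  qed
  then have "tnorm X \<le> (\<Sum>m<n. \<Sum>x<n. \<Sum>y<n. cmod (X $$ (x, y)))"
    unfolding t by (intro sum_mono) auto
  then show ?thesis by simp
qed

section \<open>Diamond norm and amplified channels\<close>

lemma psd_spectral:
  assumes "psd n A"
  obtains U ev where "unitary_ker {..<n} U"
    "\<forall>x<n. \<forall>y<n. A $$ (x, y) = (\<Sum>m<n. complex_of_real (ev m) * U x m * cnj (U y m))"
    "\<forall>m<n. ev m \<ge> 0"
  by (rule psd_mfun[OF assms, of "\<lambda>x. x"]) (rule that)

section \<open>Bipartite systems: pair indices in the convention of \<open>kron\<close>\<close>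

definition idx :: "nat \<Rightarrow> nat \<times> nat \<Rightarrow> nat" where
  "idx c p = fst p * c + snd p"

lemma idx_less: "p \<in> {..<b} \<times> {..<c} \<Longrightarrow> idx c p < b * c"
proof -
  assume p: "p \<in> {..<b} \<times> {..<c}"
  then have "idx c p < Suc (fst p) * c" by (auto simp: idx_def)
  also have "\<dots> \<le> b * c" using p by (intro mult_right_mono) auto
  finally show ?thesis .
qed

lemma idx_div_mod [simp]: "snd p < c \<Longrightarrow> idx c p div c = fst p" "snd p < c \<Longrightarrow> idx c p mod c = snd p"
  by (auto simp: idx_def)

lemma bij_betw_idx: "bij_betw (idx c) ({..<b} \<times> {..<c}) {..<b * c}"
proof (rule bij_betw_byWitness[where f' = "\<lambda>x. (x div c, x mod c)"])
  show "idx c ` ({..<b} \<times> {..<c}) \<subseteq> {..<b * c}" using idx_less by auto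
  show "(\<lambda>x. (x div c, x mod c)) ` {..<b * c} \<subseteq> {..<b} \<times> {..<c}"
    by (auto simp: less_mult_imp_div_less) (metis gr0I mod_less_divisor mult_0_right not_less_zero)
qed (auto simp: idx_def)

lemma form_reindex:
  assumes "bij_betw h I J"
  shows "form J K f g = form I (\<lambda>x y. K (h x) (h y)) (\<lambda>x. f (h x)) (\<lambda>x. g (h x))"
  unfolding form_def by (simp add: sum.reindex_bij_betw[OF assms, symmetric])

lemma sqnorm_reindex: "bij_betw h I J \<Longrightarrow> sqnorm J f = sqnorm I (\<lambda>x. f (h x))"
  unfolding sqnorm_def by (simp add: sum.reindex_bij_betw[symmetric])

lemma ktrace_reindex:
  assumes "bij_betw h I J"
  shows "ktrace J K Y = ktrace I (\<lambda>x y. K (h x) (h y)) (\<lambda>x y. Y (h x) (h y))"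
  unfolding ktrace_def by (simp add: sum.reindex_bij_betw[OF assms, symmetric])

lemma form_cong:
  assumes "\<And>x y. x \<in> I \<Longrightarrow> y \<in> I \<Longrightarrow> K x y = K' x y"
  shows "form I K f g = form I K' f g"
  unfolding form_def using assms by (intro sum.cong refl) auto

lemma ktrace_cong:
  assumes "\<And>x y. x \<in> I \<Longrightarrow> y \<in> I \<Longrightarrow> K x y = K' x y" "\<And>x y. x \<in> I \<Longrightarrow> y \<in> I \<Longrightarrow> Y x y = Y' x y"
  shows "ktrace I K Y = ktrace I K' Y'"
  unfolding ktrace_def using assms by (intro sum.cong refl) auto

lemma contraction_reindex:
  assumes h: "bij_betw h I J" and K: "contraction I K"
    and KK: "\<And>x y. x \<in> I \<Longrightarrow> y \<in> I \<Longrightarrow> K' (h x) (h y) = K x y"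
  shows "contraction J K'"
  unfolding contraction_def
proof (intro allI)
  fix f g
  have "form J K' f g = form I K (\<lambda>x. f (h x)) (\<lambda>x. g (h x))"
    unfolding form_reindex[OF h] using KK by (intro form_cong) auto
  then show "cmod (form J K' f g) \<le> sqrt (sqnorm J f) * sqrt (sqnorm J g)"
    using K unfolding contraction_def sqnorm_reindex[OF h] by metis
qed

text \<open>The map \<Phi> \<otimes> id written on pair indices. The sums over reference indices in
  \<open>tensor_map\<close> have collapsed, since the identity on matrix units of C keeps only the
  term with the reference indices of \<open>p\<close> and \<open>q\<close>.\<close>

definition ampl :: "nat \<Rightarrow> (complex mat \<Rightarrow> complex mat) \<Rightarrow> (nat \<times> nat \<Rightarrow> nat \<times> nat \<Rightarrow> complex)
    \<Rightarrow> nat \<times> nat \<Rightarrow> nat \<times> nat \<Rightarrow> complex" where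
  "ampl a \<Phi> X p q = (\<Sum>i<a. \<Sum>j<a. \<Phi> (munit a i j) $$ (fst p, fst q) * X (i, snd p) (j, snd q))"

lemma tensor_map_id_index:
  assumes \<Phi>: "\<And>i j. i < a \<Longrightarrow> j < a \<Longrightarrow> \<Phi> (munit a i j) \<in> carrier_mat b b"
    and p: "p \<in> {..<b} \<times> {..<c}" and q: "q \<in> {..<b} \<times> {..<c}"
  shows "tensor_map a b c c \<Phi> (\<lambda>X. X) X $$ (idx c p, idx c q)
     = ampl a \<Phi> (\<lambda>p q. X $$ (idx c p, idx c q)) p q"
proof -
  have p': "fst p < b" "snd p < c" "fst q < b" "snd q < c" using p q by auto
  have dm: "dim_row (munit c k l) = c" "dim_col (munit c k l) = c" for k l by (auto simp: munit_def)
  have "tensor_map a b c c \<Phi> (\<lambda>X. X) X $$ (idx c p, idx c q)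
    = (\<Sum>i<a. \<Sum>j<a. \<Sum>k<c. \<Sum>l<c. X $$ (i * c + k, j * c + l) *
        kron (\<Phi> (munit a i j)) (munit c k l) $$ (idx c p, idx c q))"
    unfolding tensor_map_def using idx_less[OF p] idx_less[OF q] by simp
  also have "\<dots> = (\<Sum>i<a. \<Sum>j<a. \<Sum>k<c. of_bool (k = snd p) * (\<Sum>l<c. of_bool (l = snd q) *
        (\<Phi> (munit a i j) $$ (fst p, fst q) * X $$ (i * c + k, j * c + l))))"
    unfolding sum_distrib_left
  proof (intro sum.cong refl)
    fix i j k l assume *: "i \<in> {..<a}" "j \<in> {..<a}" "k \<in> {..<c}" "l \<in> {..<c}"
    have "\<Phi> (munit a i j) \<in> carrier_mat b b" using \<Phi> * by auto
    then have "kron (\<Phi> (munit a i j)) (munit c k l) $$ (idx c p, idx c q)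
      = \<Phi> (munit a i j) $$ (fst p, fst q) * munit c k l $$ (snd p, snd q)"
      unfolding kron_def using idx_less[OF p] idx_less[OF q] p' by (simp add: dm)
    also have "munit c k l $$ (snd p, snd q) = of_bool (k = snd p) * of_bool (l = snd q)"
      using p' by (auto simp: munit_def)
    finally show "X $$ (i * c + k, j * c + l) * kron (\<Phi> (munit a i j)) (munit c k l) $$ (idx c p, idx c q) =
      of_bool (k = snd p) * (of_bool (l = snd q) * (\<Phi> (munit a i j) $$ (fst p, fst q) * X $$ (i * c + k, j * c + l)))"
      by (simp only: mult_ac)
  qed
  also have "\<dots> = ampl a \<Phi> (\<lambda>p q. X $$ (idx c p, idx c q)) p q"
    unfolding ampl_def using p' by (simp add: idx_def)
  finally show ?thesis .
qed

lemma tensor_map_carrier: "tensor_map a b a' b' \<Phi> \<Psi> X \<in> carrier_mat (b * b') (b * b')"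
  unfolding tensor_map_def by simp

lemma tnorm_le_diamond:
  assumes X: "X \<in> carrier_mat (a * a) (a * a)" "tnorm X \<le> 1"
  shows "tnorm (tensor_map a b a a \<Phi> (\<lambda>X. X) X) \<le> diamond a b \<Phi>"
  unfolding diamond_def
proof (rule cSup_upper)
  \<comment> \<open>A real \<open>Sup\<close> is informative only over a bounded set. Inputs of
    trace norm at most 1 have entries of modulus at most 1, which bounds the output entries, and
    hence the output trace norm, by a number independent of X.\<close>
  show "bdd_above {tnorm (tensor_map a b a a \<Phi> (\<lambda>X. X) X) |X. X \<in> carrier_mat (a * a) (a * a) \<and> tnorm X \<le> 1}"
  proof (rule bdd_aboveI, clarsimp)
    fix X assume X: "X \<in> carrier_mat (a * a) (a * a)" "tnorm X \<le> 1"
    have Xb: "cmod (X $$ (x, y)) \<le> 1" if "x < a * a" "y < a * a" for x y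
      using entry_le_tnorm[OF X(1) that] X(2) by linarith
    have "tnorm (tensor_map a b a a \<Phi> (\<lambda>X. X) X)
      \<le> real (b * a) * (\<Sum>x<b * a. \<Sum>y<b * a. cmod (tensor_map a b a a \<Phi> (\<lambda>X. X) X $$ (x, y)))"
      by (rule tnorm_le_sum_entries[OF tensor_map_carrier])
    also have "\<dots> \<le> real (b * a) * (\<Sum>x<b * a. \<Sum>y<b * a. \<Sum>i<a. \<Sum>j<a. \<Sum>k<a. \<Sum>l<a.
       cmod (kron (\<Phi> (munit a i j)) (munit a k l) $$ (x, y)))"
    proof (intro mult_left_mono sum_mono)
      fix x y assume "x \<in> {..<b * a}" "y \<in> {..<b * a}"
      then have "cmod (tensor_map a b a a \<Phi> (\<lambda>X. X) X $$ (x, y)) = cmod (\<Sum>i<a. \<Sum>j<a. \<Sum>k<a. \<Sum>l<a.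
         X $$ (i * a + k, j * a + l) * kron (\<Phi> (munit a i j)) (munit a k l) $$ (x, y))"
        unfolding tensor_map_def by simp
      also have "\<dots> \<le> (\<Sum>i<a. \<Sum>j<a. \<Sum>k<a. \<Sum>l<a.
         cmod (X $$ (i * a + k, j * a + l) * kron (\<Phi> (munit a i j)) (munit a k l) $$ (x, y)))"
        by (intro order.trans[OF norm_sum] sum_mono order.refl)
      also have "\<dots> \<le> (\<Sum>i<a. \<Sum>j<a. \<Sum>k<a. \<Sum>l<a.
         cmod (kron (\<Phi> (munit a i j)) (munit a k l) $$ (x, y)))"
      proof (intro sum_mono)
        fix i j k l assume "i \<in> {..<a}" "j \<in> {..<a}" "k \<in> {..<a}" "l \<in> {..<a}"
        then have "cmod (X $$ (i * a + k, j * a + l)) \<le> 1"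
          using idx_less[of "(i, k)" a a] idx_less[of "(j, l)" a a] by (intro Xb) (auto simp: idx_def)
        then show "cmod (X $$ (i * a + k, j * a + l) * kron (\<Phi> (munit a i j)) (munit a k l) $$ (x, y))
          \<le> cmod (kron (\<Phi> (munit a i j)) (munit a k l) $$ (x, y))"
          by (simp add: norm_mult mult_left_le_one_le)
      qed
      finally show "cmod (tensor_map a b a a \<Phi> (\<lambda>X. X) X $$ (x, y)) \<le> (\<Sum>i<a. \<Sum>j<a. \<Sum>k<a. \<Sum>l<a.
         cmod (kron (\<Phi> (munit a i j)) (munit a k l) $$ (x, y)))" .
    qed simp
    finally show "tnorm (tensor_map a b a a \<Phi> (\<lambda>X. X) X) \<le> real (b * a) * (\<Sum>x<b * a. \<Sum>y<b * a.
       \<Sum>i<a. \<Sum>j<a. \<Sum>k<a. \<Sum>l<a. cmod (kron (\<Phi> (munit a i j)) (munit a k l) $$ (x, y)))" .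
  qed
qed (use X in blast)

text \<open>Trace norm duality applied to a pure input on A A, the reference size used in
  \<open>diamond\<close>. Both sides are homogeneous in \<open>x\<close>, so \<open>x\<close> is
  rescaled to a unit vector; the zero vector is handled apart.\<close>

lemma ktrace_le_diamond_square:
  assumes \<Phi>: "\<And>i j. i < a \<Longrightarrow> j < a \<Longrightarrow> \<Phi> (munit a i j) \<in> carrier_mat b b"
    and K: "contraction ({..<b} \<times> {..<a}) K"
  shows "cmod (ktrace ({..<b} \<times> {..<a}) K (ampl a \<Phi> (\<lambda>p q. x p * cnj (x q))))
    \<le> diamond a b \<Phi> * sqnorm ({..<a} \<times> {..<a}) x"
proof (cases "sqnorm ({..<a} \<times> {..<a}) x = 0")
  case True
  then have "\<forall>p\<in>{..<a} \<times> {..<a}. x p = 0"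
    unfolding sqnorm_def by (subst (asm) sum_nonneg_eq_0_iff) auto
  then have "ktrace ({..<b} \<times> {..<a}) K (ampl a \<Phi> (\<lambda>p q. x p * cnj (x q))) = 0"
    unfolding ktrace_def ampl_def by (intro sum.neutral ballI) auto
  then show ?thesis using True by simp
next
  case False
  define s where "s = sqnorm ({..<a} \<times> {..<a}) x"
  have s: "s > 0" using False sqnorm_nonneg[of "{..<a} \<times> {..<a}" x] unfolding s_def by linarith
  define f where "f = (\<lambda>z. x (z div a, z mod a) / complex_of_real (sqrt s))"
  have f_idx: "f (idx a p) = x p / complex_of_real (sqrt s)" if "p \<in> {..<a} \<times> {..<a}" for p
    using that by (auto simp: f_def idx_def)
  have f1: "sqnorm {..<a * a} f = 1"
  proof -
    have "sqnorm {..<a * a} f = sqnorm ({..<a} \<times> {..<a}) (\<lambda>p. f (idx a p))"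
      by (rule sqnorm_reindex[OF bij_betw_idx])
    also have "\<dots> = s / s"
      using s unfolding sqnorm_def s_def sum_divide_distrib
      by (intro sum.cong refl) (simp add: f_idx norm_divide power_divide s_def[symmetric] sqnorm_def[symmetric])
    finally show ?thesis using s by simp
  qed
  define X where "X = Matrix.mat (a * a) (a * a) (\<lambda>(x, y). f x * cnj (f y))"
  have Xp: "X $$ (idx a p, idx a q) = x p * cnj (x q) / s"
    if "p \<in> {..<a} \<times> {..<a}" "q \<in> {..<a} \<times> {..<a}" for p q
    using that idx_less[OF that(1)] idx_less[OF that(2)] s
    by (simp add: X_def f_idx flip: of_real_mult)
  define K' where "K' = (\<lambda>y z. K (y div a, y mod a) (z div a, z mod a))"
  have K'i: "K' (idx a p) (idx a q) = K p q" if "p \<in> {..<b} \<times> {..<a}" "q \<in> {..<b} \<times> {..<a}" for p q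
    using that by (auto simp: K'_def idx_def)
  have "contraction {..<b * a} K'"
    by (rule contraction_reindex[OF bij_betw_idx K]) (rule K'i)
  then have "cmod (ktrace {..<b * a} K' (\<lambda>y z. tensor_map a b a a \<Phi> (\<lambda>X. X) X $$ (y, z)))
      \<le> tnorm (tensor_map a b a a \<Phi> (\<lambda>X. X) X)"
    by (rule ktrace_le_tnorm[OF _ tensor_map_carrier])
  also have "\<dots> \<le> diamond a b \<Phi>"
    using tnorm_rank_one[OF f1] by (intro tnorm_le_diamond) (simp_all add: X_def)
  also have "ktrace {..<b * a} K' (\<lambda>y z. tensor_map a b a a \<Phi> (\<lambda>X. X) X $$ (y, z))
    = ktrace ({..<b} \<times> {..<a}) K (\<lambda>p q. ampl a \<Phi> (\<lambda>p q. x p * cnj (x q)) p q / s)"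
    unfolding ktrace_reindex[OF bij_betw_idx]
  proof (rule ktrace_cong)
    fix p q assume pq: "p \<in> {..<b} \<times> {..<a}" "q \<in> {..<b} \<times> {..<a}"
    show "K' (idx a p) (idx a q) = K p q" by (rule K'i[OF pq])
    show "tensor_map a b a a \<Phi> (\<lambda>X. X) X $$ (idx a p, idx a q) = ampl a \<Phi> (\<lambda>p q. x p * cnj (x q)) p q / s"
    proof -
      have "tensor_map a b a a \<Phi> (\<lambda>X. X) X $$ (idx a p, idx a q)
          = ampl a \<Phi> (\<lambda>p q. X $$ (idx a p, idx a q)) p q"
        by (rule tensor_map_id_index[OF _ pq]) (rule \<Phi>)
      also have "\<dots> = ampl a \<Phi> (\<lambda>p q. x p * cnj (x q)) p q / s"
        unfolding ampl_def sum_divide_distrib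
        using pq by (intro sum.cong refl) (subst Xp, auto)
      finally show ?thesis .
    qed
  qed
  also have "\<dots> = ktrace ({..<b} \<times> {..<a}) K (ampl a \<Phi> (\<lambda>p q. x p * cnj (x q))) / s"
    unfolding ktrace_def sum_divide_distrib by simp
  finally show ?thesis using s by (simp add: norm_divide s_def[symmetric] field_simps)
qed

text \<open>Singular value decomposition of the coefficient matrix of v: the reference system C is
  replaced by a copy of A.\<close>

lemma reference_reduction:
  fixes v :: "nat \<times> nat \<Rightarrow> complex"
  obtains Q x where "\<forall>i<a. \<forall>k<c. v (i, k) = (\<Sum>m<a. Q k m * x (i, m))"
    "sqnorm ({..<a} \<times> {..<a}) x = sqnorm ({..<a} \<times> {..<c}) v"
    "\<forall>y. sqnorm {..<c} (\<lambda>k. \<Sum>m<a. Q k m * y m) \<le> sqnorm {..<a} y"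
proof -
  \<comment> \<open>Gram matrix of the rows \<open>v (i, _)\<close>. Its eigenvectors
    \<open>U\<close> combine these rows into vectors \<open>h m\<close> of the reference space that
    are orthogonal with squared norms \<open>ev m\<close>.\<close>
  define G where "G = Matrix.mat a a (\<lambda>(i, j). \<Sum>k<c. cnj (v (i, k)) * v (j, k))"
  have "psd a G"
    by (rule psd_gramI[where F = "{..<c}" and V = "\<lambda>i k. cnj (v (i, k))"]) (auto simp: G_def)
  then obtain U ev where U: "unitary_ker {..<a} U"
    and GU[rule_format]: "\<forall>x<a. \<forall>y<a. G $$ (x, y) = (\<Sum>m<a. complex_of_real (ev m) * U x m * cnj (U y m))"
    and ev0[rule_format]: "\<forall>m<a. ev m \<ge> 0"
    by (rule psd_spectral)
  define h where "h = (\<lambda>m k. \<Sum>i<a. v (i, k) * U i m)"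
  have hh: "(\<Sum>k<c. cnj (h m k) * h m' k) = of_bool (m = m') * ev m" if m: "m < a" "m' < a" for m m'
  proof -
    have "(\<Sum>k<c. cnj (h m k) * h m' k)
      = (\<Sum>k<c. \<Sum>i<a. \<Sum>j<a. cnj (U i m) * (cnj (v (i, k)) * v (j, k) * U j m'))"
      unfolding h_def cnj_sum sum_product by (intro sum.cong refl) simp
    also have "\<dots> = (\<Sum>i<a. \<Sum>j<a. \<Sum>k<c. cnj (U i m) * (cnj (v (i, k)) * v (j, k) * U j m'))"
      by (rule sum_rotate3)
    also have "\<dots> = (\<Sum>i<a. cnj (U i m) * (\<Sum>j<a. G $$ (i, j) * U j m'))"
      by (intro sum.cong refl) (simp add: G_def sum_distrib_left sum_distrib_right)
    also have "\<dots> = (\<Sum>i<a. cnj (U i m) * (ev m' * U i m'))"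
      using m GU by (intro sum.cong refl)
        (subst unitary_ker_eigen[OF U, where d = "\<lambda>k. complex_of_real (ev k)"], auto)
    also have "\<dots> = ev m' * (\<Sum>i<a. cnj (U i m) * U i m')" by (simp add: sum_distrib_left mult_ac)
    also have "\<dots> = of_bool (m = m') * ev m" using U m unfolding unitary_ker_def by auto
    finally show ?thesis .
  qed
  have h0: "h m k = 0" if "m < a" "k < c" "ev m = 0" for m k
  proof -
    have "complex_of_real (sqnorm {..<c} (h m)) = 0" unfolding of_real_sqnorm using hh[of m m] that by simp
    then have "\<forall>k\<in>{..<c}. (cmod (h m k))\<^sup>2 = 0"
      unfolding sqnorm_def by (subst (asm) of_real_eq_0_iff, subst (asm) sum_nonneg_eq_0_iff) auto
    then show ?thesis using that by simp
  qed
  \<comment> \<open>Where \<open>ev m = 0\<close>, division by zero gives 0, and \<open>h m\<close>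
    vanishes there too, so \<open>v\<close> is still recovered. Such columns of \<open>Q\<close> are
    zero: \<open>Q\<close> is a partial isometry, whence an inequality rather than an equality of
    norms in the last claim.\<close>
  define Q where "Q = (\<lambda>k m. h m k / complex_of_real (sqrt (ev m)))"
  define x where "x = (\<lambda>p. complex_of_real (sqrt (ev (snd p))) * cnj (U (fst p) (snd p)))"
  have 1: "v (i, k) = (\<Sum>m<a. Q k m * x (i, m))" if ik: "i < a" "k < c" for i k
  proof -
    have "(\<Sum>m<a. Q k m * x (i, m)) = (\<Sum>m<a. h m k * cnj (U i m))"
      using h0 ik by (intro sum.cong refl) (auto simp: Q_def x_def)
    also have "\<dots> = (\<Sum>m<a. \<Sum>j<a. v (j, k) * (U j m * cnj (U i m)))"
      unfolding h_def sum_distrib_right by (simp add: mult.assoc)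
    also have "\<dots> = (\<Sum>j<a. v (j, k) * (\<Sum>m<a. U j m * cnj (U i m)))"
      by (subst sum.swap) (simp add: sum_distrib_left)
    also have "\<dots> = (\<Sum>j<a. of_bool (j = i) * v (j, k))"
      using U ik unfolding unitary_ker_def by (intro sum.cong refl) auto
    finally show ?thesis using ik by simp
  qed
  have 2: "sqnorm ({..<a} \<times> {..<a}) x = sqnorm ({..<a} \<times> {..<c}) v"
  proof -
    have "sqnorm ({..<a} \<times> {..<a}) x = (\<Sum>i<a. \<Sum>m<a. ev m * (cmod (U i m))\<^sup>2)"
      unfolding sqnorm_def sum.cartesian_product'
      using ev0 by (auto simp: x_def norm_mult power_mult_distrib intro!: sum.cong)
    also have "\<dots> = (\<Sum>m<a. ev m * sqnorm {..<a} (\<lambda>i. U i m))"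
      by (subst sum.swap) (simp add: sqnorm_def sum_distrib_left)
    also have "\<dots> = (\<Sum>m<a. ev m)" using unitary_ker_norm[OF U] by simp
    finally have A: "sqnorm ({..<a} \<times> {..<a}) x = (\<Sum>m<a. ev m)" .
    have "complex_of_real (sqnorm ({..<a} \<times> {..<c}) v) = (\<Sum>i<a. G $$ (i, i))"
      unfolding of_real_sqnorm sum.cartesian_product' by (simp add: G_def)
    also have "\<dots> = (\<Sum>m<a. complex_of_real (ev m))"
      using GU by (intro unitary_ker_trace[OF U]) auto
    finally show ?thesis unfolding A by (simp flip: of_real_sum)
  qed
  have 3: "sqnorm {..<c} (\<lambda>k. \<Sum>m<a. Q k m * y m) \<le> sqnorm {..<a} y" for y
  proof -
    have "complex_of_real (sqnorm {..<c} (\<lambda>k. \<Sum>m<a. Q k m * y m))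
      = (\<Sum>k<c. \<Sum>m<a. \<Sum>m'<a. (cnj (h m k) * h m' k) * (cnj (y m) * y m' / (sqrt (ev m) * sqrt (ev m'))))"
      unfolding of_real_sqnorm cnj_sum sum_product
      by (intro sum.cong refl) (simp add: Q_def)
    also have "\<dots> = (\<Sum>m<a. \<Sum>m'<a. (\<Sum>k<c. cnj (h m k) * h m' k) * (cnj (y m) * y m' / (sqrt (ev m) * sqrt (ev m'))))"
      unfolding sum_distrib_right by (rule sum_rotate3)
    also have "\<dots> = (\<Sum>m<a. \<Sum>m'<a. of_bool (m = m') * (ev m * (cnj (y m) * y m' / (sqrt (ev m) * sqrt (ev m')))))"
      using hh by (intro sum.cong refl) auto
    also have "\<dots> = (\<Sum>m<a. ev m * (cnj (y m) * y m / (sqrt (ev m) * sqrt (ev m))))"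
      by (intro sum.cong refl) (subst sum_of_bool_eq, auto)
    also have "\<dots> = complex_of_real (\<Sum>m<a. of_bool (ev m \<noteq> 0) * (cmod (y m))\<^sup>2)"
      unfolding of_real_sum using ev0 by (intro sum.cong refl)
        (auto simp flip: of_real_mult simp: complex_norm_square[symmetric] mult.commute[of "cnj _"])
    finally have "sqnorm {..<c} (\<lambda>k. \<Sum>m<a. Q k m * y m) = (\<Sum>m<a. of_bool (ev m \<noteq> 0) * (cmod (y m))\<^sup>2)"
      by (simp only: of_real_eq_iff)
    also have "\<dots> \<le> sqnorm {..<a} y" unfolding sqnorm_def by (intro sum_mono) auto
    finally show ?thesis .
  qed
  show thesis using that[of Q x] 1 2 3 by blast
qed

text \<open>Cyclicity of the trace: conjugating the test by \<open>R\<close> is the same as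
  conjugating the state by its adjoint relation, which lets an operator on the reference be moved
  from the state into the test.\<close>

lemma ktrace_conj:
  "ktrace J (\<lambda>p' q'. \<Sum>p\<in>I. \<Sum>q\<in>I. cnj (R p p') * K p q * R q q') Y
    = ktrace I K (\<lambda>q p. \<Sum>q'\<in>J. \<Sum>p'\<in>J. R q q' * Y q' p' * cnj (R p p'))"
proof -
  let ?T = "\<lambda>p q p' q'. K p q * (R q q' * Y q' p' * cnj (R p p'))"
  have "ktrace J (\<lambda>p' q'. \<Sum>p\<in>I. \<Sum>q\<in>I. cnj (R p p') * K p q * R q q') Y
      = (\<Sum>p'\<in>J. \<Sum>q'\<in>J. \<Sum>p\<in>I. \<Sum>q\<in>I. ?T p q p' q')"
    unfolding ktrace_def sum_distrib_right by (intro sum.cong refl) (simp only: mult_ac)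
  also have "\<dots> = (\<Sum>q'\<in>J. \<Sum>p\<in>I. \<Sum>q\<in>I. \<Sum>p'\<in>J. ?T p q p' q')" by (rule sum_rotate4)
  also have "\<dots> = (\<Sum>p\<in>I. \<Sum>q\<in>I. \<Sum>q'\<in>J. \<Sum>p'\<in>J. ?T p q p' q')" by (rule sum_rotate3)
  finally show ?thesis unfolding ktrace_def sum_distrib_left .
qed

lemma form_conj:
  "form J (\<lambda>p' q'. \<Sum>p\<in>I. \<Sum>q\<in>I. cnj (R p p') * K p q * R q q') f g
    = form I K (\<lambda>p. \<Sum>p'\<in>J. R p p' * f p') (\<lambda>q. \<Sum>q'\<in>J. R q q' * g q')"
proof -
  have "form J (\<lambda>p' q'. \<Sum>p\<in>I. \<Sum>q\<in>I. cnj (R p p') * K p q * R q q') f g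
     = ktrace J (\<lambda>p' q'. \<Sum>p\<in>I. \<Sum>q\<in>I. cnj (R p p') * K p q * R q q') (\<lambda>q p. g q * cnj (f p))"
    unfolding form_def ktrace_def by (intro sum.cong refl) (simp only: mult_ac)
  also have "\<dots> = form I K (\<lambda>p. \<Sum>p'\<in>J. R p p' * f p') (\<lambda>q. \<Sum>q'\<in>J. R q q' * g q')"
    unfolding ktrace_conj unfolding ktrace_def form_def
  proof (intro sum.cong refl)
    fix p q
    have "(\<Sum>q'\<in>J. \<Sum>p'\<in>J. R q q' * (g q' * cnj (f p')) * cnj (R p p'))
      = (\<Sum>q'\<in>J. R q q' * g q') * cnj (\<Sum>p'\<in>J. R p p' * f p')"
      unfolding cnj_sum sum_product by (intro sum.cong refl) (simp add: mult_ac)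
    then show "K p q * (\<Sum>q'\<in>J. \<Sum>p'\<in>J. R q q' * (g q' * cnj (f p')) * cnj (R p p'))
      = cnj (\<Sum>p'\<in>J. R p p' * f p') * K p q * (\<Sum>q'\<in>J. R q q' * g q')"
      by (simp only: mult_ac)
  qed
  finally show ?thesis .
qed

lemma contraction_conj:
  assumes K: "contraction I K" and R: "\<And>f. sqnorm I (\<lambda>p. \<Sum>p'\<in>J. R p p' * f p') \<le> sqnorm J f"
  shows "contraction J (\<lambda>p' q'. \<Sum>p\<in>I. \<Sum>q\<in>I. cnj (R p p') * K p q * R q q')"
  unfolding contraction_def form_conj
proof (intro allI)
  fix f g
  have "cmod (form I K (\<lambda>p. \<Sum>p'\<in>J. R p p' * f p') (\<lambda>q. \<Sum>q'\<in>J. R q q' * g q'))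
    \<le> sqrt (sqnorm I (\<lambda>p. \<Sum>p'\<in>J. R p p' * f p')) * sqrt (sqnorm I (\<lambda>p. \<Sum>p'\<in>J. R p p' * g p'))"
    using K unfolding contraction_def by blast
  also have "\<dots> \<le> sqrt (sqnorm J f) * sqrt (sqnorm J g)"
    using R by (intro mult_mono real_sqrt_le_mono) auto
  finally show "cmod (form I K (\<lambda>p. \<Sum>p'\<in>J. R p p' * f p') (\<lambda>q. \<Sum>q'\<in>J. R q q' * g q'))
     \<le> sqrt (sqnorm J f) * sqrt (sqnorm J g)" .
qed

text \<open>Write v = (1 \<otimes> Q) x with x on A A. Since \<open>Q\<close> acts on the reference
  only, it commutes with \<Phi> \<otimes> id and can be moved into the test by cyclicity. The test
  remains a contraction because \<open>Q\<close> does not increase norms.\<close>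

lemma ktrace_le_diamond_pure:
  assumes \<Phi>: "\<And>i j. i < a \<Longrightarrow> j < a \<Longrightarrow> \<Phi> (munit a i j) \<in> carrier_mat b b"
    and K: "contraction ({..<b} \<times> {..<c}) K"
  shows "cmod (ktrace ({..<b} \<times> {..<c}) K (ampl a \<Phi> (\<lambda>p q. v p * cnj (v q))))
    \<le> diamond a b \<Phi> * sqnorm ({..<a} \<times> {..<c}) v"
proof -
  obtain Q x where v[rule_format]: "\<forall>i<a. \<forall>k<c. v (i, k) = (\<Sum>m<a. Q k m * x (i, m))"
    and x: "sqnorm ({..<a} \<times> {..<a}) x = sqnorm ({..<a} \<times> {..<c}) v"
    and Q: "\<forall>y. sqnorm {..<c} (\<lambda>k. \<Sum>m<a. Q k m * y m) \<le> sqnorm {..<a} y"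
    by (rule reference_reduction)
  let ?I = "{..<b} \<times> {..<c}" and ?J = "{..<b} \<times> {..<a}"
  \<comment> \<open>The operator 1 \<otimes> Q from B A to B C.\<close>
  define R :: "nat \<times> nat \<Rightarrow> nat \<times> nat \<Rightarrow> complex" where "R = (\<lambda>p p'. of_bool (fst p' = fst p) * Q (snd p) (snd p'))"
  have Rsum: "(\<Sum>p'\<in>?J. R p p' * f p') = (\<Sum>m<a. Q (snd p) m * f (fst p, m))" if p: "p \<in> ?I" for p f
  proof -
    have "(\<Sum>p'\<in>?J. R p p' * f p') = (\<Sum>s<b. of_bool (s = fst p) * (\<Sum>m<a. Q (snd p) m * f (s, m)))"
      unfolding sum.cartesian_product' R_def sum_distrib_left by (simp add: mult.assoc)
    then show ?thesis using p by auto
  qed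
  have R: "sqnorm ?I (\<lambda>p. \<Sum>p'\<in>?J. R p p' * f p') \<le> sqnorm ?J f" for f
  proof -
    have "sqnorm ?I (\<lambda>p. \<Sum>p'\<in>?J. R p p' * f p') = sqnorm ?I (\<lambda>p. \<Sum>m<a. Q (snd p) m * f (fst p, m))"
      unfolding sqnorm_def using Rsum by (intro sum.cong refl) auto
    also have "\<dots> = (\<Sum>s<b. sqnorm {..<c} (\<lambda>k. \<Sum>m<a. Q k m * f (s, m)))"
      unfolding sqnorm_def sum.cartesian_product' by simp
    also have "\<dots> \<le> (\<Sum>s<b. sqnorm {..<a} (\<lambda>m. f (s, m)))"
      using Q by (intro sum_mono) auto
    also have "\<dots> = sqnorm ?J f" unfolding sqnorm_def sum.cartesian_product' by simp
    finally show ?thesis .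
  qed
  have "ktrace ?I K (ampl a \<Phi> (\<lambda>p q. v p * cnj (v q)))
    = ktrace ?I K (\<lambda>q p. \<Sum>q'\<in>?J. \<Sum>p'\<in>?J. R q q' * ampl a \<Phi> (\<lambda>p q. x p * cnj (x q)) q' p' * cnj (R p p'))"
  proof (rule ktrace_cong)
    fix q p assume qp: "q \<in> ?I" "p \<in> ?I"
    let ?A = "ampl a \<Phi> (\<lambda>p q. x p * cnj (x q))"
    have "(\<Sum>q'\<in>?J. \<Sum>p'\<in>?J. R q q' * ?A q' p' * cnj (R p p'))
       = (\<Sum>q'\<in>?J. R q q' * cnj (\<Sum>p'\<in>?J. R p p' * cnj (?A q' p')))"
      unfolding cnj_sum sum_distrib_left by (intro sum.cong refl) (simp add: mult_ac)
    also have "\<dots> = (\<Sum>m<a. \<Sum>m'<a. Q (snd q) m * cnj (Q (snd p) m') * ?A (fst q, m) (fst p, m'))"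
      unfolding Rsum[OF qp(2)] Rsum[OF qp(1)] unfolding cnj_sum sum_distrib_left
      by (intro sum.cong refl) (simp add: mult_ac)
    also have "\<dots> = (\<Sum>m<a. \<Sum>m'<a. \<Sum>i<a. \<Sum>j<a. \<Phi> (munit a i j) $$ (fst q, fst p) *
         ((Q (snd q) m * x (i, m)) * cnj (Q (snd p) m' * x (j, m'))))"
      unfolding ampl_def sum_distrib_left by (intro sum.cong refl) (simp add: mult_ac)
    also have "\<dots> = (\<Sum>i<a. \<Sum>j<a. \<Sum>m<a. \<Sum>m'<a. \<Phi> (munit a i j) $$ (fst q, fst p) *
         ((Q (snd q) m * x (i, m)) * cnj (Q (snd p) m' * x (j, m'))))"
      by (rule trans[OF sum_rotate4], rule trans[OF sum_rotate4]) (rule refl)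
    also have "\<dots> = ampl a \<Phi> (\<lambda>p q. v p * cnj (v q)) q p"
      unfolding ampl_def
    proof (rule sum.cong[OF refl], rule sum.cong[OF refl])
      fix i j assume ij: "i \<in> {..<a}" "j \<in> {..<a}"
      have vv: "v (i, snd q) = (\<Sum>m<a. Q (snd q) m * x (i, m))" "v (j, snd p) = (\<Sum>m<a. Q (snd p) m * x (j, m))"
        using ij qp by (auto simp: v)
      show "(\<Sum>m<a. \<Sum>m'<a. \<Phi> (munit a i j) $$ (fst q, fst p) *
          (Q (snd q) m * x (i, m) * cnj (Q (snd p) m' * x (j, m'))))
        = \<Phi> (munit a i j) $$ (fst q, fst p) * (v (i, snd q) * cnj (v (j, snd p)))"
        unfolding vv cnj_sum sum_product unfolding sum_distrib_left ..
    qed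
    finally show "ampl a \<Phi> (\<lambda>p q. v p * cnj (v q)) q p
       = (\<Sum>q'\<in>?J. \<Sum>p'\<in>?J. R q q' * ?A q' p' * cnj (R p p'))" by simp
  qed simp
  also have "cmod \<dots> \<le> diamond a b \<Phi> * sqnorm ({..<a} \<times> {..<a}) x"
    unfolding ktrace_conj[symmetric]
    by (rule ktrace_le_diamond_square[OF _ contraction_conj[OF K R]]) (rule \<Phi>)
  finally show ?thesis unfolding x .
qed

text \<open>Convexity: split a mixed input into the pure vectors of its Gram decomposition. Their
  squared norms sum to the trace, which is 1.\<close>

lemma ktrace_le_diamond:
  fixes V :: "nat \<times> nat \<Rightarrow> 'm \<Rightarrow> complex"
  assumes \<Phi>: "\<And>i j. i < a \<Longrightarrow> j < a \<Longrightarrow> \<Phi> (munit a i j) \<in> carrier_mat b b"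
    and K: "contraction ({..<b} \<times> {..<c}) K"
    and X: "\<And>p q. p \<in> {..<a} \<times> {..<c} \<Longrightarrow> q \<in> {..<a} \<times> {..<c} \<Longrightarrow> X p q = (\<Sum>m\<in>F. V p m * cnj (V q m))"
    and tr: "(\<Sum>p\<in>{..<a} \<times> {..<c}. X p p) = 1"
  shows "cmod (ktrace ({..<b} \<times> {..<c}) K (ampl a \<Phi> X)) \<le> diamond a b \<Phi>"
proof -
  let ?I = "{..<b} \<times> {..<c}"
  let ?v = "\<lambda>m. ampl a \<Phi> (\<lambda>p q. V p m * cnj (V q m))"
  have "ktrace ?I K (ampl a \<Phi> X) = ktrace ?I K (\<lambda>p q. \<Sum>m\<in>F. ?v m p q)"
  proof (rule ktrace_cong)
    fix p q assume pq: "p \<in> ?I" "q \<in> ?I"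
    have "ampl a \<Phi> X p q = (\<Sum>i<a. \<Sum>j<a. \<Sum>m\<in>F. \<Phi> (munit a i j) $$ (fst p, fst q) *
        (V (i, snd p) m * cnj (V (j, snd q) m)))"
      unfolding ampl_def using pq X by (intro sum.cong refl) (auto simp: sum_distrib_left)
    also have "\<dots> = (\<Sum>m\<in>F. ?v m p q)" unfolding ampl_def by (rule sum_rotate3[symmetric])
    finally show "ampl a \<Phi> X p q = (\<Sum>m\<in>F. ?v m p q)" .
  qed simp
  also have "\<dots> = (\<Sum>m\<in>F. ktrace ?I K (?v m))"
    unfolding ktrace_def sum_distrib_left by (rule sum_rotate3[symmetric])
  finally have "cmod (ktrace ?I K (ampl a \<Phi> X)) \<le> (\<Sum>m\<in>F. cmod (ktrace ?I K (?v m)))"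
    by (simp add: norm_sum)
  also have "\<dots> \<le> (\<Sum>m\<in>F. diamond a b \<Phi> * sqnorm ({..<a} \<times> {..<c}) (\<lambda>p. V p m))"
    by (intro sum_mono ktrace_le_diamond_pure[OF _ K]) (rule \<Phi>)
  also have "\<dots> = diamond a b \<Phi> * (\<Sum>m\<in>F. sqnorm ({..<a} \<times> {..<c}) (\<lambda>p. V p m))"
    by (simp add: sum_distrib_left)
  also have "(\<Sum>m\<in>F. sqnorm ({..<a} \<times> {..<c}) (\<lambda>p. V p m)) = 1"
  proof -
    have "complex_of_real (\<Sum>m\<in>F. sqnorm ({..<a} \<times> {..<c}) (\<lambda>p. V p m))
       = (\<Sum>p\<in>{..<a} \<times> {..<c}. X p p)"
      unfolding of_real_sum of_real_sqnorm
      by (rule trans[OF sum.swap], rule sum.cong[OF refl]) (simp add: X mult.commute)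
    then show ?thesis unfolding tr by (simp only: of_real_eq_1_iff)
  qed
  finally show ?thesis by simp
qed

section \<open>Tensor powers of channels\<close>

text \<open>Extensional functions, so that each n-tuple is represented exactly once and a sum over
  tuples of a product turns into a product of sums.\<close>

definition multi :: "nat \<Rightarrow> nat \<Rightarrow> (nat \<Rightarrow> nat) set" where
  "multi n d = {..<n} \<rightarrow>\<^sub>E {..<d}"

lemma finite_multi [simp]: "finite (multi n d)"
  unfolding multi_def by (simp add: finite_PiE)

lemma card_multi: "card (multi n d) = d ^ n"
  unfolding multi_def by (simp add: card_funcsetE)

lemma multiD: "z \<in> multi n d \<Longrightarrow> t < n \<Longrightarrow> z t < d"
  unfolding multi_def by auto

lemma multi_eqI: "z \<in> multi n d \<Longrightarrow> z' \<in> multi n d \<Longrightarrow> (\<And>t. t < n \<Longrightarrow> z t = z' t) \<Longrightarrow> z = z'"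
  unfolding multi_def by (rule PiE_ext) auto

lemma restrict_multi: "(\<And>t. t < n \<Longrightarrow> z t < d) \<Longrightarrow> restrict z {..<n} \<in> multi n d"
  unfolding multi_def by auto

lemma sum_multi_prod:
  fixes f :: "nat \<Rightarrow> nat \<Rightarrow> 'a :: comm_semiring_1"
  shows "(\<Sum>z\<in>multi n d. \<Prod>t<n. f t (z t)) = (\<Prod>t<n. \<Sum>i<d. f t i)"
  unfolding multi_def by (rule prod_sum_PiE[symmetric]) auto

definition kpow :: "nat \<Rightarrow> (nat \<Rightarrow> nat \<Rightarrow> complex) \<Rightarrow> (nat \<Rightarrow> nat) \<Rightarrow> (nat \<Rightarrow> nat) \<Rightarrow> complex" where
  "kpow n R z z' = (\<Prod>t<n. R (z t) (z' t))"

lemma prod_of_bool: "(\<Prod>t<(n::nat). of_bool (P t)) = (of_bool (\<forall>t<n. P t) :: complex)"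
  by (induction n) (auto simp: less_Suc_eq)

lemma unitary_ker_kpow:
  assumes U: "unitary_ker {..<d} U"
  shows "unitary_ker (multi n d) (kpow n U)"
  unfolding unitary_ker_def
proof (intro conjI ballI)
  fix k l assume kl: "k \<in> multi n d" "l \<in> multi n d"
  have eq: "(\<forall>t<n. k t = l t) \<longleftrightarrow> k = l" using multi_eqI[OF kl] by auto
  have "(\<Sum>x\<in>multi n d. cnj (kpow n U x k) * kpow n U x l)
      = (\<Sum>x\<in>multi n d. \<Prod>t<n. cnj (U (x t) (k t)) * U (x t) (l t))"
    unfolding kpow_def by (simp add: prod.distrib)
  also have "\<dots> = (\<Prod>t<n. \<Sum>x<d. cnj (U x (k t)) * U x (l t))"
    by (rule sum_multi_prod)
  also have "\<dots> = (\<Prod>t<n. of_bool (k t = l t))"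
    using U multiD[OF kl(1)] multiD[OF kl(2)] unfolding unitary_ker_def by (intro prod.cong refl) auto
  finally show "(\<Sum>x\<in>multi n d. cnj (kpow n U x k) * kpow n U x l) = of_bool (k = l)"
    by (simp only: prod_of_bool eq)
  have "(\<Sum>x\<in>multi n d. kpow n U k x * cnj (kpow n U l x))
      = (\<Sum>x\<in>multi n d. \<Prod>t<n. U (k t) (x t) * cnj (U (l t) (x t)))"
    unfolding kpow_def by (simp add: prod.distrib)
  also have "\<dots> = (\<Prod>t<n. \<Sum>x<d. U (k t) x * cnj (U (l t) x))"
    by (rule sum_multi_prod)
  also have "\<dots> = (\<Prod>t<n. of_bool (k t = l t))"
    using U multiD[OF kl(1)] multiD[OF kl(2)] unfolding unitary_ker_def by (intro prod.cong refl) auto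
  finally show "(\<Sum>x\<in>multi n d. kpow n U k x * cnj (kpow n U l x)) = of_bool (k = l)"
    by (simp only: prod_of_bool eq)
qed

lemma kpow_spectral:
  assumes R: "\<And>x y. x < d \<Longrightarrow> y < d \<Longrightarrow> R x y = (\<Sum>m<e. w m * U x m * cnj (U y m))"
    and z: "\<And>t. t < n \<Longrightarrow> z t < d" "\<And>t. t < n \<Longrightarrow> z' t < d"
  shows "kpow n R z z' = (\<Sum>m\<in>multi n e. (\<Prod>t<n. w (m t)) * kpow n U z m * cnj (kpow n U z' m))"
proof -
  have "kpow n R z z' = (\<Prod>t<n. \<Sum>m<e. w m * U (z t) m * cnj (U (z' t) m))"
    unfolding kpow_def using R z by (intro prod.cong refl) auto
  also have "\<dots> = (\<Sum>m\<in>multi n e. \<Prod>t<n. w (m t) * U (z t) (m t) * cnj (U (z' t) (m t)))"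
    by (rule sum_multi_prod[symmetric])
  finally show ?thesis unfolding kpow_def by (simp add: prod.distrib)
qed

lemma kpow_trace: "(\<Sum>z\<in>multi n d. kpow n R z z) = (\<Sum>x<d. R x x) ^ n"
  unfolding kpow_def by (subst sum_multi_prod) simp

text \<open>Base-b digits with the last component most significant. This matches
  \<open>tpow\<close>, whose recursion puts the newest factor on the left of the tensor
  product.\<close>

primrec enc :: "nat \<Rightarrow> nat \<Rightarrow> (nat \<Rightarrow> nat) \<Rightarrow> nat" where
  "enc b 0 f = 0"
| "enc b (Suc n) f = f n * b ^ n + enc b n f"

lemma enc_less: "(\<And>t. t < n \<Longrightarrow> f t < b) \<Longrightarrow> enc b n f < b ^ n"
proof (induction n)
  case (Suc n)
  then have "idx (b ^ n) (f n, enc b n f) < b * b ^ n" by (intro idx_less) auto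
  then show ?case by (simp add: idx_def)
qed simp

lemma enc_inject:
  "(\<And>t. t < n \<Longrightarrow> f t < b) \<Longrightarrow> (\<And>t. t < n \<Longrightarrow> g t < b) \<Longrightarrow> enc b n f = enc b n g \<Longrightarrow> t < n \<Longrightarrow> f t = g t"
proof (induction n)
  case (Suc n)
  have l: "enc b n f < b ^ n" "enc b n g < b ^ n" using Suc.prems by (auto intro!: enc_less)
  have e: "f n * b ^ n + enc b n f = g n * b ^ n + enc b n g" using Suc.prems by simp
  from e have "idx (b ^ n) (f n, enc b n f) div b ^ n = idx (b ^ n) (g n, enc b n g) div b ^ n"
    by (simp add: idx_def)
  then have "f n = g n" using l by simp
  moreover from this e have "enc b n f = enc b n g" by simp
  ultimately show ?case using Suc by (auto simp: less_Suc_eq)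
qed simp

lemma enc_cong: "(\<And>t. t < n \<Longrightarrow> f t = g t) \<Longrightarrow> enc b n f = enc b n g"
  by (induction n) auto

lemma bij_betw_enc: "bij_betw (enc b n) (multi n b) {..<b ^ n}"
proof -
  have inj: "inj_on (enc b n) (multi n b)"
    by (intro inj_onI multi_eqI) (auto dest: multiD intro: enc_inject)
  moreover have "enc b n ` multi n b \<subseteq> {..<b ^ n}" by (auto intro!: enc_less dest: multiD)
  ultimately have "enc b n ` multi n b = {..<b ^ n}"
    by (intro card_subset_eq) (auto simp: card_image card_multi)
  then show ?thesis using inj by (simp add: bij_betw_def)
qed

text \<open>The component \<open>z t\<close> indexes the t-th copy of B C. Splitting every component
  into its B digit and its C digit regroups (B C)...(B C) into B...B C...C.\<close>

definition pidx :: "nat \<Rightarrow> nat \<Rightarrow> nat \<Rightarrow> (nat \<Rightarrow> nat) \<Rightarrow> nat \<times> nat" where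
  "pidx b c n z = (enc b n (\<lambda>t. z t div c), enc c n (\<lambda>t. z t mod c))"

lemma pidx_mem:
  assumes "\<And>t. t < n \<Longrightarrow> z t < b * c"
  shows "pidx b c n z \<in> {..<b ^ n} \<times> {..<c ^ n}"
proof -
  have "z t div c < b \<and> z t mod c < c" if "t < n" for t
    using assms[OF that] by (metis less_mult_imp_div_less mod_less_divisor mult_0_right neq0_conv not_less0)
  then show ?thesis unfolding pidx_def by (auto intro!: enc_less)
qed

lemma pidx_inject:
  assumes "\<And>t. t < n \<Longrightarrow> z t < b * c" "\<And>t. t < n \<Longrightarrow> z' t < b * c" "pidx b c n z = pidx b c n z'" "t < n"
  shows "z t = z' t"
proof -
  have *: "z t div c < b \<and> z t mod c < c \<and> z' t div c < b \<and> z' t mod c < c" if "t < n" for t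
    using assms(1,2)[OF that] by (metis less_mult_imp_div_less mod_less_divisor mult_0_right neq0_conv not_less0)
  have "z t div c = z' t div c"
    using * assms(3,4) by (intro enc_inject[of n "\<lambda>t. z t div c" b "\<lambda>t. z' t div c"]) (auto simp: pidx_def)
  moreover have "z t mod c = z' t mod c"
    using * assms(3,4) by (intro enc_inject[of n "\<lambda>t. z t mod c" c "\<lambda>t. z' t mod c"]) (auto simp: pidx_def)
  ultimately show ?thesis by (metis div_mult_mod_eq)
qed

lemma bij_betw_pidx: "bij_betw (pidx b c n) (multi n (b * c)) ({..<b ^ n} \<times> {..<c ^ n})"
proof -
  have inj: "inj_on (pidx b c n) (multi n (b * c))"
    by (intro inj_onI multi_eqI) (auto dest: multiD intro: pidx_inject)
  moreover have "pidx b c n ` multi n (b * c) \<subseteq> {..<b ^ n} \<times> {..<c ^ n}"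
    using pidx_mem multiD by blast
  ultimately have "pidx b c n ` multi n (b * c) = {..<b ^ n} \<times> {..<c ^ n}"
    by (intro card_subset_eq) (auto simp: card_image card_multi power_mult_distrib)
  then show ?thesis using inj by (simp add: bij_betw_def)
qed

definition midx :: "nat \<Rightarrow> nat \<Rightarrow> nat \<Rightarrow> (nat \<Rightarrow> nat) \<Rightarrow> nat" where
  "midx b c n z = idx (c ^ n) (pidx b c n z)"

lemma bij_betw_midx: "bij_betw (midx b c n) (multi n (b * c)) {..<b ^ n * c ^ n}"
  using bij_betw_trans[OF bij_betw_pidx bij_betw_idx] by (simp add: midx_def[abs_def] comp_def)

text \<open>The n-fold tensor power of an operator on A C, reordered from (A C)...(A C)
  to A...A C...C.\<close>

definition shuffled_pow :: "nat \<Rightarrow> nat \<Rightarrow> nat \<Rightarrow> complex mat \<Rightarrow> complex mat" where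
  "shuffled_pow b c n R = Matrix.mat (b ^ n * c ^ n) (b ^ n * c ^ n) (\<lambda>(x, y).
     kpow n (\<lambda>x y. R $$ (x, y)) (inv_into (multi n (b * c)) (midx b c n) x)
       (inv_into (multi n (b * c)) (midx b c n) y))"

lemma shuffled_pow_index:
  assumes z: "\<And>t. t < n \<Longrightarrow> z t < b * c" "\<And>t. t < n \<Longrightarrow> z' t < b * c"
  shows "shuffled_pow b c n R $$ (idx (c ^ n) (pidx b c n z), idx (c ^ n) (pidx b c n z'))
    = kpow n (\<lambda>x y. R $$ (x, y)) z z'"
proof -
  \<comment> \<open>The arguments need not be extensional outside the first n positions. The
    encoding reads only those positions, so they may be restricted first; this permits tuples given
    by arbitrary lambda terms.\<close>
  let ?r = "\<lambda>z. restrict z {..<n}"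
  have r: "?r z \<in> multi n (b * c)" "?r z' \<in> multi n (b * c)" using z by (auto intro: restrict_multi)
  have p: "idx (c ^ n) (pidx b c n z) = midx b c n (?r z)" "idx (c ^ n) (pidx b c n z') = midx b c n (?r z')"
    unfolding midx_def pidx_def by (auto intro!: arg_cong[of _ _ "idx _"] enc_cong)
  have m: "midx b c n (?r z) < b ^ n * c ^ n" "midx b c n (?r z') < b ^ n * c ^ n"
    using bij_betwE[OF bij_betw_midx] r by auto
  show ?thesis unfolding p shuffled_pow_def using m r
    by (simp add: bij_betw_inv_into_left[OF bij_betw_midx]) (simp add: kpow_def)
qed

lemma shuffled_pow_carrier: "shuffled_pow b c n R \<in> carrier_mat (b ^ n * c ^ n) (b ^ n * c ^ n)"
  unfolding shuffled_pow_def by simp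

text \<open>The square roots of the eigenvalues are absorbed into the vectors. The factor 1 keeps
  the shape that \<open>kpow_spectral\<close> expects, with trivial weights.\<close>

lemma psd_gram:
  assumes "psd d R"
  obtains V where "\<forall>x<d. \<forall>y<d. R $$ (x, y) = (\<Sum>m<d. 1 * V x m * cnj (V y m))"
proof -
  obtain U ev where R[rule_format]: "\<forall>x<d. \<forall>y<d. R $$ (x, y) = (\<Sum>m<d. complex_of_real (ev m) * U x m * cnj (U y m))"
    and ev[rule_format]: "\<forall>m<d. ev m \<ge> 0" using psd_spectral[OF assms] .
  show thesis
    by (rule that[of "\<lambda>x m. complex_of_real (sqrt (ev m)) * U x m"])
      (use ev in \<open>auto simp: R mult_ac intro!: sum.cong simp flip: of_real_mult\<close>)
qed

lemma density_shuffled_pow: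
  assumes R: "density (b * c) R"
  obtains V :: "nat \<Rightarrow> (nat \<Rightarrow> nat) \<Rightarrow> complex" and F where
    "\<forall>x<b ^ n * c ^ n. \<forall>y<b ^ n * c ^ n. shuffled_pow b c n R $$ (x, y) = (\<Sum>m\<in>F. V x m * cnj (V y m))"
    "(\<Sum>x<b ^ n * c ^ n. shuffled_pow b c n R $$ (x, x)) = 1"
proof -
  let ?d = "b * c"
  have Rp: "psd ?d R" and tr: "mtrace R = 1" using R unfolding density_def by auto
  obtain V where V: "\<forall>x<?d. \<forall>y<?d. R $$ (x, y) = (\<Sum>m<?d. 1 * V x m * cnj (V y m))"
    using psd_gram[OF Rp] .
  define dz where "dz = inv_into (multi n ?d) (midx b c n)"
  have dz: "dz x \<in> multi n ?d" if "x < b ^ n * c ^ n" for x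
    unfolding dz_def using that bij_betw_inv_into[OF bij_betw_midx, THEN bij_betwE, of b n c] by auto
  have "shuffled_pow b c n R $$ (x, y) = (\<Sum>m\<in>multi n ?d. kpow n V (dz x) m * cnj (kpow n V (dz y) m))"
    if xy: "x < b ^ n * c ^ n" "y < b ^ n * c ^ n" for x y
  proof -
    have "shuffled_pow b c n R $$ (x, y) = kpow n (\<lambda>x y. R $$ (x, y)) (dz x) (dz y)"
      unfolding shuffled_pow_def dz_def using xy by simp
    also have "\<dots> = (\<Sum>m\<in>multi n ?d. (\<Prod>t<n. 1) * kpow n V (dz x) m * cnj (kpow n V (dz y) m))"
      using V multiD[OF dz[OF xy(1)]] multiD[OF dz[OF xy(2)]]
      by (intro kpow_spectral[where d = ?d]) auto
    finally show ?thesis by simp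
  qed
  moreover have "(\<Sum>x<b ^ n * c ^ n. shuffled_pow b c n R $$ (x, x)) = 1"
  proof -
    have "(\<Sum>x<b ^ n * c ^ n. shuffled_pow b c n R $$ (x, x))
        = (\<Sum>z\<in>multi n ?d. shuffled_pow b c n R $$ (midx b c n z, midx b c n z))"
      by (rule sum.reindex_bij_betw[OF bij_betw_midx, symmetric])
    also have "\<dots> = (\<Sum>z\<in>multi n ?d. kpow n (\<lambda>x y. R $$ (x, y)) z z)"
      unfolding midx_def by (intro sum.cong refl shuffled_pow_index) (auto dest: multiD)
    also have "\<dots> = 1"
      using tr psd_carrier[OF Rp] unfolding kpow_trace mtrace_def by auto
    finally show ?thesis .
  qed
  ultimately show thesis using that[of "\<lambda>x. kpow n V (dz x)" "multi n ?d"] by auto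
qed

lemma tensor_map_munit:
  assumes N: "N (munit a i j) \<in> carrier_mat b b" and M: "M (munit a' k l) \<in> carrier_mat b' b'"
    and ij: "i < a" "j < a" "k < a'" "l < a'" and p: "p \<in> {..<b} \<times> {..<b'}" "q \<in> {..<b} \<times> {..<b'}"
  shows "tensor_map a b a' b' N M (munit (a * a') (i * a' + k) (j * a' + l)) $$ (idx b' p, idx b' q)
    = N (munit a i j) $$ (fst p, fst q) * M (munit a' k l) $$ (snd p, snd q)"
proof -
  let ?X = "munit (a * a') (i * a' + k) (j * a' + l)"
  have X: "?X $$ (i' * a' + k', j' * a' + l') = of_bool (i' = i) * of_bool (j' = j) * of_bool (k' = k) * of_bool (l' = l)"
    if "i' < a" "j' < a" "k' < a'" "l' < a'" for i' j' k' l'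
  proof -
    have b: "i' * a' + k' < a * a'" "j' * a' + l' < a * a'"
      using idx_less[of "(i', k')" a a'] idx_less[of "(j', l')" a a'] that by (auto simp: idx_def)
    have "i' * a' + k' = i * a' + k \<longleftrightarrow> i' = i \<and> k' = k" "j' * a' + l' = j * a' + l \<longleftrightarrow> j' = j \<and> l' = l"
      using inj_onD[OF bij_betw_imp_inj_on[OF bij_betw_idx[of a' a]], of "(i', k')" "(i, k)"]
        inj_onD[OF bij_betw_imp_inj_on[OF bij_betw_idx[of a' a]], of "(j', l')" "(j, l)"] that ij
      by (auto simp: idx_def)
    then show ?thesis using b by (auto simp: munit_def)
  qed
  have "tensor_map a b a' b' N M ?X $$ (idx b' p, idx b' q)
     = (\<Sum>i'<a. \<Sum>j'<a. \<Sum>k'<a'. \<Sum>l'<a'. ?X $$ (i' * a' + k', j' * a' + l') *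
        kron (N (munit a i' j')) (M (munit a' k' l')) $$ (idx b' p, idx b' q))"
    unfolding tensor_map_def using idx_less[OF p(1)] idx_less[OF p(2)] by simp
  also have "\<dots> = (\<Sum>i'<a. of_bool (i' = i) * (\<Sum>j'<a. of_bool (j' = j) * (\<Sum>k'<a'. of_bool (k' = k) *
       (\<Sum>l'<a'. of_bool (l' = l) * kron (N (munit a i' j')) (M (munit a' k' l')) $$ (idx b' p, idx b' q)))))"
    unfolding sum_distrib_left by (intro sum.cong refl) (simp add: X mult.assoc)
  also have "\<dots> = kron (N (munit a i j)) (M (munit a' k l)) $$ (idx b' p, idx b' q)"
    using ij by simp
  also have "\<dots> = N (munit a i j) $$ (fst p, fst q) * M (munit a' k l) $$ (snd p, snd q)"
    unfolding kron_def using idx_less[OF p(1)] idx_less[OF p(2)] N M p by auto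
  finally show ?thesis .
qed

lemma tpow_carrier:
  "X \<in> carrier_mat (a ^ n) (a ^ n) \<Longrightarrow> tpow a b N n X \<in> carrier_mat (b ^ n) (b ^ n)"
  by (cases n) (auto intro: tensor_map_carrier)

lemma munit_carrier: "munit a i j \<in> carrier_mat a a"
  unfolding munit_def by simp

lemma tpow_munit:
  assumes N: "\<And>i j. i < a \<Longrightarrow> j < a \<Longrightarrow> N (munit a i j) \<in> carrier_mat b b"
    and "\<And>t. t < n \<Longrightarrow> f t < a" "\<And>t. t < n \<Longrightarrow> g t < a" "\<And>t. t < n \<Longrightarrow> r t < b" "\<And>t. t < n \<Longrightarrow> s t < b"
  shows "tpow a b N n (munit (a ^ n) (enc a n f) (enc a n g)) $$ (enc b n r, enc b n s)
    = (\<Prod>t<n. N (munit a (f t) (g t)) $$ (r t, s t))"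
  using assms(2-)
proof (induction n)
  case 0
  then show ?case by (simp add: munit_def)
next
  case (Suc n)
  have "tpow a b N (Suc n) (munit (a ^ Suc n) (enc a (Suc n) f) (enc a (Suc n) g)) $$ (enc b (Suc n) r, enc b (Suc n) s)
    = tensor_map a b (a ^ n) (b ^ n) N (tpow a b N n)
        (munit (a * a ^ n) (f n * a ^ n + enc a n f) (g n * a ^ n + enc a n g))
        $$ (idx (b ^ n) (r n, enc b n r), idx (b ^ n) (s n, enc b n s))"
    by (simp add: idx_def)
  also have "\<dots> = N (munit a (f n) (g n)) $$ (r n, s n)
      * tpow a b N n (munit (a ^ n) (enc a n f) (enc a n g)) $$ (enc b n r, enc b n s)"
    using Suc.prems by (subst tensor_map_munit)
      (auto intro!: N enc_less tpow_carrier munit_carrier)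
  also have "\<dots> = (\<Prod>t<Suc n. N (munit a (f t) (g t)) $$ (r t, s t))"
    using Suc by (simp add: mult.commute)
  finally show ?case .
qed

text \<open>The power of a channel acts on the power of a state copy by copy, up to regrouping of
  the factors. On matrix units and tuple indices all ingredients are products over the copies, so
  the sums over input tuples factorise into single-copy sums.\<close>

lemma ampl_tpow:
  assumes N: "\<And>i j. i < a \<Longrightarrow> j < a \<Longrightarrow> N (munit a i j) \<in> carrier_mat b b"
    and z: "z \<in> multi n (b * c)" "z' \<in> multi n (b * c)"
  shows "ampl (a ^ n) (tpow a b N n) (\<lambda>p q. shuffled_pow a c n R $$ (idx (c ^ n) p, idx (c ^ n) q)) (pidx b c n z) (pidx b c n z')
    = kpow n (\<lambda>x y. tensor_map a b c c N (\<lambda>X. X) R $$ (x, y)) z z'"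
proof -
  have dm: "z t div c < b" "z t mod c < c" "z' t div c < b" "z' t mod c < c" if "t < n" for t
    using multiD[OF z(1) that] multiD[OF z(2) that]
    by (metis less_mult_imp_div_less mod_less_divisor mult_0_right neq0_conv not_less0)+
  let ?F = "\<lambda>t i j. N (munit a i j) $$ (z t div c, z' t div c) * R $$ (i * c + z t mod c, j * c + z' t mod c)"
  have *: "tpow a b N n (munit (a ^ n) (enc a n f) (enc a n g)) $$ (fst (pidx b c n z), fst (pidx b c n z'))
      * shuffled_pow a c n R $$ (idx (c ^ n) (enc a n f, snd (pidx b c n z)), idx (c ^ n) (enc a n g, snd (pidx b c n z')))
      = (\<Prod>t<n. ?F t (f t) (g t))" if fg: "f \<in> multi n a" "g \<in> multi n a" for f g
  proof -
    have lt: "f t * c + z t mod c < a * c" "g t * c + z' t mod c < a * c" if "t < n" for t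
      using idx_less[of "(f t, z t mod c)" a c] idx_less[of "(g t, z' t mod c)" a c] dm[OF that]
        multiD[OF fg(1) that] multiD[OF fg(2) that] by (auto simp: idx_def)
    have div_q: "(q * c + r) div c = q" if "r < c" for q r using that by simp
    have p: "(enc a n f, snd (pidx b c n z)) = pidx a c n (\<lambda>t. f t * c + z t mod c)"
      "(enc a n g, snd (pidx b c n z')) = pidx a c n (\<lambda>t. g t * c + z' t mod c)"
      unfolding pidx_def using dm(2,4) by (auto intro!: enc_cong simp: div_q)
    have "shuffled_pow a c n R $$ (idx (c ^ n) (enc a n f, snd (pidx b c n z)), idx (c ^ n) (enc a n g, snd (pidx b c n z')))
      = (\<Prod>t<n. R $$ (f t * c + z t mod c, g t * c + z' t mod c))"
      unfolding p by (subst shuffled_pow_index) (auto simp: lt kpow_def)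
    moreover have "tpow a b N n (munit (a ^ n) (enc a n f) (enc a n g)) $$ (fst (pidx b c n z), fst (pidx b c n z'))
      = (\<Prod>t<n. N (munit a (f t) (g t)) $$ (z t div c, z' t div c))"
      unfolding pidx_def fst_conv using dm multiD[OF fg(1)] multiD[OF fg(2)] by (intro tpow_munit N) auto
    ultimately show ?thesis by (simp add: prod.distrib)
  qed
  have "ampl (a ^ n) (tpow a b N n) (\<lambda>p q. shuffled_pow a c n R $$ (idx (c ^ n) p, idx (c ^ n) q)) (pidx b c n z) (pidx b c n z')
    = (\<Sum>f\<in>multi n a. \<Sum>g\<in>multi n a. \<Prod>t<n. ?F t (f t) (g t))"
    unfolding ampl_def sum.reindex_bij_betw[OF bij_betw_enc, symmetric]
    by (intro sum.cong refl *)
  also have "\<dots> = (\<Prod>t<n. \<Sum>i<a. \<Sum>j<a. ?F t i j)"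
    unfolding sum_multi_prod[where f = "\<lambda>t i. \<Sum>j<a. ?F t i j", symmetric]
    by (rule sum.cong[OF refl]) (rule sum_multi_prod)
  also have "\<dots> = kpow n (\<lambda>x y. tensor_map a b c c N (\<lambda>X. X) R $$ (x, y)) z z'"
    unfolding kpow_def
  proof (intro prod.cong refl)
    fix t assume "t \<in> {..<n}"
    then have t: "t < n" by simp
    have "tensor_map a b c c N (\<lambda>X. X) R $$ (idx c (z t div c, z t mod c), idx c (z' t div c, z' t mod c))
      = ampl a N (\<lambda>p q. R $$ (idx c p, idx c q)) (z t div c, z t mod c) (z' t div c, z' t mod c)"
      using dm[OF t] by (intro tensor_map_id_index N) auto
    then show "(\<Sum>i<a. \<Sum>j<a. ?F t i j) = tensor_map a b c c N (\<lambda>X. X) R $$ (z t, z' t)"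
      by (simp add: ampl_def idx_def)
  qed
  finally show ?thesis .
qed

section \<open>Tail bounds and the projective test\<close>

text \<open>The moment generating function \<open>m\<close> of f - E - \<delta> satisfies m 0 = 1
  and has derivative -\<delta> at 0, so m \<theta> < 1 for some \<theta> > 0. Markov's inequality
  for the exponential of the sum then gives the tail with \<kappa> = m \<theta>.\<close>

lemma chernoff_tail:
  fixes p f :: "nat \<Rightarrow> real"
  assumes p0: "\<And>i. i < d \<Longrightarrow> 0 \<le> p i" and p1: "(\<Sum>i<d. p i) = 1" and \<delta>: "0 < \<delta>"
  defines "E \<equiv> (\<Sum>i<d. p i * f i)"
  obtains \<kappa> where "0 \<le> \<kappa>" "\<kappa> < 1"
    "\<forall>n. (\<Sum>z\<in>{z \<in> multi n d. real n * (E + \<delta>) < (\<Sum>t<n. f (z t))}. \<Prod>t<n. p (z t)) \<le> \<kappa> ^ n"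
proof -
  define m where "m = (\<lambda>\<theta>. \<Sum>i<d. p i * exp (\<theta> * (f i - E - \<delta>)))"
  have "(\<Sum>i<d. p i * (f i - E - \<delta>)) = (\<Sum>i<d. p i * f i - p i * (E + \<delta>))"
    by (intro sum.cong refl) (simp add: algebra_simps)
  also have "\<dots> = E - (\<Sum>i<d. p i) * (E + \<delta>)"
    unfolding sum_subtractf sum_distrib_right E_def ..
  finally have "(\<Sum>i<d. p i * (f i - E - \<delta>)) = - \<delta>" using p1 by simp
  moreover have "(m has_real_derivative (\<Sum>i<d. p i * (f i - E - \<delta>))) (at 0)"
    unfolding m_def by (auto intro!: derivative_eq_intros sum.cong)
  ultimately have "DERIV m 0 :> - \<delta>" by simp
  then have "\<exists>e>0. \<forall>h>0. h < e \<longrightarrow> m (0 + h) < m 0"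
    using \<delta> by (intro DERIV_neg_dec_right) auto
  then obtain e where e: "e > 0" "\<And>h. 0 < h \<Longrightarrow> h < e \<Longrightarrow> m (0 + h) < m 0" by blast
  define \<theta> where "\<theta> = e / 2"
  have \<theta>: "\<theta> > 0" and "m \<theta> < m 0" using e(1) e(2)[of \<theta>] by (auto simp: \<theta>_def)
  then have m1: "m \<theta> < 1" using p1 by (simp add: m_def)
  have m0: "0 \<le> m \<theta>" unfolding m_def using p0 by (auto intro!: sum_nonneg)
  have "(\<Sum>z\<in>{z \<in> multi n d. real n * (E + \<delta>) < (\<Sum>t<n. f (z t))}. \<Prod>t<n. p (z t)) \<le> m \<theta> ^ n" for n
  proof -
    let ?B = "{z \<in> multi n d. real n * (E + \<delta>) < (\<Sum>t<n. f (z t))}"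
    have "(\<Sum>z\<in>?B. \<Prod>t<n. p (z t)) \<le> (\<Sum>z\<in>?B. \<Prod>t<n. p (z t) * exp (\<theta> * (f (z t) - E - \<delta>)))"
    proof (rule sum_mono)
      fix z assume z: "z \<in> ?B"
      have "(\<Sum>t<n. f (z t) - E - \<delta>) = (\<Sum>t<n. f (z t)) - real n * (E + \<delta>)"
        by (simp add: sum_subtractf algebra_simps)
      then have "1 \<le> exp (\<theta> * (\<Sum>t<n. f (z t) - E - \<delta>))" using z \<theta> by simp
      also have "\<dots> = (\<Prod>t<n. exp (\<theta> * (f (z t) - E - \<delta>)))"
        by (simp add: sum_distrib_left exp_sum)
      finally have "(\<Prod>t<n. p (z t)) * 1 \<le> (\<Prod>t<n. p (z t)) * (\<Prod>t<n. exp (\<theta> * (f (z t) - E - \<delta>)))"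
        using z p0 by (intro mult_left_mono prod_nonneg) (auto simp: multiD)
      then show "(\<Prod>t<n. p (z t)) \<le> (\<Prod>t<n. p (z t) * exp (\<theta> * (f (z t) - E - \<delta>)))"
        by (simp add: prod.distrib)
    qed
    also have "\<dots> \<le> (\<Sum>z\<in>multi n d. \<Prod>t<n. p (z t) * exp (\<theta> * (f (z t) - E - \<delta>)))"
      using p0 by (intro sum_mono2) (auto intro!: prod_nonneg mult_nonneg_nonneg simp: multiD)
    also have "\<dots> = m \<theta> ^ n"
      by (subst sum_multi_prod[where f = "\<lambda>t i. p i * exp (\<theta> * (f i - E - \<delta>))"]) (simp add: m_def)
    finally show ?thesis .
  qed
  then show thesis using that[OF m0 m1] by blast
qed

section \<open>Inner products and Parseval over an index set\<close>

definition ip :: "'i set \<Rightarrow> ('i \<Rightarrow> complex) \<Rightarrow> ('i \<Rightarrow> complex) \<Rightarrow> complex" where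
  "ip I f g = (\<Sum>x\<in>I. cnj (f x) * g x)"

lemma ip_cnj: "cnj (ip I f g) = ip I g f"
  unfolding ip_def by (simp add: mult.commute)

lemma ip_lincomb: "ip I f (\<lambda>x. \<Sum>j\<in>J. w x j * c j) = (\<Sum>j\<in>J. ip I f (\<lambda>x. w x j) * c j)"
  unfolding ip_def sum_distrib_left sum_distrib_right
  by (subst sum.swap) (simp add: mult.assoc)

lemma ip_cauchy_schwarz: "cmod (ip I f g) \<le> sqrt (sqnorm I f) * sqrt (sqnorm I g)"
proof -
  have "cmod (ip I f g) \<le> (\<Sum>x\<in>I. \<bar>cmod (f x)\<bar> * \<bar>cmod (g x)\<bar>)"
    unfolding ip_def by (rule order.trans[OF norm_sum]) (simp add: norm_mult)
  also have "\<dots> \<le> L2_set (\<lambda>x. cmod (f x)) I * L2_set (\<lambda>x. cmod (g x)) I"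
    by (rule L2_set_mult_ineq)
  finally show ?thesis unfolding L2_set_def sqnorm_def .
qed

lemma ip_unitary:
  "unitary_ker I U \<Longrightarrow> k \<in> I \<Longrightarrow> l \<in> I \<Longrightarrow> ip I (\<lambda>x. U x k) (\<lambda>x. U x l) = of_bool (k = l)"
  unfolding unitary_ker_def ip_def by blast

lemma ip_unitary_lincomb:
  assumes "unitary_ker I U" "finite I" "J \<subseteq> I" "k \<in> I"
  shows "ip I (\<lambda>x. U x k) (\<lambda>x. \<Sum>j\<in>J. U x j * c j) = of_bool (k \<in> J) * c k"
proof -
  have "ip I (\<lambda>x. U x k) (\<lambda>x. \<Sum>j\<in>J. U x j * c j) = (\<Sum>j\<in>J. of_bool (k = j) * c j)"
    unfolding ip_lincomb using assms by (intro sum.cong refl) (auto simp: ip_unitary)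
  also have "\<dots> = of_bool (k \<in> J) * c k"
    using finite_subset[OF assms(3,2)] by (cases "k \<in> J") (auto intro!: sum.neutral)
  finally show ?thesis .
qed

lemma form_spectral:
  fixes e :: "'k \<Rightarrow> real"
  assumes "\<And>x y. x \<in> I \<Longrightarrow> y \<in> I \<Longrightarrow> Y x y = (\<Sum>k\<in>J. complex_of_real (e k) * U x k * cnj (U y k))"
  shows "form I Y f f = complex_of_real (\<Sum>k\<in>J. e k * (cmod (ip I (\<lambda>x. U x k) f))\<^sup>2)"
proof -
  have "form I Y f f = (\<Sum>x\<in>I. \<Sum>y\<in>I. \<Sum>k\<in>J. complex_of_real (e k) * (cnj (f x) * U x k * (cnj (U y k) * f y)))"
    unfolding form_def using assms
    by (intro sum.cong refl) (simp add: sum_distrib_left sum_distrib_right mult_ac)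
  also have "\<dots> = (\<Sum>k\<in>J. \<Sum>x\<in>I. \<Sum>y\<in>I. complex_of_real (e k) * (cnj (f x) * U x k * (cnj (U y k) * f y)))"
    by (rule sum_rotate3[symmetric])
  also have "\<dots> = (\<Sum>k\<in>J. complex_of_real (e k) * (ip I f (\<lambda>x. U x k) * ip I (\<lambda>x. U x k) f))"
    unfolding ip_def sum_product unfolding sum_distrib_left ..
  also have "\<dots> = complex_of_real (\<Sum>k\<in>J. e k * (cmod (ip I (\<lambda>x. U x k) f))\<^sup>2)"
    unfolding of_real_sum of_real_mult
    by (intro sum.cong refl) (metis complex_norm_square ip_cnj mult.commute)
  finally show ?thesis .
qed

text \<open>Completeness of the columns is a spectral decomposition of the identity with all weights
  1, so \<open>form_spectral\<close> applies.\<close>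

lemma parseval:
  assumes U: "unitary_ker I U" and fin: "finite I"
  shows "(\<Sum>k\<in>I. (cmod (ip I (\<lambda>x. U x k) f))\<^sup>2) = sqnorm I f"
proof -
  have "form I (\<lambda>x y. of_bool (x = y)) f f = complex_of_real (\<Sum>k\<in>I. 1 * (cmod (ip I (\<lambda>x. U x k) f))\<^sup>2)"
    using U unfolding unitary_ker_def by (intro form_spectral) simp
  moreover have "form I (\<lambda>x y. of_bool (x = y)) f f = complex_of_real (sqnorm I f)"
  proof -
    have "form I (\<lambda>x y. of_bool (x = y)) f f = (\<Sum>x\<in>I. \<Sum>y\<in>I. of_bool (x = y) * (cnj (f x) * f y))"
      unfolding form_def by (intro sum.cong refl) (simp only: mult_ac)
    also have "\<dots> = (\<Sum>x\<in>I. cnj (f x) * f x)"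
      using fin by (intro sum.cong refl sum_of_bool_eq) auto
    finally show ?thesis unfolding of_real_sqnorm .
  qed
  ultimately have "complex_of_real (\<Sum>k\<in>I. 1 * (cmod (ip I (\<lambda>x. U x k) f))\<^sup>2) = complex_of_real (sqnorm I f)"
    by simp
  then show ?thesis by (simp only: of_real_eq_iff mult_1)
qed

text \<open>The test \<open>T = \<Pi>\<^sub>2 \<Pi>\<^sub>1 \<Pi>\<^sub>2\<close>, where \<open>\<Pi>\<^sub>1\<close> projects onto the vectors \<open>u\<^sub>i\<close> with \<open>i \<in> G1\<close>
  and \<open>\<Pi>\<^sub>2\<close> onto the vectors \<open>w\<^sub>j\<close> with \<open>j \<in> G2\<close>.\<close>

locale projective_test =
  fixes I :: "'i set" and U W :: "'i \<Rightarrow> 'i \<Rightarrow> complex" and G1 G2 :: "'i set"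
  assumes fin: "finite I" and U: "unitary_ker I U" and W: "unitary_ker I W"
    and G1: "G1 \<subseteq> I" and G2: "G2 \<subseteq> I"
begin

definition C :: "'i \<Rightarrow> 'i \<Rightarrow> complex" where
  "C j i = ip I (\<lambda>x. W x j) (\<lambda>x. U x i)"

text \<open>The vector \<open>\<Pi>\<^sub>2 u\<^sub>i\<close>, expanded in the w basis. The test T
  is then the sum of the rank-one operators of these vectors over \<open>G1\<close>, so no operator
  products are needed.\<close>

definition Y :: "'i \<Rightarrow> 'i \<Rightarrow> complex" where
  "Y i x = (\<Sum>j\<in>G2. W x j * C j i)"

definition T :: "'i \<Rightarrow> 'i \<Rightarrow> complex" where
  "T x y = (\<Sum>i\<in>G1. Y i x * cnj (Y i y))"

lemma ktrace_T: "ktrace I T R = (\<Sum>i\<in>G1. form I R (Y i) (Y i))"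
proof -
  have "ktrace I T R = (\<Sum>x\<in>I. \<Sum>y\<in>I. \<Sum>i\<in>G1. cnj (Y i y) * R y x * Y i x)"
    unfolding ktrace_def T_def sum_distrib_right by (intro sum.cong refl) (simp only: mult_ac)
  also have "\<dots> = (\<Sum>i\<in>G1. \<Sum>x\<in>I. \<Sum>y\<in>I. cnj (Y i y) * R y x * Y i x)"
    by (rule sum_rotate3[symmetric])
  also have "\<dots> = (\<Sum>i\<in>G1. form I R (Y i) (Y i))"
    unfolding form_def by (rule sum.cong[OF refl], rule sum.swap)
  finally show ?thesis .
qed

lemma ktrace_T_nonneg:
  assumes "\<And>f. 0 \<le> Re (form I R f f)" shows "0 \<le> Re (ktrace I T R)"
  unfolding ktrace_T using assms by (simp add: sum_nonneg)

lemma ip_W_Y: "j \<in> I \<Longrightarrow> ip I (\<lambda>x. W x j) (Y i) = of_bool (j \<in> G2) * C j i"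
  unfolding Y_def by (rule ip_unitary_lincomb[OF W fin G2])

lemma ip_U_Y: "ip I (\<lambda>x. U x i) (Y i) = complex_of_real (\<Sum>j\<in>G2. (cmod (C j i))\<^sup>2)"
  unfolding Y_def ip_lincomb of_real_sum C_def
  by (intro sum.cong refl) (metis complex_norm_square ip_cnj mult.commute)

lemma C_norm: "i \<in> I \<Longrightarrow> (\<Sum>j\<in>I. (cmod (C j i))\<^sup>2) = 1"
  unfolding C_def parseval[OF W fin] by (rule unitary_ker_norm[OF U])

lemma C_norm_G2: "i \<in> I \<Longrightarrow> (\<Sum>j\<in>G2. (cmod (C j i))\<^sup>2) \<le> 1"
  using C_norm[of i] sum_mono2[OF fin G2, of "\<lambda>j. (cmod (C j i))\<^sup>2"] by simp

text \<open>Each \<open>Y i\<close> lies in the span of the w_j with j in \<open>G2\<close>, where R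
  has eigenvalues at most \<open>B\<close>, and its norm is at most 1. There are
  \<open>card G1\<close> such vectors.\<close>

lemma ktrace_T_upper:
  fixes q :: "'i \<Rightarrow> real" and B :: real
  assumes R: "\<And>x y. x \<in> I \<Longrightarrow> y \<in> I \<Longrightarrow> R x y = (\<Sum>k\<in>I. complex_of_real (q k) * W x k * cnj (W y k))"
    and q: "\<And>k. k \<in> G2 \<Longrightarrow> q k \<le> B" and B: "0 \<le> B"
  shows "Re (ktrace I T R) \<le> card G1 * B"
proof -
  have "Re (form I R (Y i) (Y i)) \<le> B" if i: "i \<in> G1" for i
  proof -
    have "Re (form I R (Y i) (Y i)) = (\<Sum>k\<in>I. q k * (cmod (ip I (\<lambda>x. W x k) (Y i)))\<^sup>2)"
      by (subst form_spectral[OF R]) auto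
    also have "\<dots> \<le> (\<Sum>k\<in>I. B * (cmod (C k i))\<^sup>2)"
      using q B by (intro sum_mono) (auto simp: ip_W_Y intro!: mult_right_mono)
    also have "\<dots> = B" using C_norm[of i] i G1 by (auto simp flip: sum_distrib_left)
    finally show ?thesis .
  qed
  then have "(\<Sum>i\<in>G1. Re (form I R (Y i) (Y i))) \<le> of_nat (card G1) * B"
    by (intro sum_bounded_above) auto
  then show ?thesis unfolding ktrace_T by simp
qed

text \<open>Gentle measurement, through \<open>x\<^sup>2 \<ge> 2 x - 1\<close> for \<open>x = \<langle>u\<^sub>i, \<Pi>\<^sub>2 u\<^sub>i\<rangle>\<close>.\<close>

lemma ktrace_T_lower:
  fixes p :: "'i \<Rightarrow> real"
  assumes R: "\<And>x y. x \<in> I \<Longrightarrow> y \<in> I \<Longrightarrow> R x y = (\<Sum>k\<in>I. complex_of_real (p k) * U x k * cnj (U y k))"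
    and p0: "\<And>k. k \<in> I \<Longrightarrow> 0 \<le> p k" and p1: "(\<Sum>k\<in>I. p k) = 1"
  shows "1 - 2 * (1 - (\<Sum>k\<in>G1. p k)) - 2 * (1 - (\<Sum>j\<in>G2. Re (form I R (\<lambda>x. W x j) (\<lambda>x. W x j))))
     \<le> Re (ktrace I T R)"
proof -
  define s where "s = (\<lambda>i. \<Sum>j\<in>G2. (cmod (C j i))\<^sup>2)"
  have s0: "0 \<le> s i" for i unfolding s_def by (simp add: sum_nonneg)
  have G1': "i \<in> I" if "i \<in> G1" for i using that G1 by auto
  have "p i * (2 * s i - 1) \<le> Re (form I R (Y i) (Y i))" if i: "i \<in> G1" for i
  proof -
    have "0 \<le> (s i - 1)\<^sup>2" by simp
    then have "2 * s i - 1 \<le> (s i)\<^sup>2" by (simp add: power2_diff)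
    then have "p i * (2 * s i - 1) \<le> p i * (s i)\<^sup>2" using p0 G1' i by (intro mult_left_mono) auto
    also have "\<dots> = p i * (cmod (ip I (\<lambda>x. U x i) (Y i)))\<^sup>2"
      by (simp only: ip_U_Y s_def norm_of_real power2_abs)
    also have "\<dots> \<le> (\<Sum>k\<in>I. p k * (cmod (ip I (\<lambda>x. U x k) (Y i)))\<^sup>2)"
      using G1'[OF i] p0 fin by (intro member_le_sum) auto
    also have "\<dots> = Re (form I R (Y i) (Y i))"
      by (subst form_spectral[OF R]) auto
    finally show ?thesis .
  qed
  then have 1: "(\<Sum>i\<in>G1. p i * (2 * s i - 1)) \<le> Re (ktrace I T R)"
    unfolding ktrace_T by (simp add: sum_mono)
  \<comment> \<open>As s i is at most 1, extending the sum from \<open>G1\<close> to all of I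
    changes it by at most the mass of p outside \<open>G1\<close>. The full sum is
    Tr(\<open>\<Pi>\<^sub>2\<close> R), computed afterwards in the w basis.\<close>
  have "(\<Sum>i\<in>I - G1. p i * s i) \<le> (\<Sum>i\<in>I - G1. p i)"
    using p0 C_norm_G2 by (intro sum_mono) (auto simp: s_def mult_left_le)
  also have "\<dots> = 1 - (\<Sum>i\<in>G1. p i)"
    using p1 sum_diff[OF fin G1, of p] by simp
  finally have 2: "(\<Sum>i\<in>I. p i * s i) - (1 - (\<Sum>i\<in>G1. p i)) \<le> (\<Sum>i\<in>G1. p i * s i)"
    using sum_diff[OF fin G1, of "\<lambda>i. p i * s i"] by simp
  have 3: "(\<Sum>i\<in>I. p i * s i) = (\<Sum>j\<in>G2. Re (form I R (\<lambda>x. W x j) (\<lambda>x. W x j)))"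
  proof -
    have "(\<Sum>i\<in>I. p i * s i) = (\<Sum>j\<in>G2. \<Sum>i\<in>I. p i * (cmod (C j i))\<^sup>2)"
      unfolding s_def sum_distrib_left by (rule sum.swap)
    also have "\<dots> = (\<Sum>j\<in>G2. Re (form I R (\<lambda>x. W x j) (\<lambda>x. W x j)))"
      by (subst form_spectral[OF R], assumption, assumption)
        (simp add: C_def ip_cnj[symmetric, of I "\<lambda>x. U x _"])
    finally show ?thesis .
  qed
  \<comment> \<open>With g the mass of \<open>G1\<close> and S that of \<open>\<Pi>\<^sub>2\<close>,
    the steps so far give 2 S + g - 2. Since g is at most 1, this is at least the claimed 2 S + 2 g
    - 3.\<close>
  have 4: "(\<Sum>i\<in>G1. p i) \<le> 1"
    using p1 p0 fin G1 by (metis DiffD1 sum_mono2)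
  have "(\<Sum>i\<in>G1. p i * (2 * s i - 1)) = 2 * (\<Sum>i\<in>G1. p i * s i) - (\<Sum>i\<in>G1. p i)"
    unfolding sum_distrib_left sum_subtractf[symmetric] by (intro sum.cong refl) (simp add: algebra_simps)
  then show ?thesis using 1 2 3 4 by argo
qed

text \<open>Since T g = \<open>\<Pi>\<^sub>2\<close> h, where h has squared norm A equal to the
  inner product of g with T g, the squared norm of T g is at most A. Expanding the squared norm of 2
  T g - g gives 4 |T g|^2 - 4 A + |g|^2, which is at most |g|^2. Cauchy-Schwarz concludes.\<close>

lemma contraction_T: "contraction I (\<lambda>x y. 2 * T x y - of_bool (x = y))"
  unfolding contraction_def
proof (intro allI)
  fix f g
  define a where "a = (\<lambda>i. ip I (Y i) g)"
  define Tg where "Tg = (\<lambda>x. \<Sum>i\<in>G1. Y i x * a i)"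
  define A where "A = (\<Sum>i\<in>G1. (cmod (a i))\<^sup>2)"
  have Tg: "(\<Sum>y\<in>I. T x y * g y) = Tg x" for x
    unfolding T_def Tg_def a_def ip_def sum_distrib_left sum_distrib_right
    by (subst sum.swap) (simp add: mult_ac)
  define h where "h = (\<lambda>x. \<Sum>i\<in>G1. U x i * a i)"
  have hA: "sqnorm I h = A"
  proof -
    have "sqnorm I h = (\<Sum>k\<in>I. (cmod (of_bool (k \<in> G1) * a k))\<^sup>2)"
      unfolding parseval[OF U fin, symmetric] h_def
      using ip_unitary_lincomb[OF U fin G1] by (intro sum.cong refl) simp
    also have "\<dots> = (\<Sum>k\<in>G1. (cmod (a k))\<^sup>2)"
      using fin G1 by (intro sum.mono_neutral_cong_right) auto
    finally show ?thesis unfolding A_def .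
  qed
  have TgA: "sqnorm I Tg \<le> A"
  proof -
    have "ip I (\<lambda>x. W x j) Tg = of_bool (j \<in> G2) * ip I (\<lambda>x. W x j) h" if j: "j \<in> I" for j
    proof -
      have "ip I (\<lambda>x. W x j) Tg = (\<Sum>i\<in>G1. of_bool (j \<in> G2) * C j i * a i)"
        unfolding Tg_def ip_lincomb using ip_W_Y[OF j] by simp
      then show ?thesis
        unfolding h_def ip_lincomb C_def by (simp add: sum_distrib_left mult.assoc)
    qed
    then have "sqnorm I Tg = (\<Sum>j\<in>I. (cmod (of_bool (j \<in> G2) * ip I (\<lambda>x. W x j) h))\<^sup>2)"
      unfolding parseval[OF W fin, symmetric] by (intro sum.cong refl) simp
    also have "\<dots> \<le> (\<Sum>j\<in>I. (cmod (ip I (\<lambda>x. W x j) h))\<^sup>2)"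
      by (intro sum_mono) auto
    finally show ?thesis unfolding parseval[OF W fin] hA .
  qed
  have gTg: "ip I g Tg = complex_of_real A"
    unfolding Tg_def ip_lincomb A_def of_real_sum a_def
    by (intro sum.cong refl) (metis complex_norm_square ip_cnj mult.commute)
  have "sqnorm I (\<lambda>x. 2 * Tg x - g x) = 4 * sqnorm I Tg - 4 * Re (ip I g Tg) + sqnorm I g"
  proof -
    have "(cmod (2 * u - v))\<^sup>2 = 4 * (cmod u)\<^sup>2 - 4 * Re (cnj v * u) + (cmod v)\<^sup>2" for u v
      unfolding cmod_power2 by (simp add: power2_eq_square algebra_simps)
    then show ?thesis
      unfolding sqnorm_def ip_def by (simp add: sum.distrib sum_subtractf sum_distrib_left)
  qed
  then have K: "sqnorm I (\<lambda>x. 2 * Tg x - g x) \<le> sqnorm I g" using TgA gTg by simp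
  have "form I (\<lambda>x y. 2 * T x y - of_bool (x = y)) f g = ip I f (\<lambda>x. 2 * Tg x - g x)"
    unfolding form_def ip_def
  proof (intro sum.cong refl)
    fix x assume x: "x \<in> I"
    have "(\<Sum>y\<in>I. cnj (f x) * (2 * T x y - of_bool (x = y)) * g y)
      = cnj (f x) * (2 * (\<Sum>y\<in>I. T x y * g y) - (\<Sum>y\<in>I. of_bool (x = y) * g y))"
      unfolding sum_distrib_left sum_subtractf[symmetric] by (intro sum.cong refl) (simp add: algebra_simps)
    then show "(\<Sum>y\<in>I. cnj (f x) * (2 * T x y - of_bool (x = y)) * g y) = cnj (f x) * (2 * Tg x - g x)"
      using fin x unfolding Tg by simp
  qed
  then have "cmod (form I (\<lambda>x y. 2 * T x y - of_bool (x = y)) f g)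
     \<le> sqrt (sqnorm I f) * sqrt (sqnorm I (\<lambda>x. 2 * Tg x - g x))"
    using ip_cauchy_schwarz by metis
  also have "\<dots> \<le> sqrt (sqnorm I f) * sqrt (sqnorm I g)"
    using K by (intro mult_left_mono) auto
  finally show "cmod (form I (\<lambda>x y. 2 * T x y - of_bool (x = y)) f g) \<le> sqrt (sqnorm I f) * sqrt (sqnorm I g)" .
qed

text \<open>On a difference of two operators of equal trace the subtracted term cancels, so 2 T - 1
  yields twice the difference of acceptance probabilities.\<close>

lemma ktrace_contraction:
  "ktrace I (\<lambda>x y. 2 * T x y - of_bool (x = y)) R = 2 * ktrace I T R - (\<Sum>x\<in>I. R x x)"
proof -
  have "ktrace I (\<lambda>x y. 2 * T x y - of_bool (x = y)) R
     = 2 * ktrace I T R - (\<Sum>x\<in>I. \<Sum>y\<in>I. of_bool (x = y) * R y x)"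
    unfolding ktrace_def sum_distrib_left sum_subtractf[symmetric]
    by (intro sum.cong refl) (simp add: algebra_simps)
  then show ?thesis using fin by simp
qed

end

section \<open>Testing the smoothed channel\<close>

lemma sum_multi_prod2:
  fixes f :: "nat \<Rightarrow> nat \<Rightarrow> nat \<Rightarrow> complex"
  shows "(\<Sum>z\<in>multi n d. \<Sum>z'\<in>multi n e. \<Prod>t<n. f t (z t) (z' t)) = (\<Prod>t<n. \<Sum>i<d. \<Sum>j<e. f t i j)"
  unfolding sum_multi_prod[where f = "\<lambda>t i. \<Sum>j<e. f t i j", symmetric]
  by (rule sum.cong[OF refl]) (rule sum_multi_prod)

lemma form_kpow:
  "form (multi n d) (kpow n R) (\<lambda>z. kpow n W z j) (\<lambda>z. kpow n W z j)
    = (\<Prod>t<n. form {..<d} R (\<lambda>x. W x (j t)) (\<lambda>x. W x (j t)))"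
proof -
  have "form (multi n d) (kpow n R) (\<lambda>z. kpow n W z j) (\<lambda>z. kpow n W z j)
    = (\<Sum>z\<in>multi n d. \<Sum>z'\<in>multi n d. \<Prod>t<n. cnj (W (z t) (j t)) * R (z t) (z' t) * W (z' t) (j t))"
    unfolding form_def kpow_def by (simp add: prod.distrib)
  also have "\<dots> = (\<Prod>t<n. form {..<d} R (\<lambda>x. W x (j t)) (\<lambda>x. W x (j t)))"
    unfolding form_def by (rule sum_multi_prod2)
  finally show ?thesis .
qed

lemma channel_carrier:
  "channel a b N \<Longrightarrow> N (munit a i j) \<in> carrier_mat b b"
  unfolding channel_def comp_pos_def lin_map_def using munit_carrier by auto

lemma ampl_trace:
  assumes N: "channel a b N"
  shows "(\<Sum>p\<in>{..<b} \<times> {..<c}. ampl a N X p p) = (\<Sum>p\<in>{..<a} \<times> {..<c}. X p p)"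
proof -
  have tr: "(\<Sum>r<b. N (munit a i j) $$ (r, r)) = of_bool (i = j)" if "i < a" "j < a" for i j
  proof -
    have "(\<Sum>r<b. N (munit a i j) $$ (r, r)) = mtrace (N (munit a i j))"
      using channel_carrier[OF N, of i j] unfolding mtrace_def by auto
    also have "\<dots> = mtrace (munit a i j)" using N munit_carrier unfolding channel_def by auto
    also have "\<dots> = (\<Sum>x<a. of_bool (x = i) * of_bool (x = j))"
      unfolding mtrace_def munit_def by (auto intro!: sum.cong simp del: sum_of_bool_eq sum_mult_of_bool_eq sum_of_bool_mult_eq)
    also have "\<dots> = of_bool (i = j)" using that by (subst sum_of_bool_eq) auto
    finally show ?thesis .
  qed
  have "(\<Sum>p\<in>{..<b} \<times> {..<c}. ampl a N X p p)
    = (\<Sum>r<b. \<Sum>k<c. \<Sum>i<a. \<Sum>j<a. N (munit a i j) $$ (r, r) * X (i, k) (j, k))"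
    unfolding sum.cartesian_product' ampl_def by simp
  also have "\<dots> = (\<Sum>k<c. \<Sum>i<a. \<Sum>j<a. \<Sum>r<b. N (munit a i j) $$ (r, r) * X (i, k) (j, k))"
    by (rule sum_rotate4)
  also have "\<dots> = (\<Sum>k<c. \<Sum>i<a. \<Sum>j<a. of_bool (i = j) * X (i, k) (j, k))"
    unfolding sum_distrib_right[symmetric] using tr by (intro sum.cong refl) auto
  also have "\<dots> = (\<Sum>k<c. \<Sum>i<a. X (i, k) (i, k))" by (intro sum.cong refl sum_of_bool_eq) auto
  also have "\<dots> = (\<Sum>p\<in>{..<a} \<times> {..<c}. X p p)"
    unfolding sum.cartesian_product' by (rule sum.swap)
  finally show ?thesis .
qed

lemma tensor_map_id_trace:
  assumes N: "channel a b N"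
  shows "(\<Sum>x<b * c. tensor_map a b c c N (\<lambda>X. X) R $$ (x, x)) = (\<Sum>x<a * c. R $$ (x, x))"
proof -
  have "(\<Sum>x<b * c. tensor_map a b c c N (\<lambda>X. X) R $$ (x, x))
    = (\<Sum>p\<in>{..<b} \<times> {..<c}. tensor_map a b c c N (\<lambda>X. X) R $$ (idx c p, idx c p))"
    by (rule sum.reindex_bij_betw[OF bij_betw_idx, symmetric])
  also have "\<dots> = (\<Sum>p\<in>{..<b} \<times> {..<c}. ampl a N (\<lambda>p q. R $$ (idx c p, idx c q)) p p)"
    by (intro sum.cong refl tensor_map_id_index channel_carrier[OF N])
  also have "\<dots> = (\<Sum>p\<in>{..<a} \<times> {..<c}. R $$ (idx c p, idx c p))" by (rule ampl_trace[OF N])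
  also have "\<dots> = (\<Sum>x<a * c. R $$ (x, x))" by (rule sum.reindex_bij_betw[OF bij_betw_idx])
  finally show ?thesis .
qed

text \<open>Carries positivity of the amplified output from matrix indices to an index set
  \<open>Z\<close> of one's choice, later the tuples, by pulling the test vector back along the
  inverse bijection.\<close>

lemma comp_pos_form:
  assumes cp: "comp_pos a b \<Theta>" and R: "psd (a * c) R"
    and h: "bij_betw h Z ({..<b} \<times> {..<c})"
  shows "0 \<le> Re (form Z (\<lambda>z z'. ampl a \<Theta> (\<lambda>p q. R $$ (idx c p, idx c q)) (h z) (h z')) f f)"
proof -
  let ?S = "tensor_map a b c c \<Theta> (\<lambda>X. X) R"
  have k: "bij_betw (\<lambda>z. idx c (h z)) Z {..<b * c}"
    using bij_betw_trans[OF h bij_betw_idx] by (simp add: comp_def)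
  define g where "g = (\<lambda>x. f (inv_into Z (\<lambda>z. idx c (h z)) x))"
  have g: "g (idx c (h z)) = f z" if "z \<in> Z" for z
    unfolding g_def using bij_betw_inv_into_left[OF k that] by simp
  have \<Theta>: "\<Theta> (munit a i j) \<in> carrier_mat b b" for i j
    using cp munit_carrier unfolding comp_pos_def lin_map_def by auto
  have "form {..<b * c} (\<lambda>x y. ?S $$ (x, y)) g g
    = form Z (\<lambda>z z'. ampl a \<Theta> (\<lambda>p q. R $$ (idx c p, idx c q)) (h z) (h z')) f f"
    unfolding form_reindex[OF k] unfolding form_def
  proof (intro sum.cong refl)
    fix z z' assume z: "z \<in> Z" "z' \<in> Z"
    then have hz: "h z \<in> {..<b} \<times> {..<c}" "h z' \<in> {..<b} \<times> {..<c}" using bij_betwE[OF h] by auto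
    have "?S $$ (idx c (h z), idx c (h z')) = ampl a \<Theta> (\<lambda>p q. R $$ (idx c p, idx c q)) (h z) (h z')"
      by (rule tensor_map_id_index[OF _ hz]) (rule \<Theta>)
    then show "cnj (g (idx c (h z))) * ?S $$ (idx c (h z), idx c (h z')) * g (idx c (h z'))
      = cnj (f z) * ampl a \<Theta> (\<lambda>p q. R $$ (idx c p, idx c q)) (h z) (h z') * f z'"
      using g z by simp
  qed
  moreover have "psd (b * c) ?S" using cp R unfolding comp_pos_def by blast
  ultimately show ?thesis using psd_form(2)[of "b * c" ?S g] unfolding form_def by simp
qed

lemma ampl_diff:
  assumes "\<And>i j. \<Phi> (munit a i j) \<in> carrier_mat b b" "\<And>i j. \<Psi> (munit a i j) \<in> carrier_mat b b"
    and "p \<in> {..<b} \<times> {..<c}" "q \<in> {..<b} \<times> {..<c}"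
  shows "ampl a (\<lambda>X. t \<cdot>\<^sub>m \<Phi> X - \<Psi> X) X p q = t * ampl a \<Phi> X p q - ampl a \<Psi> X p q"
proof -
  have "(t \<cdot>\<^sub>m \<Phi> (munit a i j) - \<Psi> (munit a i j)) $$ (fst p, fst q)
      = t * \<Phi> (munit a i j) $$ (fst p, fst q) - \<Psi> (munit a i j) $$ (fst p, fst q)" for i j
  proof -
    have d: "fst p < b" "fst q < b" using assms(3,4) by auto
    show ?thesis using assms(1)[of i j] assms(2)[of i j] d by auto
  qed
  then show ?thesis
    unfolding ampl_def sum_distrib_left sum_subtractf[symmetric]
    by (intro sum.cong refl) (simp only: left_diff_distrib mult.assoc)
qed

lemma psd_shuffled_pow:
  assumes "density (a * c) \<rho>" shows "psd (a ^ n * c ^ n) (shuffled_pow a c n \<rho>)"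
proof -
  obtain V :: "nat \<Rightarrow> (nat \<Rightarrow> nat) \<Rightarrow> complex" and F where
    V[rule_format]: "\<forall>x<a ^ n * c ^ n. \<forall>y<a ^ n * c ^ n. shuffled_pow a c n \<rho> $$ (x, y) = (\<Sum>m\<in>F. V x m * cnj (V y m))"
    and "(\<Sum>x<a ^ n * c ^ n. shuffled_pow a c n \<rho> $$ (x, x)) = 1"
    using density_shuffled_pow[OF assms] .
  show ?thesis using V by (intro psd_gramI[OF shuffled_pow_carrier])
qed

lemma shuffled_pow_trace:
  assumes "density (a * c) \<rho>"
  shows "(\<Sum>p\<in>{..<a ^ n} \<times> {..<c ^ n}. shuffled_pow a c n \<rho> $$ (idx (c ^ n) p, idx (c ^ n) p)) = 1"
proof -
  have "(\<Sum>x<a ^ n * c ^ n. shuffled_pow a c n \<rho> $$ (x, x)) = 1"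
    using density_shuffled_pow[OF assms] by metis
  then show ?thesis
    by (subst sum.reindex_bij_betw[OF bij_betw_idx, of "\<lambda>x. shuffled_pow a c n \<rho> $$ (x, x)"])
qed

lemma ktrace_diff: "ktrace I K (\<lambda>x y. A x y - B x y) = ktrace I K A - ktrace I K B"
  unfolding ktrace_def by (simp add: algebra_simps sum_subtractf)

text \<open>Feeds the regrouped power of \<rho>, with reference C...C, into N' minus the power of N.
  By \<open>ampl_tpow\<close> the second output is, in tuple indices, the plain power of the
  single-copy output, so the test may be designed on tuples.\<close>

lemma diamond_kpow:
  assumes N: "channel a b N" and \<rho>: "density (a * c) \<rho>" and N': "channel (a ^ n) (b ^ n) N'"
    and K: "contraction (multi n (b * c)) K"
  shows "cmod (ktrace (multi n (b * c)) K (\<lambda>z z'.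
      ampl (a ^ n) N' (\<lambda>p q. shuffled_pow a c n \<rho> $$ (idx (c ^ n) p, idx (c ^ n) q)) (pidx b c n z) (pidx b c n z')
      - kpow n (\<lambda>x y. tensor_map a b c c N (\<lambda>X. X) \<rho> $$ (x, y)) z z'))
    \<le> diamond (a ^ n) (b ^ n) (\<lambda>X. N' X - tpow a b N n X)"
proof -
  let ?Z = "multi n (b * c)" and ?P = "{..<b ^ n} \<times> {..<c ^ n}" and ?h = "pidx b c n"
  let ?X = "\<lambda>p q. shuffled_pow a c n \<rho> $$ (idx (c ^ n) p, idx (c ^ n) q)"
  let ?\<Phi> = "\<lambda>X. N' X - tpow a b N n X"
  note h = bij_betw_pidx[of b c n]
  define K' where "K' = (\<lambda>p q. K (inv_into ?Z ?h p) (inv_into ?Z ?h q))"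
  have K'h: "K' (?h z) (?h z') = K z z'" if "z \<in> ?Z" "z' \<in> ?Z" for z z'
    unfolding K'_def using bij_betw_inv_into_left[OF h] that by simp
  have K': "contraction ?P K'" by (rule contraction_reindex[OF h K]) (rule K'h)
  have cN: "tpow a b N n (munit (a ^ n) i j) \<in> carrier_mat (b ^ n) (b ^ n)" for i j
    by (intro tpow_carrier munit_carrier)
  note cN' = channel_carrier[OF N']
  obtain V :: "nat \<Rightarrow> (nat \<Rightarrow> nat) \<Rightarrow> complex" and F where
    V[rule_format]: "\<forall>x<a ^ n * c ^ n. \<forall>y<a ^ n * c ^ n. shuffled_pow a c n \<rho> $$ (x, y) = (\<Sum>m\<in>F. V x m * cnj (V y m))"
    and "(\<Sum>x<a ^ n * c ^ n. shuffled_pow a c n \<rho> $$ (x, x)) = 1"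
    using density_shuffled_pow[OF \<rho>] .
  have "cmod (ktrace ?P K' (ampl (a ^ n) ?\<Phi> ?X)) \<le> diamond (a ^ n) (b ^ n) ?\<Phi>"
  proof (rule ktrace_le_diamond[OF _ K', where V = "\<lambda>p. V (idx (c ^ n) p)" and F = F])
    show "N' (munit (a ^ n) i j) - tpow a b N n (munit (a ^ n) i j) \<in> carrier_mat (b ^ n) (b ^ n)" for i j
      using cN' cN by (metis minus_carrier_mat)
    show "?X p q = (\<Sum>m\<in>F. V (idx (c ^ n) p) m * cnj (V (idx (c ^ n) q) m))"
      if "p \<in> {..<a ^ n} \<times> {..<c ^ n}" "q \<in> {..<a ^ n} \<times> {..<c ^ n}" for p q
      using V[OF idx_less[OF that(1)] idx_less[OF that(2)]] .
    show "(\<Sum>p\<in>{..<a ^ n} \<times> {..<c ^ n}. ?X p p) = 1" by (rule shuffled_pow_trace[OF \<rho>])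
  qed
  also have "ktrace ?P K' (ampl (a ^ n) ?\<Phi> ?X) = ktrace ?Z K (\<lambda>z z'. ampl (a ^ n) N' ?X (?h z) (?h z')
      - kpow n (\<lambda>x y. tensor_map a b c c N (\<lambda>X. X) \<rho> $$ (x, y)) z z')"
    unfolding ktrace_reindex[OF h]
  proof (rule ktrace_cong)
    fix z z' assume z: "z \<in> ?Z" "z' \<in> ?Z"
    show "K' (?h z) (?h z') = K z z'" by (rule K'h[OF z])
    have hz: "?h z \<in> ?P" "?h z' \<in> ?P" using bij_betwE[OF h] z by auto
    have ent: "(N' (munit (a ^ n) i j) - tpow a b N n (munit (a ^ n) i j)) $$ (fst (?h z), fst (?h z'))
       = N' (munit (a ^ n) i j) $$ (fst (?h z), fst (?h z')) - tpow a b N n (munit (a ^ n) i j) $$ (fst (?h z), fst (?h z'))"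
      for i j
    proof -
      have "fst (?h z) < b ^ n" "fst (?h z') < b ^ n" using hz by (metis lessThan_iff mem_Times_iff)+
      then show ?thesis using cN'[of i j] cN[of i j] by auto
    qed
    have "ampl (a ^ n) ?\<Phi> ?X (?h z) (?h z') = ampl (a ^ n) N' ?X (?h z) (?h z') - ampl (a ^ n) (tpow a b N n) ?X (?h z) (?h z')"
      unfolding ampl_def sum_subtractf[symmetric] ent by (intro sum.cong refl) (simp add: algebra_simps)
    also have "ampl (a ^ n) (tpow a b N n) ?X (?h z) (?h z') = kpow n (\<lambda>x y. tensor_map a b c c N (\<lambda>X. X) \<rho> $$ (x, y)) z z'"
      by (rule ampl_tpow[OF _ z]) (rule channel_carrier[OF N])
    finally show "ampl (a ^ n) ?\<Phi> ?X (?h z) (?h z') = ampl (a ^ n) N' ?X (?h z) (?h z')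
       - kpow n (\<lambda>x y. tensor_map a b c c N (\<lambda>X. X) \<rho> $$ (x, y)) z z'" .
  qed
  finally show ?thesis .
qed

text \<open>Let \<tau> be the output of N' on the regrouped state. Gentle measurement and closeness
  give acceptance of \<tau> at least 1 - 4 \<eta> - \<epsilon>, the two error masses counting twice
  each. Complete positivity of t M - N' bounds it above by t times the weight for the power of
  \<open>s\<close>.\<close>

lemma hypothesis_test_bound:
  fixes p q P :: "nat \<Rightarrow> real" and t \<epsilon> \<eta> B :: real
  assumes N: "channel a b N" and M: "channel a b M" and \<rho>: "density (a * c) \<rho>"
    and N': "channel (a ^ n) (b ^ n) N'"
    and dia: "diamond (a ^ n) (b ^ n) (\<lambda>X. N' X - tpow a b N n X) / 2 \<le> \<epsilon>"
    and cp: "comp_pos (a ^ n) (b ^ n) (\<lambda>X. complex_of_real t \<cdot>\<^sub>m tpow a b M n X - N' X)"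
    and U: "unitary_ker {..<b * c} U" and W: "unitary_ker {..<b * c} W"
    and r: "\<And>x y. x < b * c \<Longrightarrow> y < b * c \<Longrightarrow> tensor_map a b c c N (\<lambda>X. X) \<rho> $$ (x, y)
       = (\<Sum>m<b * c. complex_of_real (p m) * U x m * cnj (U y m))"
    and s: "\<And>x y. x < b * c \<Longrightarrow> y < b * c \<Longrightarrow> tensor_map a b c c M (\<lambda>X. X) \<rho> $$ (x, y)
       = (\<Sum>m<b * c. complex_of_real (q m) * W x m * cnj (W y m))"
    and p: "\<And>m. m < b * c \<Longrightarrow> 0 \<le> p m"
    and P: "\<And>j. j < b * c \<Longrightarrow> form {..<b * c} (\<lambda>x y. tensor_map a b c c N (\<lambda>X. X) \<rho> $$ (x, y)) (\<lambda>x. W x j) (\<lambda>x. W x j)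
       = complex_of_real (P j)"
    and G: "G1 \<subseteq> multi n (b * c)" "G2 \<subseteq> multi n (b * c)"
    and B: "\<And>z. z \<in> G2 \<Longrightarrow> (\<Prod>i<n. q (z i)) \<le> B" "0 \<le> B"
    and q: "\<And>m. m < b * c \<Longrightarrow> 0 \<le> q m"
    and \<eta>1: "1 - (\<Sum>z\<in>G1. \<Prod>i<n. p (z i)) \<le> \<eta>" and \<eta>2: "1 - (\<Sum>z\<in>G2. \<Prod>i<n. P (z i)) \<le> \<eta>"
    and pos: "0 < 1 - 4 * \<eta> - \<epsilon>"
  shows "1 - 4 * \<eta> - \<epsilon> \<le> t * (card G1 * B)"
proof -
  let ?d = "b * c" and ?Z = "multi n (b * c)" and ?h = "pidx b c n"
  let ?r = "\<lambda>x y. tensor_map a b c c N (\<lambda>X. X) \<rho> $$ (x, y)"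
  let ?s = "\<lambda>x y. tensor_map a b c c M (\<lambda>X. X) \<rho> $$ (x, y)"
  let ?X = "\<lambda>p q. shuffled_pow a c n \<rho> $$ (idx (c ^ n) p, idx (c ^ n) q)"
  define \<tau> where "\<tau> = (\<lambda>z z'. ampl (a ^ n) N' ?X (?h z) (?h z'))"
  note h = bij_betw_pidx[of b c n]
  have trr: "(\<Sum>x<?d. ?r x x) = 1"
    using tensor_map_id_trace[OF N] \<rho> psd_carrier[of "a * c" \<rho>] unfolding density_def mtrace_def by auto
  have p1: "(\<Sum>m<?d. p m) = 1"
  proof -
    have "complex_of_real (\<Sum>m<?d. p m) = (\<Sum>x<?d. ?r x x)"
      using r by (subst unitary_ker_trace[OF U, where d = "\<lambda>m. complex_of_real (p m)"]) auto
    then show ?thesis unfolding trr by (simp only: of_real_eq_1_iff)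
  qed
  have rn: "kpow n ?r z z' = (\<Sum>m\<in>?Z. complex_of_real (\<Prod>i<n. p (m i)) * kpow n U z m * cnj (kpow n U z' m))"
    if "z \<in> ?Z" "z' \<in> ?Z" for z z'
    unfolding of_real_prod using r multiD[OF that(1)] multiD[OF that(2)]
    by (intro kpow_spectral[where d = ?d]) auto
  have sn: "kpow n ?s z z' = (\<Sum>m\<in>?Z. complex_of_real (\<Prod>i<n. q (m i)) * kpow n W z m * cnj (kpow n W z' m))"
    if "z \<in> ?Z" "z' \<in> ?Z" for z z'
    unfolding of_real_prod using s multiD[OF that(1)] multiD[OF that(2)]
    by (intro kpow_spectral[where d = ?d]) auto
  have PP: "Re (form ?Z (kpow n ?r) (\<lambda>x. kpow n W x j) (\<lambda>x. kpow n W x j)) = (\<Prod>i<n. P (j i))"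
    if j: "j \<in> G2" for j
  proof -
    have "j \<in> ?Z" using j G by auto
    then have "(\<Prod>i<n. form {..<?d} ?r (\<lambda>x. W x (j i)) (\<lambda>x. W x (j i))) = (\<Prod>i<n. complex_of_real (P (j i)))"
      using P multiD by (intro prod.cong refl) auto
    then show ?thesis unfolding form_kpow by (simp flip: of_real_prod)
  qed
  interpret projective_test ?Z "kpow n U" "kpow n W" G1 G2
    using unitary_ker_kpow[OF U] unitary_ker_kpow[OF W] G by unfold_locales auto
  have "1 - 2 * (1 - (\<Sum>k\<in>G1. \<Prod>i<n. p (k i)))
      - 2 * (1 - (\<Sum>j\<in>G2. Re (form ?Z (kpow n ?r) (\<lambda>x. kpow n W x j) (\<lambda>x. kpow n W x j))))
      \<le> Re (ktrace ?Z T (kpow n ?r))"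
  proof (rule ktrace_T_lower[OF rn])
    show "0 \<le> (\<Prod>i<n. p (k i))" if "k \<in> ?Z" for k using p multiD[OF that] by (intro prod_nonneg) auto
    show "(\<Sum>k\<in>?Z. \<Prod>i<n. p (k i)) = 1"
      using p1 sum_multi_prod[where f = "\<lambda>t. p"] by simp
  qed
  then have low: "1 - 4 * \<eta> \<le> Re (ktrace ?Z T (kpow n ?r))" using \<eta>1 \<eta>2 PP by simp
  have up: "Re (ktrace ?Z T (kpow n ?s)) \<le> card G1 * B"
    by (rule ktrace_T_upper[OF sn]) (use B in auto)
  have s0: "0 \<le> Re (ktrace ?Z T (kpow n ?s))"
  proof (rule ktrace_T_nonneg)
    fix f
    have "form ?Z (kpow n ?s) f f
        = complex_of_real (\<Sum>m\<in>?Z. (\<Prod>i<n. q (m i)) * (cmod (ip ?Z (\<lambda>x. kpow n W x m) f))\<^sup>2)"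
      by (rule form_spectral[OF sn])
    also have "Re \<dots> \<ge> 0"
      unfolding Re_complex_of_real using q
      by (auto intro!: sum_nonneg mult_nonneg_nonneg prod_nonneg simp: multiD)
    finally show "0 \<le> Re (form ?Z (kpow n ?s) f f)" .
  qed
  have \<tau>tr: "(\<Sum>z\<in>?Z. \<tau> z z) = 1"
    unfolding \<tau>_def sum.reindex_bij_betw[OF h, of "\<lambda>p. ampl (a ^ n) N' ?X p p"]
      ampl_trace[OF N'] by (rule shuffled_pow_trace[OF \<rho>])
  have rtr: "(\<Sum>z\<in>?Z. kpow n ?r z z) = 1" unfolding kpow_trace trr by simp
  \<comment> \<open>The hypothesis bounds half the diamond norm, hence the 2 \<epsilon>. It cancels
    against the factor 2 of the contraction, because \<tau> and the power of \<open>r\<close> both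
    have trace 1.\<close>
  have "cmod (ktrace ?Z (\<lambda>x y. 2 * T x y - of_bool (x = y)) (\<lambda>z z'. \<tau> z z' - kpow n ?r z z')) \<le> 2 * \<epsilon>"
    using diamond_kpow[OF N \<rho> N' contraction_T] dia unfolding \<tau>_def by simp
  then have "cmod (2 * (ktrace ?Z T \<tau> - ktrace ?Z T (kpow n ?r))) \<le> 2 * \<epsilon>"
    unfolding ktrace_diff ktrace_contraction \<tau>tr rtr by (simp add: algebra_simps)
  then have "cmod (ktrace ?Z T \<tau> - ktrace ?Z T (kpow n ?r)) \<le> \<epsilon>"
    unfolding norm_mult by simp
  then have close: "Re (ktrace ?Z T (kpow n ?r)) - \<epsilon> \<le> Re (ktrace ?Z T \<tau>)"
    using abs_Re_le_cmod[of "ktrace ?Z T \<tau> - ktrace ?Z T (kpow n ?r)"] by simp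
  have "Re (ktrace ?Z T \<tau>) \<le> t * Re (ktrace ?Z T (kpow n ?s))"
  proof -
    have "ampl (a ^ n) (\<lambda>X. complex_of_real t \<cdot>\<^sub>m tpow a b M n X - N' X) ?X (?h z) (?h z')
        = t * kpow n ?s z z' - \<tau> z z'" if z: "z \<in> ?Z" "z' \<in> ?Z" for z z'
    proof -
      have hz: "?h z \<in> {..<b ^ n} \<times> {..<c ^ n}" "?h z' \<in> {..<b ^ n} \<times> {..<c ^ n}"
        using bij_betwE[OF h] z by auto
      have "ampl (a ^ n) (\<lambda>X. complex_of_real t \<cdot>\<^sub>m tpow a b M n X - N' X) ?X (?h z) (?h z')
        = t * ampl (a ^ n) (tpow a b M n) ?X (?h z) (?h z') - ampl (a ^ n) N' ?X (?h z) (?h z')"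
        by (rule ampl_diff[OF _ _ hz]) (intro tpow_carrier munit_carrier channel_carrier[OF N'])+
      moreover have "ampl (a ^ n) (tpow a b M n) ?X (?h z) (?h z') = kpow n ?s z z'"
        by (rule ampl_tpow[OF _ z]) (rule channel_carrier[OF M])
      ultimately show ?thesis unfolding \<tau>_def by simp
    qed
    then have "form ?Z (\<lambda>z z'. t * kpow n ?s z z' - \<tau> z z') f f
       = form ?Z (\<lambda>z z'. ampl (a ^ n) (\<lambda>X. complex_of_real t \<cdot>\<^sub>m tpow a b M n X - N' X) ?X (?h z) (?h z')) f f" for f
      by (intro form_cong) simp
    then have "0 \<le> Re (ktrace ?Z T (\<lambda>z z'. t * kpow n ?s z z' - \<tau> z z'))"
      using comp_pos_form[OF cp psd_shuffled_pow[OF \<rho>] h] by (intro ktrace_T_nonneg) simp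
    moreover have "ktrace ?Z T (\<lambda>z z'. t * kpow n ?s z z') = t * ktrace ?Z T (kpow n ?s)"
      unfolding ktrace_def by (simp add: sum_distrib_left mult_ac)
    ultimately show ?thesis unfolding ktrace_diff by simp
  qed
  then have ts: "1 - 4 * \<eta> - \<epsilon> \<le> t * Re (ktrace ?Z T (kpow n ?s))" using low close by linarith
  \<comment> \<open>Nothing is assumed on the sign of t. It must be positive since its product with
    a nonnegative weight is positive, and only then may the weight be replaced by its upper
    bound.\<close>
  then have "0 < t" using pos s0 by (smt (verit) mult_nonneg_nonneg mult_le_0_iff)
  then show ?thesis using ts up by (smt (verit) mult_left_mono)
qed

section \<open>Regularised lower bound\<close>

lemma ip_resolution:
  assumes W: "unitary_ker I W" and fin: "finite I"
  shows "ip I f v = (\<Sum>j\<in>I. ip I f (\<lambda>x. W x j) * ip I (\<lambda>x. W x j) v)"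
proof -
  have "(\<Sum>j\<in>I. ip I f (\<lambda>x. W x j) * ip I (\<lambda>x. W x j) v)
    = (\<Sum>j\<in>I. \<Sum>x\<in>I. \<Sum>y\<in>I. cnj (f x) * v y * (W x j * cnj (W y j)))"
    unfolding ip_def sum_product by (intro sum.cong refl) (simp only: mult_ac)
  also have "\<dots> = (\<Sum>x\<in>I. \<Sum>y\<in>I. cnj (f x) * v y * (\<Sum>j\<in>I. W x j * cnj (W y j)))"
    unfolding sum_distrib_left by (rule sum_rotate3)
  also have "\<dots> = (\<Sum>x\<in>I. \<Sum>y\<in>I. of_bool (x = y) * (cnj (f x) * v y))"
    using W unfolding unitary_ker_def by (intro sum.cong refl) (simp add: mult.commute)
  also have "\<dots> = ip I f v" unfolding ip_def using fin by (intro sum.cong refl sum_of_bool_eq) auto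
  finally show ?thesis ..
qed

lemma ktrace_spectral:
  assumes "\<And>x y. x \<in> I \<Longrightarrow> y \<in> I \<Longrightarrow> L x y = (\<Sum>k\<in>J. l k * W x k * cnj (W y k))"
  shows "ktrace I R L = (\<Sum>k\<in>J. l k * form I R (\<lambda>x. W x k) (\<lambda>x. W x k))"
proof -
  have "ktrace I R L = (\<Sum>x\<in>I. \<Sum>y\<in>I. \<Sum>k\<in>J. l k * (cnj (W x k) * R x y * W y k))"
    unfolding ktrace_def using assms
    by (intro sum.cong refl) (simp add: sum_distrib_left mult_ac)
  also have "\<dots> = (\<Sum>k\<in>J. \<Sum>x\<in>I. \<Sum>y\<in>I. l k * (cnj (W x k) * R x y * W y k))"
    by (rule sum_rotate3[symmetric])
  finally show ?thesis unfolding form_def sum_distrib_left .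
qed

lemma mtrace_mult:
  assumes "A \<in> carrier_mat n n" "B \<in> carrier_mat n n"
  shows "mtrace (A * B) = ktrace {..<n} (\<lambda>x y. A $$ (x, y)) (\<lambda>x y. B $$ (x, y))"
  using assms unfolding mtrace_def ktrace_def
  by (auto intro!: sum.cong simp: mult_mat_index_sum[OF assms] simp del: index_mult_mat(1))

text \<open>One fixed diagonalisation of each output: \<open>p\<close> and \<open>U\<close> for the
  output of N, \<open>q\<close> and \<open>W\<close> for that of M. They are later instantiated with
  the diagonalisations behind \<open>mfun\<close>, so that the relative entropy is expressed in the
  same data.\<close>

locale output_pair =
  fixes a b c :: nat and N M :: "complex mat \<Rightarrow> complex mat" and \<rho> :: "complex mat"
    and U W :: "nat \<Rightarrow> nat \<Rightarrow> complex" and p q :: "nat \<Rightarrow> real"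
  assumes N: "channel a b N" and M: "channel a b M" and \<rho>: "density (a * c) \<rho>"
    and U: "unitary_ker {..<b * c} U" and W: "unitary_ker {..<b * c} W"
    and r: "\<And>x y. x < b * c \<Longrightarrow> y < b * c \<Longrightarrow> tensor_map a b c c N (\<lambda>X. X) \<rho> $$ (x, y)
       = (\<Sum>m<b * c. complex_of_real (p m) * U x m * cnj (U y m))"
    and s: "\<And>x y. x < b * c \<Longrightarrow> y < b * c \<Longrightarrow> tensor_map a b c c M (\<lambda>X. X) \<rho> $$ (x, y)
       = (\<Sum>m<b * c. complex_of_real (q m) * W x m * cnj (W y m))"
    and p: "\<And>m. m < b * c \<Longrightarrow> 0 \<le> p m" and q: "\<And>m. m < b * c \<Longrightarrow> 0 \<le> q m"
begin

abbreviation R :: "complex mat" where "R \<equiv> tensor_map a b c c N (\<lambda>X. X) \<rho>"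
abbreviation S :: "complex mat" where "S \<equiv> tensor_map a b c c M (\<lambda>X. X) \<rho>"

text \<open>Diagonal entry of \<open>R\<close> at the eigenvector w_j of \<open>S\<close>, that is,
  the distribution of measuring \<open>R\<close> in the eigenbasis of \<open>S\<close>. It turns
  Tr(R log S) into a classical mean.\<close>

definition P :: "nat \<Rightarrow> real" where
  "P j = (\<Sum>m<b * c. p m * (cmod (ip {..<b * c} (\<lambda>x. U x m) (\<lambda>x. W x j)))\<^sup>2)"

lemma form_R:
  "form {..<b * c} (\<lambda>x y. R $$ (x, y)) f f
    = complex_of_real (\<Sum>m<b * c. p m * (cmod (ip {..<b * c} (\<lambda>x. U x m) f))\<^sup>2)"
  using r by (intro form_spectral) auto

lemma form_R_U: "k < b * c \<Longrightarrow> form {..<b * c} (\<lambda>x y. R $$ (x, y)) (\<lambda>x. U x k) (\<lambda>x. U x k) = complex_of_real (p k)"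
proof -
  assume k: "k < b * c"
  have "(\<Sum>m<b * c. p m * (cmod (ip {..<b * c} (\<lambda>x. U x m) (\<lambda>x. U x k)))\<^sup>2) = (\<Sum>m<b * c. if m = k then p m else 0)"
    using ip_unitary[OF U] k by (intro sum.cong refl) auto
  then show ?thesis unfolding form_R using k by simp
qed

lemma P_nonneg: "0 \<le> P j"
  unfolding P_def using p by (auto intro!: sum_nonneg)

lemma p_sum: "(\<Sum>m<b * c. p m) = 1"
proof -
  have "complex_of_real (\<Sum>m<b * c. p m) = (\<Sum>x<b * c. R $$ (x, x))"
    using r by (subst unitary_ker_trace[OF U, where d = "\<lambda>m. complex_of_real (p m)"]) auto
  also have "\<dots> = 1"
    using tensor_map_id_trace[OF N] \<rho> psd_carrier[of "a * c" \<rho>] unfolding density_def mtrace_def by auto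
  finally show ?thesis by (simp only: of_real_eq_1_iff)
qed

lemma P_sum: "(\<Sum>j<b * c. P j) = 1"
proof -
  have "(\<Sum>j<b * c. P j) = (\<Sum>m<b * c. p m * (\<Sum>j<b * c. (cmod (ip {..<b * c} (\<lambda>x. W x j) (\<lambda>x. U x m)))\<^sup>2))"
    unfolding P_def sum_distrib_left
    by (subst sum.swap) (simp add: ip_cnj[symmetric, of _ "\<lambda>x. U x _"])
  also have "\<dots> = (\<Sum>m<b * c. p m)"
    unfolding parseval[OF W finite_lessThan] using unitary_ker_norm[OF U] by simp
  finally show ?thesis using p_sum by simp
qed

text \<open>\<open>exp g\<close> only has to dominate the eigenvalues q, which allows any finite
  exponent at a zero eigenvalue. \<open>h\<close> is the exponent of the rank of the first
  projection and \<open>s'\<close> that of the eigenvalues kept by the second. The choice of \<eta>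
  makes 1 - 4 \<eta> - \<epsilon> equal to (1 - \<epsilon>) / 2.\<close>

lemma Dmax_lower:
  fixes n :: nat
  assumes \<epsilon>: "\<epsilon> < 1" and g: "\<And>j. j < b * c \<Longrightarrow> q j \<le> exp (g j)"
    and H: "0 \<le> \<eta>" "8 * \<eta> = 1 - \<epsilon>"
    and tail1: "(\<Sum>z\<in>{z \<in> multi n (b * c). real n * h < (\<Sum>t<n. - ln_supp (p (z t)))}. \<Prod>t<n. p (z t)) \<le> \<eta>"
    and tail2: "(\<Sum>z\<in>{z \<in> multi n (b * c). real n * s' < (\<Sum>t<n. g (z t))}. \<Prod>t<n. P (z t)) \<le> \<eta>"
  shows "ereal (ln ((1 - \<epsilon>) / 2) - real n * (h + s'))
     \<le> Dmax_eps (a ^ n) (b ^ n) \<epsilon> (tpow a b N n) (tpow a b M n)"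
proof -
  let ?Z = "multi n (b * c)"
  \<comment> \<open>Since \<open>ln_supp 0 = 0\<close>, tuples with a zero eigenvalue would pass the
    entropy condition unnoticed and spoil the count of \<open>G1\<close>. They are excluded
    explicitly.\<close>
  define G1 where "G1 = {z \<in> ?Z. (\<forall>t<n. 0 < p (z t)) \<and> (\<Sum>t<n. - ln_supp (p (z t))) \<le> real n * h}"
  define G2 where "G2 = {z \<in> ?Z. (\<Sum>t<n. g (z t)) \<le> real n * s'}"
  have G: "G1 \<subseteq> ?Z" "G2 \<subseteq> ?Z" by (auto simp: G1_def G2_def)
  have all1: "(\<Sum>z\<in>?Z. \<Prod>t<n. p (z t)) = 1" "(\<Sum>z\<in>?Z. \<Prod>t<n. P (z t)) = 1"
    using sum_multi_prod[where f = "\<lambda>t. p"] sum_multi_prod[where f = "\<lambda>t. P"] p_sum P_sum by auto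
  have pp: "0 \<le> (\<Prod>t<n. p (z t))" if "z \<in> ?Z" for z using p multiD[OF that] by (intro prod_nonneg) auto
  have e1: "1 - (\<Sum>z\<in>G1. \<Prod>t<n. p (z t)) \<le> \<eta>"
  proof -
    let ?B = "{z \<in> ?Z. real n * h < (\<Sum>t<n. - ln_supp (p (z t)))}"
    have "1 - (\<Sum>z\<in>G1. \<Prod>t<n. p (z t)) = (\<Sum>z\<in>?Z - G1. \<Prod>t<n. p (z t))"
      using all1 G by (simp add: sum_diff)
    \<comment> \<open>A tuple outside both \<open>G1\<close> and the tail fails only positivity, so
      its weight has a zero factor.\<close>
    also have "\<dots> = (\<Sum>z\<in>(?Z - G1) \<inter> ?B. \<Prod>t<n. p (z t))"
    proof (rule sum.mono_neutral_right)
      show "\<forall>z\<in>?Z - G1 - (?Z - G1) \<inter> ?B. (\<Prod>t<n. p (z t)) = 0"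
      proof
        fix z assume z: "z \<in> ?Z - G1 - (?Z - G1) \<inter> ?B"
        then obtain t where t: "t < n" "\<not> 0 < p (z t)" unfolding G1_def by (auto simp: not_less)
        then have "p (z t) = 0" using p[of "z t"] multiD[of z n "b * c" t] z by fastforce
        then show "(\<Prod>t<n. p (z t)) = 0" using t by auto
      qed
    qed auto
    also have "\<dots> \<le> (\<Sum>z\<in>?B. \<Prod>t<n. p (z t))"
      using pp by (intro sum_mono2) auto
    finally show ?thesis using tail1 by linarith
  qed
  have e2: "1 - (\<Sum>z\<in>G2. \<Prod>t<n. P (z t)) \<le> \<eta>"
  proof -
    have "1 - (\<Sum>z\<in>G2. \<Prod>t<n. P (z t)) = (\<Sum>z\<in>?Z - G2. \<Prod>t<n. P (z t))"
      using all1 G by (simp add: sum_diff)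
    also have "?Z - G2 = {z \<in> ?Z. real n * s' < (\<Sum>t<n. g (z t))}" by (auto simp: G2_def)
    finally show ?thesis using tail2 by linarith
  qed
  \<comment> \<open>Counting by weight: every tuple in \<open>G1\<close> has probability at least
    exp(-n h), and the total is at most 1.\<close>
  have card: "card G1 \<le> exp (real n * h)"
  proof -
    have "card G1 * exp (- (real n * h)) = (\<Sum>z\<in>G1. exp (- (real n * h)))" by simp
    also have "\<dots> \<le> (\<Sum>z\<in>G1. \<Prod>t<n. p (z t))"
    proof (rule sum_mono)
      fix z assume z: "z \<in> G1"
      have "exp (- (real n * h)) \<le> exp (\<Sum>t<n. ln_supp (p (z t)))"
        using z by (simp add: G1_def sum_negf)
      also have "\<dots> = (\<Prod>t<n. p (z t))"
        unfolding exp_sum[OF finite_lessThan] using z by (intro prod.cong refl) (auto simp: G1_def ln_supp_def)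
      finally show "exp (- (real n * h)) \<le> (\<Prod>t<n. p (z t))" .
    qed
    also have "\<dots> \<le> 1" unfolding all1(1)[symmetric] using G pp by (intro sum_mono2) auto
    finally show ?thesis by (simp add: exp_minus field_simps)
  qed
  have B: "(\<Prod>t<n. q (z t)) \<le> exp (real n * s')" if z: "z \<in> G2" for z
  proof -
    have "(\<Prod>t<n. q (z t)) \<le> (\<Prod>t<n. exp (g (z t)))"
      using g q z multiD[of z n "b * c"] by (intro prod_mono) (auto simp: G2_def)
    also have "\<dots> = exp (\<Sum>t<n. g (z t))" by (simp add: exp_sum)
    also have "\<dots> \<le> exp (real n * s')" using z by (simp add: G2_def)
    finally show ?thesis .
  qed
  show ?thesis
    unfolding Dmax_eps_def
  proof (rule Inf_greatest, clarify)
    fix N' assume N': "channel (a ^ n) (b ^ n) N'"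
      and dia: "diamond (a ^ n) (b ^ n) (\<lambda>X. N' X - tpow a b N n X) / 2 \<le> \<epsilon>"
    define Ts where "Ts = {t::real. comp_pos (a ^ n) (b ^ n) (\<lambda>X. complex_of_real t \<cdot>\<^sub>m tpow a b M n X - N' X)}"
    \<comment> \<open>Written as an exponential so that the lower bound on \<open>Inf Ts\<close> is
      visibly positive, as monotonicity of \<open>ln\<close> requires.\<close>
    have t: "exp (ln ((1 - \<epsilon>) / 2) - real n * (h + s')) \<le> t" if "t \<in> Ts" for t
    proof -
      have "1 - 4 * \<eta> - \<epsilon> \<le> t * (card G1 * exp (real n * s'))"
      proof (rule hypothesis_test_bound[OF N M \<rho> N' dia _ U W r s p _ G B _ q e1 e2])
        show "form {..<b * c} (\<lambda>x y. R $$ (x, y)) (\<lambda>x. W x j) (\<lambda>x. W x j) = complex_of_real (P j)" for j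
          unfolding form_R P_def ..
        show "comp_pos (a ^ n) (b ^ n) (\<lambda>X. complex_of_real t \<cdot>\<^sub>m tpow a b M n X - N' X)"
          using that by (simp add: Ts_def)
        show "0 < 1 - 4 * \<eta> - \<epsilon>" using H \<epsilon> by argo
      qed auto
      moreover have "1 - 4 * \<eta> - \<epsilon> = (1 - \<epsilon>) / 2" using H by argo
      ultimately have *: "(1 - \<epsilon>) / 2 \<le> t * (card G1 * exp (real n * s'))" by simp
      have "0 < t"
      proof (rule ccontr)
        assume "\<not> 0 < t"
        then have "t * (card G1 * exp (real n * s')) \<le> 0" by (intro mult_nonpos_nonneg) auto
        then show False using * \<epsilon> by argo
      qed
      then have "t * (card G1 * exp (real n * s')) \<le> t * (exp (real n * h) * exp (real n * s'))"
        using card by (intro mult_left_mono mult_right_mono) auto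
      with * have "(1 - \<epsilon>) / 2 \<le> t * exp (real n * (h + s'))"
        by (simp add: exp_add[symmetric] algebra_simps)
      then show ?thesis using \<epsilon> by (simp add: exp_diff divide_le_eq)
    qed
    show "ereal (ln ((1 - \<epsilon>) / 2) - real n * (h + s')) \<le> Dmax (a ^ n) (b ^ n) N' (tpow a b M n)"
    proof (cases "Ts = {}")
      case True
      then show ?thesis unfolding Dmax_def Let_def Ts_def by simp
    next
      case False
      have "exp (ln ((1 - \<epsilon>) / 2) - real n * (h + s')) \<le> Inf Ts"
        using False t by (intro cInf_greatest) auto
      then have "ln (exp (ln ((1 - \<epsilon>) / 2) - real n * (h + s'))) \<le> ln (Inf Ts)"
        by (intro ln_mono) (auto intro: less_le_trans[OF exp_gt_zero])
      then show ?thesis using False unfolding Dmax_def Let_def Ts_def by simp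
    qed
  qed
qed

text \<open>Both tails decay geometrically, hence eventually fall below the constant \<eta>. The
  prefactor (1 - \<epsilon>) / 2 contributes a term of order 1/n to the rate, so the limit does not
  depend on \<epsilon>.\<close>

theorem liminf_Dmax_eps:
  fixes g :: "nat \<Rightarrow> real"
  assumes \<epsilon>: "\<epsilon> < 1" and g: "\<And>j. j < b * c \<Longrightarrow> q j \<le> exp (g j)"
  shows "ereal ((\<Sum>m<b * c. p m * ln_supp (p m)) - (\<Sum>j<b * c. P j * g j))
    \<le> liminf (\<lambda>n. ereal (1 / real n) * Dmax_eps (a ^ n) (b ^ n) \<epsilon> (tpow a b N n) (tpow a b M n))"
    (is "ereal ?D \<le> liminf ?x")
proof (rule ereal_le_epsilon2)
  fix e :: real assume e: "0 < e"
  \<comment> \<open>One third each for the slack in \<open>h\<close>, the slack in \<open>s'\<close>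
    and the vanishing term ln((1 - \<epsilon>) / 2) / n.\<close>
  define \<delta> where "\<delta> = e / 3"
  have \<delta>: "0 < \<delta>" using e by (simp add: \<delta>_def)
  define \<eta> where "\<eta> = (1 - \<epsilon>) / 8"
  have \<eta>: "0 < \<eta>" "8 * \<eta> = 1 - \<epsilon>" using \<epsilon> by (auto simp: \<eta>_def)
  define h where "h = (\<Sum>i<b * c. p i * - ln_supp (p i)) + \<delta>"
  define s' where "s' = (\<Sum>i<b * c. P i * g i) + \<delta>"
  obtain \<kappa>1 where \<kappa>1: "0 \<le> \<kappa>1" "\<kappa>1 < 1"
    "\<forall>n. (\<Sum>z\<in>{z \<in> multi n (b * c). real n * h < (\<Sum>t<n. - ln_supp (p (z t)))}. \<Prod>t<n. p (z t)) \<le> \<kappa>1 ^ n"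
    unfolding h_def using chernoff_tail[OF p p_sum \<delta>] .
  obtain \<kappa>2 where \<kappa>2: "0 \<le> \<kappa>2" "\<kappa>2 < 1"
    "\<forall>n. (\<Sum>z\<in>{z \<in> multi n (b * c). real n * s' < (\<Sum>t<n. g (z t))}. \<Prod>t<n. P (z t)) \<le> \<kappa>2 ^ n"
    unfolding s'_def using chernoff_tail[OF P_nonneg P_sum \<delta>] .
  have "eventually (\<lambda>n. \<kappa>1 ^ n < \<eta>) sequentially" "eventually (\<lambda>n. \<kappa>2 ^ n < \<eta>) sequentially"
    using \<kappa>1 \<kappa>2 \<eta> by (auto intro!: order_tendstoD(2)[OF LIMSEQ_power_zero])
  moreover have "eventually (\<lambda>n. - \<delta> < ln ((1 - \<epsilon>) / 2) / real n) sequentially"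
    using \<delta> by (intro order_tendstoD(1)[OF lim_const_over_n]) auto
  moreover have "eventually (\<lambda>n. n > 0) sequentially" by (rule eventually_gt_at_top)
  ultimately have "eventually (\<lambda>n. ereal (?D - e) \<le> ?x n) sequentially"
  proof eventually_elim
    case (elim n)
    let ?y = "ln ((1 - \<epsilon>) / 2) - real n * (h + s')"
    have "ereal ?y \<le> Dmax_eps (a ^ n) (b ^ n) \<epsilon> (tpow a b N n) (tpow a b M n)"
      using \<epsilon> g \<eta> \<kappa>1(3)[rule_format, of n] \<kappa>2(3)[rule_format, of n] elim
      by (intro Dmax_lower[where \<eta> = \<eta> and g = g]) auto
    then have "ereal (1 / real n) * ereal ?y \<le> ?x n"
      by (intro ereal_mult_left_mono) auto
    moreover have "1 / real n * ?y = ln ((1 - \<epsilon>) / 2) / real n - (h + s')"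
      using elim(4) by (simp add: field_simps)
    moreover have "?D - e \<le> ln ((1 - \<epsilon>) / 2) / real n - (h + s')"
    proof -
      have "h + s' = - ?D + 2 * \<delta>" by (simp add: h_def s'_def sum_negf)
      moreover have "e = 3 * \<delta>" by (simp add: \<delta>_def)
      ultimately show ?thesis using elim(3) by argo
    qed
    ultimately have "ereal (?D - e) \<le> ereal (1 / real n) * ereal ?y"
      unfolding times_ereal.simps(1) ereal_less_eq(3) by simp
    then show ?case using \<open>ereal (1 / real n) * ereal ?y \<le> ?x n\<close> by (rule order_trans)
  qed
  then have "ereal (?D - e) \<le> liminf ?x" by (rule Liminf_bounded)
  then have "ereal (?D - e) + ereal e \<le> liminf ?x + ereal e" by (intro add_right_mono)
  then show "ereal ?D \<le> liminf ?x + ereal e" by simp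
qed

text \<open>Contraposition: if \<open>P j = 0\<close> whenever \<open>q j = 0\<close>, then every
  eigenvector of \<open>R\<close> with positive eigenvalue is orthogonal to those w_j. A vector in
  the kernel of \<open>S\<close> has components only along them, so \<open>R\<close> annihilates it
  as well.\<close>

lemma kernel_not_subset:
  assumes "\<not> mat_kernel S \<subseteq> mat_kernel R"
  shows "\<exists>j<b * c. q j = 0 \<and> 0 < P j"
proof (rule ccontr)
  assume "\<not> ?thesis"
  then have z: "P j = 0" if "j < b * c" "q j = 0" for j using P_nonneg[of j] that by force
  let ?I = "{..<b * c}"
  have Rc: "R \<in> carrier_mat (b * c) (b * c)" and Sc: "S \<in> carrier_mat (b * c) (b * c)"
    by (rule tensor_map_carrier)+
  obtain v where v: "v \<in> mat_kernel S" "v \<notin> mat_kernel R" using assms by auto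
  have vc: "v \<in> carrier_vec (b * c)" and Sv: "S *\<^sub>v v = 0\<^sub>v (b * c)"
    using v(1) Sc unfolding mat_kernel_def by auto
  have "form ?I (\<lambda>x y. S $$ (x, y)) (($) v) (($) v) = (\<Sum>x<b * c. cnj (v $ x) * (S *\<^sub>v v) $ x)"
    unfolding form_def using vc
    by (intro sum.cong refl) (simp add: mult_mat_vec_index_sum[OF Sc] sum_distrib_left mult.assoc del: index_mult_mat_vec)
  also have "\<dots> = 0" unfolding Sv by simp
  finally have "complex_of_real (\<Sum>j<b * c. q j * (cmod (ip ?I (\<lambda>x. W x j) (($) v)))\<^sup>2) = 0"
    using s by (subst form_spectral[symmetric, where Y = "\<lambda>x y. S $$ (x, y)"]) auto
  then have "\<forall>j\<in>?I. q j * (cmod (ip ?I (\<lambda>x. W x j) (($) v)))\<^sup>2 = 0"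
    using q by (subst (asm) of_real_eq_0_iff, subst (asm) sum_nonneg_eq_0_iff) auto
  then have wv: "ip ?I (\<lambda>x. W x j) (($) v) = 0" if "j < b * c" "q j \<noteq> 0" for j using that by auto
  have uw: "p m = 0 \<or> ip ?I (\<lambda>x. U x m) (\<lambda>x. W x j) = 0" if "j < b * c" "q j = 0" "m < b * c" for m j
  proof -
    have "\<forall>m\<in>?I. p m * (cmod (ip ?I (\<lambda>x. U x m) (\<lambda>x. W x j)))\<^sup>2 = 0"
      using z[OF that(1,2)] p unfolding P_def by (subst (asm) sum_nonneg_eq_0_iff) auto
    then show ?thesis using that by auto
  qed
  have uv: "complex_of_real (p m) * ip ?I (\<lambda>x. U x m) (($) v) = 0" if m: "m < b * c" for m
  proof (subst ip_resolution[OF W finite_lessThan], subst sum_distrib_left, intro sum.neutral ballI)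
    fix j assume "j \<in> ?I"
    then show "complex_of_real (p m) * (ip ?I (\<lambda>x. U x m) (\<lambda>x. W x j) * ip ?I (\<lambda>x. W x j) (($) v)) = 0"
      using wv[of j] uw[of j m] m by (cases "q j = 0") auto
  qed
  have "(R *\<^sub>v v) $ x = 0" if x: "x < b * c" for x
  proof -
    have "(R *\<^sub>v v) $ x = (\<Sum>y<b * c. \<Sum>m<b * c. U x m * (complex_of_real (p m) * (cnj (U y m) * v $ y)))"
      unfolding mult_mat_vec_index_sum[OF Rc vc x] using r[OF x]
      by (intro sum.cong refl) (simp add: sum_distrib_right sum_distrib_left mult_ac)
    also have "\<dots> = (\<Sum>m<b * c. U x m * (complex_of_real (p m) * ip ?I (\<lambda>x. U x m) (($) v)))"
      unfolding ip_def sum_distrib_left by (rule sum.swap)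
    also have "\<dots> = 0" by (intro sum.neutral ballI) (use uv in auto)
    finally show ?thesis .
  qed
  then have "v \<in> mat_kernel R" unfolding mat_kernel_def using vc Rc by (auto intro!: eq_vecI)
  then show False using v(2) by simp
qed

lemma liminf_infinite:
  assumes \<epsilon>: "\<epsilon> < 1" and j: "j < b * c" "q j = 0" "0 < P j"
  shows "liminf (\<lambda>n. ereal (1 / real n) * Dmax_eps (a ^ n) (b ^ n) \<epsilon> (tpow a b N n) (tpow a b M n)) = \<infinity>"
proof (rule ereal_top)
  fix B :: real
  define A where "A = (\<Sum>m<b * c. p m * ln_supp (p m))"
  define C where "C = (\<Sum>i<b * c. P i * ln_supp (q i))"
  define Q where "Q = (\<Sum>i<b * c. P i * of_bool (q i = 0))"
  have "P j * of_bool (q j = 0) \<le> Q"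
    unfolding Q_def using j P_nonneg by (intro member_le_sum) auto
  then have Q: "0 < Q" using j by simp
  \<comment> \<open>Solves A - (C - K Q) = B, possible because the weight Q of the first output on
    the kernel of the second is positive. At q i = 0 one has g i = -K, and 0 \<le> exp(-K) holds for
    every K.\<close>
  define K where "K = (B - A + C) / Q"
  define g where "g = (\<lambda>i. ln_supp (q i) - K * of_bool (q i = 0))"
  have "ereal (A - (\<Sum>i<b * c. P i * g i))
    \<le> liminf (\<lambda>n. ereal (1 / real n) * Dmax_eps (a ^ n) (b ^ n) \<epsilon> (tpow a b N n) (tpow a b M n))"
    unfolding A_def
  proof (rule liminf_Dmax_eps[OF \<epsilon>])
    fix i assume "i < b * c"
    then show "q i \<le> exp (g i)" using q[of i] by (auto simp: g_def ln_supp_def)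
  qed
  moreover have "(\<Sum>i<b * c. P i * g i) = C - K * Q"
    unfolding C_def Q_def g_def sum_distrib_left sum_subtractf[symmetric]
    by (intro sum.cong refl) (simp add: algebra_simps)
  moreover have "A - (C - K * Q) = B" using Q by (simp add: K_def)
  ultimately show "ereal B \<le> liminf (\<lambda>n. ereal (1 / real n) * Dmax_eps (a ^ n) (b ^ n) \<epsilon> (tpow a b N n) (tpow a b M n))"
    by simp
qed

end

lemma channel_psd:
  "channel a b N \<Longrightarrow> density (a * c) \<rho> \<Longrightarrow> psd (b * c) (tensor_map a b c c N (\<lambda>X. X) \<rho>)"
  unfolding channel_def comp_pos_def density_def by blast

text \<open>Tr(R log R) is evaluated in the basis U and Tr(R log S) in the basis W, giving the sum
  of p ln p minus the sum of P ln q. With g = ln q on the support this is the exponent already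
  bounded; a violated kernel inclusion falls under the infinite case.\<close>

theorem rel_ent_le_liminf:
  assumes \<epsilon>: "\<epsilon> < 1" and N: "channel a b N" and M: "channel a b M" and \<rho>: "density (a * c) \<rho>"
  shows "rel_ent (tensor_map a b c c N (\<lambda>X. X) \<rho>) (tensor_map a b c c M (\<lambda>X. X) \<rho>)
    \<le> liminf (\<lambda>n. ereal (1 / real n) * Dmax_eps (a ^ n) (b ^ n) \<epsilon> (tpow a b N n) (tpow a b M n))"
proof -
  let ?d = "b * c" and ?R = "tensor_map a b c c N (\<lambda>X. X) \<rho>" and ?S = "tensor_map a b c c M (\<lambda>X. X) \<rho>"
  obtain U p where U: "unitary_ker {..<?d} U"
    and r[rule_format]: "\<forall>x<?d. \<forall>y<?d. ?R $$ (x, y) = (\<Sum>m<?d. complex_of_real (p m) * U x m * cnj (U y m))"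
    and lr[rule_format]: "\<forall>x<?d. \<forall>y<?d. mfun ln_supp ?R $$ (x, y) = (\<Sum>m<?d. complex_of_real (ln_supp (p m)) * U x m * cnj (U y m))"
    and lrc: "mfun ln_supp ?R \<in> carrier_mat ?d ?d" and p[rule_format]: "\<forall>m<?d. 0 \<le> p m"
    using psd_mfun[OF channel_psd[OF N \<rho>], of ln_supp] .
  obtain W q where W: "unitary_ker {..<?d} W"
    and s[rule_format]: "\<forall>x<?d. \<forall>y<?d. ?S $$ (x, y) = (\<Sum>m<?d. complex_of_real (q m) * W x m * cnj (W y m))"
    and ls[rule_format]: "\<forall>x<?d. \<forall>y<?d. mfun ln_supp ?S $$ (x, y) = (\<Sum>m<?d. complex_of_real (ln_supp (q m)) * W x m * cnj (W y m))"
    and lsc: "mfun ln_supp ?S \<in> carrier_mat ?d ?d" and q[rule_format]: "\<forall>m<?d. 0 \<le> q m"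
    using psd_mfun[OF channel_psd[OF M \<rho>], of ln_supp] .
  interpret output_pair a b c N M \<rho> U W p q
    using N M \<rho> U W r s p q by unfold_locales
  show ?thesis
  proof (cases "mat_kernel ?S \<subseteq> mat_kernel ?R")
    case True
    let ?K = "\<lambda>x y. ?R $$ (x, y)"
    have "mtrace (?R * (mfun ln_supp ?R - mfun ln_supp ?S))
      = ktrace {..<?d} ?K (\<lambda>x y. (mfun ln_supp ?R - mfun ln_supp ?S) $$ (x, y))"
      using lrc lsc by (intro mtrace_mult tensor_map_carrier) auto
    also have "\<dots> = ktrace {..<?d} ?K (\<lambda>x y. mfun ln_supp ?R $$ (x, y) - mfun ln_supp ?S $$ (x, y))"
      using lrc lsc by (intro ktrace_cong) auto
    also have "\<dots> = ktrace {..<?d} ?K (\<lambda>x y. mfun ln_supp ?R $$ (x, y)) - ktrace {..<?d} ?K (\<lambda>x y. mfun ln_supp ?S $$ (x, y))"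
      by (rule ktrace_diff)
    also have "ktrace {..<?d} ?K (\<lambda>x y. mfun ln_supp ?R $$ (x, y))
      = (\<Sum>k<?d. complex_of_real (ln_supp (p k)) * form {..<?d} ?K (\<lambda>x. U x k) (\<lambda>x. U x k))"
      using lr by (intro ktrace_spectral) auto
    also have "\<dots> = complex_of_real (\<Sum>k<?d. p k * ln_supp (p k))"
      unfolding of_real_sum using form_R_U by (intro sum.cong refl) simp
    also have "ktrace {..<?d} ?K (\<lambda>x y. mfun ln_supp ?S $$ (x, y))
      = (\<Sum>k<?d. complex_of_real (ln_supp (q k)) * form {..<?d} ?K (\<lambda>x. W x k) (\<lambda>x. W x k))"
      using ls by (intro ktrace_spectral) auto
    also have "\<dots> = complex_of_real (\<Sum>k<?d. P k * ln_supp (q k))"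
      unfolding form_R P_def[symmetric] of_real_sum by (intro sum.cong refl) simp
    finally have "rel_ent ?R ?S = ereal ((\<Sum>k<?d. p k * ln_supp (p k)) - (\<Sum>k<?d. P k * ln_supp (q k)))"
      unfolding rel_ent_def using True by simp
    \<comment> \<open>Equality for positive eigenvalues; at a zero eigenvalue \<open>ln_supp\<close>
      gives 0 and the claim reads 0 \<le> 1.\<close>
    moreover have "q k \<le> exp (ln_supp (q k))" if "k < ?d" for k
      using q[OF that] by (auto simp: ln_supp_def)
    ultimately show ?thesis using liminf_Dmax_eps[OF \<epsilon>, of "\<lambda>k. ln_supp (q k)"] by simp
  next
    case False
    then obtain j where "j < ?d" "q j = 0" "0 < P j" using kernel_not_subset by auto
    then show ?thesis using liminf_infinite[OF \<epsilon>] by simp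
  qed
qed

theorem mainTheorem5:
  fixes dA dB :: nat and \<epsilon> :: real and N M :: "complex mat \<Rightarrow> complex mat"
  assumes "0 < \<epsilon>" "\<epsilon> < 1" "dA > 0" "dB > 0"
    and "channel dA dB N" "channel dA dB M"
  shows "liminf (\<lambda>n. ereal (1 / real n) * Dmax_eps (dA ^ n) (dB ^ n) \<epsilon> (tpow dA dB N n) (tpow dA dB M n))
           \<ge> chan_rel_ent dA dB N M"
  unfolding chan_rel_ent_def
  by (rule Sup_least) (use rel_ent_le_liminf[OF assms(2,5,6)] in auto)

end
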